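(* Let $n\ge 1$ and let $T$ be a triangulated $(n+3)$-gon with diagonals labelled $1,\dots,n$ and boundary sides labelled $n+1,\dots,2n+3$, such that the quiver $Q=Q_T$ is acyclic with underlying graph the path $1 - 2 - \cdots - n$. Let $\mathcal{A}(\overline{Q})$ be the cluster algebra with coefficients of the ice quiver $\overline{Q}=\overline{Q}_T$, with initial seed $((x_1,\dots,x_{2n+3}),\overline{Q})$. For $1\le i\le j\le n$ let $f^{[i,j]}\in\mathbb{Z}[x_1,\dots,x_{2n+3}]$ be the numerator of the cluster variable $\frac{f^{[i,j]}}{x_ix_{i+1}\cdots x_j}$ of $\mathcal{A}(\overline{Q})$. Then for all $1\le i\le j\le n$, $$f^{[i,j]}=\sum_{A\in\mathbb{A}(T^{[i,j]})}\ \prod_{a\in A}x_a,$$ where $\mathbb{A}(T^{[i,j]})$ is the set of perfect matchings of angles in $T^{[i,j]}$ and, for an angle $a$ of a triangle of $T^{[i,j]}$, $x_a$ is the element of $\{x_1,\dots,x_{2n+3}\}$ indexed by the side opposite to $a$ in that triangle.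
   Context: Quivers from triangulations. Let $T$ be a triangulated (convex, planar) $(n+3)$-gon, with $n$ diagonals $1,\dots,n$ and boundary sides (boundary arcs) $n+1,\dots,2n+3$. The quiver $Q_T$ has vertices $1,\dots,n$ and an arrow $i\to j$ whenever the diagonals $i,j$ are sides of a common triangle of $T$ and $j$ follows $i$ in the clockwise order on the boundary of that triangle. The ice quiver $\overline{Q}_T$ is obtained from $Q_T$ by adding a vertex for each boundary arc and adding, by the same rule, the arrows between diagonals and boundary arcs lying in a common triangle (no arrows between two boundary arcs). The frozen vertices are $n+1,\dots,2n+3$. Cluster algebra. A seed is a pair $(x,R)$ where $R$ is a quiver on $\{1,\dots,m\}$ without loops and $2$-cycles, with no arrows between the frozen vertices $n+1,\dots,m$, and $x=(x_1,\dots,x_m)$ is a free generating set of the field $\mathbb{Q}(t_1,\dots,t_m)$ over $\mathbb{Q}$. Mutation at $k\in\{1,\dots,n\}$ gives $(x',R')$: $R'$ is obtained by adding an arrow $i\to j$ for each path $i\to k\to j$, reversing all arrows at $k$, removing a maximal set of disjoint $2$-cycles, and removing all arrows between frozen vertices; $x'_i=x_i$ for $i\ne k$ and $x_kx'_k=\prod_{(j\to k)\in R_1}x_j+\prod_{(k\to j)\in R_1}x_j$. The cluster variables are the elements $x_1,\dots,x_n$ of all seeds obtained from the initial seed by sequences of mutations; the coefficients are $x_{n+1},\dots,x_m$. $\mathcal{A}$ is the $\mathbb{Z}$-subalgebra generated by all cluster variables and coefficients. Here $m=2n+3$. Known fact used as definition of $f^{[i,j]}$: the non-initial cluster variables of $\mathcal{A}(\overline{Q})$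 are indexed by pairs $1\le i\le j\le n$, the pair $(i,j)$ corresponding to the unique cluster variable of the form $f^{[i,j]}/(x_ix_{i+1}\cdots x_j)$ with $f^{[i,j]}\in\mathbb{Z}[x_1,\dots,x_{2n+3}]$ not divisible by any of $x_1,\dots,x_n$. Subpolygon. $T^{[i,j]}$ is the triangulated subpolygon of $T$ whose set of diagonals is $\{i,i+1,\dots,j\}$, i.e. the union of the triangles of $T$ having at least one side in $\{i,\dots,j\}$; its sides keep their labels from $T$. Perfect matchings of angles. For a triangulated polygon $T$, a perfect matching of angles in $T$ is a selection of marked angles (an angle being an angle of a triangle of $T$ at one of its vertices), exactly one marked angle at each vertex of the polygon incident to at least one diagonal (and none at other vertices), such that each triangle of $T$ has exactly one marked angle. $\mathbb{A}(T)$ is the set of all of them. *)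

theory Defs
  imports Complex_Main "HOL-Library.Poly_Mapping"
begin

section \<open>Polynomials in variables indexed by natural numbers\<close>

text \<open>A polynomial maps monomials (finitely supported exponent vectors) to coefficients.\<close>

type_synonym 'c mpoly = "(nat \<Rightarrow>\<^sub>0 nat) \<Rightarrow>\<^sub>0 'c"

definition Var :: "nat \<Rightarrow> 'c::zero_neq_one mpoly" where
  "Var i = Poly_Mapping.single (Poly_Mapping.single i 1) 1"

definition indets :: "'c::zero mpoly \<Rightarrow> nat set" where
  "indets p = (\<Union>\<mu>\<in>Poly_Mapping.keys p. Poly_Mapping.keys \<mu>)"

text \<open>Evaluation at \<open>x\<close>, with the coefficients mapped into the target by \<open>h\<close>.\<close>

definition eval_mpoly :: "('c::zero \<Rightarrow> 'a) \<Rightarrow> (nat \<Rightarrow> 'a) \<Rightarrow> 'c mpoly \<Rightarrow> 'a::comm_ring_1" where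
  "eval_mpoly h x p =
     (\<Sum>\<mu>\<in>Poly_Mapping.keys p. h (Poly_Mapping.lookup p \<mu>) *
        (\<Prod>i\<in>Poly_Mapping.keys \<mu>. x i ^ Poly_Mapping.lookup \<mu> i))"

text \<open>
  The family \<open>x\<close>, restricted to \<open>I\<close>, is algebraically independent over the rationals and
  generates the whole field \<open>'a\<close>. So for \<open>I = {1..m}\<close> the type \<open>'a\<close> is a copy of the field of
  rational functions in \<open>m\<close> variables over the rationals.
\<close>

definition free_generating_set :: "nat set \<Rightarrow> (nat \<Rightarrow> 'a::field_char_0) \<Rightarrow> bool" where
  "free_generating_set I x \<longleftrightarrow>
     (\<forall>p::rat mpoly. indets p \<subseteq> I \<longrightarrow> eval_mpoly of_rat x p = 0 \<longrightarrow> p = 0) \<and>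
     (\<forall>y. \<exists>p q::rat mpoly. indets p \<subseteq> I \<and> indets q \<subseteq> I \<and>
        eval_mpoly of_rat x q \<noteq> 0 \<and> y = eval_mpoly of_rat x p / eval_mpoly of_rat x q)"


section \<open>Seeds, mutations and cluster variables\<close>

text \<open>
  \<open>R i j\<close> is the number of arrows from \<open>i\<close> to \<open>j\<close>. The vertices are \<open>1, \<dots>, m\<close>, of which
  \<open>n+1, \<dots>, m\<close> are frozen. In a seed \<open>(x, R)\<close> only the values of \<open>x\<close> on \<open>{1..m}\<close> matter.
\<close>

type_synonym quiver = "nat \<Rightarrow> nat \<Rightarrow> nat"
type_synonym 'a seed = "(nat \<Rightarrow> 'a) \<times> quiver"

definition ice_quiver :: "nat \<Rightarrow> nat \<Rightarrow> quiver \<Rightarrow> bool" where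
  "ice_quiver n m R \<longleftrightarrow> n \<le> m \<and>
     (\<forall>i j. R i j > 0 \<longrightarrow> i \<in> {1..m} \<and> j \<in> {1..m}) \<and>
     (\<forall>i. R i i = 0) \<and>
     (\<forall>i j. R i j = 0 \<or> R j i = 0) \<and>
     (\<forall>i j. i > n \<and> j > n \<longrightarrow> R i j = 0)"

definition is_seed :: "nat \<Rightarrow> nat \<Rightarrow> 'a::field_char_0 seed \<Rightarrow> bool" where
  "is_seed n m S \<longleftrightarrow> free_generating_set {1..m} (fst S) \<and> ice_quiver n m (snd S)"

text \<open>
  The four steps: complete the paths \<open>i \<rightarrow> k \<rightarrow> j\<close>; reverse the arrows at \<open>k\<close>; cancel a maximal
  set of disjoint 2-cycles; delete the arrows between frozen vertices.
\<close>

definition mutate_quiver :: "nat \<Rightarrow> nat \<Rightarrow> quiver \<Rightarrow> quiver" where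
  "mutate_quiver n k R =
     (let R1 = (\<lambda>i j. R i j + R i k * R k j);
          R2 = (\<lambda>i j. if i = k \<or> j = k then R1 j i else R1 i j);
          R3 = (\<lambda>i j. R2 i j - min (R2 i j) (R2 j i))
      in (\<lambda>i j. if i > n \<and> j > n then 0 else R3 i j))"

definition mutate :: "nat \<Rightarrow> nat \<Rightarrow> nat \<Rightarrow> 'a::field_char_0 seed \<Rightarrow> 'a seed" where
  "mutate n m k S =
     (let x = fst S; R = snd S
      in (x(k := ((\<Prod>j=1..m. x j ^ R j k) + (\<Prod>j=1..m. x j ^ R k j)) / x k),
          mutate_quiver n k R))"

inductive_set reachable_seeds :: "nat \<Rightarrow> nat \<Rightarrow> 'a::field_char_0 seed \<Rightarrow> 'a seed set"
  for n m :: nat and S\<^sub>0 :: "'a seed"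
  where
    initial: "S\<^sub>0 \<in> reachable_seeds n m S\<^sub>0"
  | step: "S \<in> reachable_seeds n m S\<^sub>0 \<Longrightarrow> k \<in> {1..n} \<Longrightarrow> mutate n m k S \<in> reachable_seeds n m S\<^sub>0"

definition cluster_variables :: "nat \<Rightarrow> nat \<Rightarrow> 'a::field_char_0 seed \<Rightarrow> 'a set" where
  "cluster_variables n m S\<^sub>0 = {fst S k | S k. S \<in> reachable_seeds n m S\<^sub>0 \<and> k \<in> {1..n}}"

text \<open>
  \<open>f / (x\<^sub>i \<cdots> x\<^sub>j)\<close> is a cluster variable, where \<open>f\<close> is an integer polynomial in
  \<open>x\<^sub>1, \<dots>, x\<^sub>m\<close> not divisible by any of \<open>x\<^sub>1, \<dots>, x\<^sub>n\<close>.
\<close>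

definition is_numerator ::
    "nat \<Rightarrow> nat \<Rightarrow> 'a::field_char_0 seed \<Rightarrow> nat \<Rightarrow> nat \<Rightarrow> int mpoly \<Rightarrow> bool" where
  "is_numerator n m S\<^sub>0 i j f \<longleftrightarrow>
     indets f \<subseteq> {1..m} \<and>
     (\<forall>k\<in>{1..n}. \<not> Var k dvd f) \<and>
     eval_mpoly of_int (fst S\<^sub>0) f / (\<Prod>k=i..j. fst S\<^sub>0 k) \<in> cluster_variables n m S\<^sub>0"

definition numerator :: "nat \<Rightarrow> nat \<Rightarrow> 'a::field_char_0 seed \<Rightarrow> nat \<Rightarrow> nat \<Rightarrow> int mpoly" where
  "numerator n m S\<^sub>0 i j = (THE f. is_numerator n m S\<^sub>0 i j f)"


section \<open>Triangulated polygons\<close>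

text \<open>
  The vertices of a convex \<open>N\<close>-gon are \<open>0, \<dots>, N-1\<close>, numbered in clockwise order; a side or a
  diagonal is the set of its two endpoints.
\<close>

definition polygon_sides :: "nat \<Rightarrow> nat set set" where
  "polygon_sides N = {{v, (v + 1) mod N} | v. v < N}"

definition polygon_diagonals :: "nat \<Rightarrow> nat set set" where
  "polygon_diagonals N = {{v, w} | v w. v < N \<and> w < N \<and> v \<noteq> w} - polygon_sides N"

definition clockwise :: "nat \<Rightarrow> nat \<Rightarrow> nat \<Rightarrow> bool" where
  "clockwise a b c \<longleftrightarrow> a < b \<and> b < c \<or> b < c \<and> c < a \<or> c < a \<and> a < b"

definition crossing :: "nat set \<Rightarrow> nat set \<Rightarrow> bool" where
  "crossing s t \<longleftrightarrow>
     (\<exists>a b c d. s = {a, b} \<and> t = {c, d} \<and> clockwise a c b \<and> clockwise b d a)"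

text \<open>A triangulation is a maximal set of pairwise non-crossing diagonals.\<close>

definition triangulation :: "nat \<Rightarrow> nat set set \<Rightarrow> bool" where
  "triangulation N D \<longleftrightarrow>
     D \<subseteq> polygon_diagonals N \<and>
     (\<forall>s\<in>D. \<forall>t\<in>D. \<not> crossing s t) \<and>
     (\<forall>s\<in>polygon_diagonals N - D. \<exists>t\<in>D. crossing s t)"

text \<open>\<open>e l\<close> is the diagonal (\<open>l \<le> n\<close>) or the boundary side (\<open>l > n\<close>) labelled \<open>l\<close>.\<close>

definition labelled_triangulation :: "nat \<Rightarrow> (nat \<Rightarrow> nat set) \<Rightarrow> bool" where
  "labelled_triangulation n e \<longleftrightarrow>
     inj_on e {1..n} \<and> triangulation (n + 3) (e ` {1..n}) \<and>
     bij_betw e {n+1..2*n+3} (polygon_sides (n + 3))"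

text \<open>
  All vertices lie on the boundary of the convex polygon, so any three vertices that are pairwise
  joined by sides or by diagonals of \<open>T\<close> span a triangle of \<open>T\<close>.
\<close>

definition triangles :: "nat \<Rightarrow> (nat \<Rightarrow> nat set) \<Rightarrow> nat set set" where
  "triangles n e =
     {{a, b, c} | a b c. clockwise a b c \<and> {{a, b}, {b, c}, {c, a}} \<subseteq> e ` {1..2*n+3}}"

text \<open>
  \<open>i\<close> and \<open>j\<close> are sides of a common triangle and \<open>j\<close> follows \<open>i\<close> clockwise on its boundary.
\<close>

definition follows :: "nat \<Rightarrow> (nat \<Rightarrow> nat set) \<Rightarrow> nat \<Rightarrow> nat \<Rightarrow> bool" where
  "follows n e i j \<longleftrightarrow>
     (\<exists>a b c. {a, b, c} \<in> triangles n e \<and> clockwise a b c \<and> e i = {a, b} \<and> e j = {b, c})"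

definition Q_of :: "nat \<Rightarrow> (nat \<Rightarrow> nat set) \<Rightarrow> quiver" where
  "Q_of n e i j = (if i \<in> {1..n} \<and> j \<in> {1..n} \<and> follows n e i j then 1 else 0)"

definition Qbar_of :: "nat \<Rightarrow> (nat \<Rightarrow> nat set) \<Rightarrow> quiver" where
  "Qbar_of n e i j =
     (if i \<in> {1..2*n+3} \<and> j \<in> {1..2*n+3} \<and> (i \<le> n \<or> j \<le> n) \<and> follows n e i j then 1 else 0)"

definition acyclic_path_quiver :: "nat \<Rightarrow> quiver \<Rightarrow> bool" where
  "acyclic_path_quiver n Q \<longleftrightarrow>
     acyclic {(i, j). Q i j > 0} \<and>
     (\<forall>i\<in>{1..n}. \<forall>j\<in>{1..n}. Q i j + Q j i = (if j = i + 1 \<or> i = j + 1 then 1 else 0))"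

lemma ice_quiver_Qbar_of: "ice_quiver n (2*n+3) (Qbar_of n e)"
proof -
  have asym: "\<not> (follows n e i j \<and> follows n e j i)" for i j
  proof
    assume "follows n e i j \<and> follows n e j i"
    then obtain a b c a' b' c' where
      1: "clockwise a b c" "e i = {a, b}" "e j = {b, c}" and
      2: "clockwise a' b' c'" "e j = {a', b'}" "e i = {b', c'}"
      unfolding follows_def by blast
    have "{a, b} = {b', c'}" "{b, c} = {a', b'}"
      using 1 2 by simp_all
    then have "clockwise c b a \<or> a = c"
      using 2(1) by (auto simp: doubleton_eq_iff)
    with 1(1) show False
      by (auto simp: clockwise_def)
  qed
  show ?thesis
    using asym unfolding ice_quiver_def Qbar_of_def by auto
qed

text \<open>
  In particular, requiring \<open>(x, Qbar_of n e)\<close> to be a seed is only a condition on \<open>x\<close>.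
\<close>

lemma is_seed_Qbar_of_iff:
  "is_seed n (2*n+3) (x, Qbar_of n e) \<longleftrightarrow> free_generating_set {1..2*n+3} x"
  by (simp add: is_seed_def ice_quiver_Qbar_of)


section \<open>Perfect matchings of angles\<close>

text \<open>
  An angle of a triangulated polygon, given by its set \<open>\<T>\<close> of triangles, is a pair consisting of
  a triangle and one of its vertices; \<open>D\<close> is the set of diagonals of the polygon.
\<close>

type_synonym angle = "nat set \<times> nat"

definition angles :: "nat set set \<Rightarrow> angle set" where
  "angles \<T> = {(\<Delta>, v). \<Delta> \<in> \<T> \<and> v \<in> \<Delta>}"

definition angle_matchings :: "nat set set \<Rightarrow> nat set set \<Rightarrow> angle set set" where
  "angle_matchings \<T> D = {A. A \<subseteq> angles \<T> \<and>
     (\<forall>v\<in>\<Union>\<T>. if v \<in> \<Union>D then \<exists>!a. a \<in> A \<and> snd a = v else \<not> (\<exists>a\<in>A. snd a = v)) \<and>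
     (\<forall>\<Delta>\<in>\<T>. \<exists>!a. a \<in> A \<and> fst a = \<Delta>)}"

definition subpolygon_diagonals :: "(nat \<Rightarrow> nat set) \<Rightarrow> nat \<Rightarrow> nat \<Rightarrow> nat set set" where
  "subpolygon_diagonals e i j = e ` {i..j}"

definition subpolygon_triangles :: "nat \<Rightarrow> (nat \<Rightarrow> nat set) \<Rightarrow> nat \<Rightarrow> nat \<Rightarrow> nat set set" where
  "subpolygon_triangles n e i j = {\<Delta> \<in> triangles n e. \<exists>k\<in>{i..j}. e k \<subseteq> \<Delta>}"

definition opposite_label :: "nat \<Rightarrow> (nat \<Rightarrow> nat set) \<Rightarrow> angle \<Rightarrow> nat" where
  "opposite_label n e a = the_inv_into {1..2*n+3} e (fst a - {snd a})"

end

(*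
  Put the vertices of the polygon at vectors p_v of a plane over the ambient field such that
  det(p_v, p_w) = x_l for every side or diagonal {v, w} of T with label l; such vectors are found
  triangle by triangle.  The Pluecker relations make all the determinants det(p_v, p_w) satisfy the
  Ptolemy relations.  Since a mutation is a flip of a diagonal, every seed is given by the
  determinants along some triangulation, so every cluster variable is the determinant of a diagonal.

  As the quiver is a path, T is a chain of triangles D_0, ..., D_n with D_(k-1) and D_k meeting along
  the diagonal k.  A diagonal outside T joins the tip u_i of D_(i-1) to the tip w_j of D_j for
  exactly one pair i <= j, and crosses the diagonals i, ..., j.  Expanding over the angle marked in
  the last triangle, the matching sum obeys the same recursion as x_i ... x_j det(p_(u_i), p_(w_j)).
  It is not divisible by x_k because it is positive at x_k = 0 and all other variables 1.
  Algebraic independence then identifies the numerator.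
*)
theory Submission
  imports Defs
begin

section \<open>Polynomials\<close>

text \<open>Two obstacles shape the argument. The numerator is a definite description, so exhibiting
  one cluster variable is not enough: all of them must be known, to exclude a second polynomial over
  the same denominator. And following arbitrary mutations means dividing by determinants of
  arbitrary chords, which must first be nonzero. The matching formula itself supplies this: it
  writes the determinant of a chord outside T as the value of a nonzero polynomial at algebraically
  independent elements, divided by initial variables.

  The recursion closes only for a wider family of sums: a run of triangles is matched at all its
  vertices except the tip of the first triangle and one further, arbitrary vertex v. Two omitted
  vertices leave as many vertices as triangles. The value is the determinant of the omitted pair
  times those of the hinges; adding a triangle is Ptolemy's relation if v is the new tip, and
  multiplication by one factor otherwise.

  Conversely, the chord from u_i to w_j is reached by flipping i, ..., j in this order, which grows
  a fan at u_i.\<close>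

abbreviation eval :: "(nat \<Rightarrow> 'a::comm_ring_1) \<Rightarrow> int mpoly \<Rightarrow> 'a" where
  "eval x p \<equiv> eval_mpoly of_int x p"

definition eval_monom :: "(nat \<Rightarrow> 'a::comm_ring_1) \<Rightarrow> (nat \<Rightarrow>\<^sub>0 nat) \<Rightarrow> 'a" where
  "eval_monom x \<mu> = (\<Prod>i\<in>Poly_Mapping.keys \<mu>. x i ^ Poly_Mapping.lookup \<mu> i)"

text \<open>A finite index set larger than the keys can be shared by several monomials, and below by
  several polynomials, even where a sum loses keys by cancellation.\<close>

lemma eval_monom_superset:
  assumes "finite K" "Poly_Mapping.keys \<mu> \<subseteq> K"
  shows "eval_monom x \<mu> = (\<Prod>i\<in>K. x i ^ Poly_Mapping.lookup \<mu> i)"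
  unfolding eval_monom_def
  by (rule prod.mono_neutral_left) (use assms in \<open>auto simp: in_keys_iff\<close>)

lemma eval_monom_add: "eval_monom x (\<mu> + \<nu>) = eval_monom x \<mu> * eval_monom x \<nu>"
proof -
  let ?K = "Poly_Mapping.keys \<mu> \<union> Poly_Mapping.keys \<nu>"
  have "Poly_Mapping.keys (\<mu> + \<nu>) \<subseteq> ?K" by (rule keys_add)
  then show ?thesis
    by (simp add: eval_monom_superset[of ?K] lookup_add power_add prod.distrib)
qed

lemma eval_superset:
  assumes "finite K" "Poly_Mapping.keys p \<subseteq> K"
  shows "eval x p = (\<Sum>\<mu>\<in>K. of_int (Poly_Mapping.lookup p \<mu>) * eval_monom x \<mu>)"
  unfolding eval_mpoly_def eval_monom_def
  by (rule sum.mono_neutral_left) (use assms in \<open>auto simp: in_keys_iff\<close>)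

lemma eval_0 [simp]: "eval x 0 = 0"
  by (simp add: eval_mpoly_def)

lemma eval_add [simp]: "eval x (p + q) = eval x p + eval x q"
proof -
  let ?K = "Poly_Mapping.keys p \<union> Poly_Mapping.keys q"
  have "Poly_Mapping.keys (p + q) \<subseteq> ?K" by (rule keys_add)
  then show ?thesis
    by (simp add: eval_superset[of ?K] lookup_add distrib_right sum.distrib)
qed

lemma eval_single: "eval x (Poly_Mapping.single \<mu> c) = of_int c * eval_monom x \<mu>"
  by (subst eval_superset[of "{\<mu>}"]) auto

lemma eval_sum [simp]: "eval x (\<Sum>i\<in>A. f i) = (\<Sum>i\<in>A. eval x (f i))"
  by (induction A rule: infinite_finite_induct) simp_all

lemma mpoly_eq_sum: "p = (\<Sum>\<mu>\<in>Poly_Mapping.keys p. Poly_Mapping.single \<mu> (Poly_Mapping.lookup p \<mu>))"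
  by (rule poly_mapping_eqI)
     (auto simp: lookup_sum lookup_single when_def in_keys_iff)

lemma eval_mult [simp]: "eval x (p * q) = eval x p * eval x q"
proof -
  let ?s = "\<lambda>p \<mu>. Poly_Mapping.single \<mu> (Poly_Mapping.lookup p \<mu>) :: int mpoly"
  have "eval x (p * q) = eval x ((\<Sum>\<mu>\<in>Poly_Mapping.keys p. ?s p \<mu>) * (\<Sum>\<nu>\<in>Poly_Mapping.keys q. ?s q \<nu>))"
    by (simp only: mpoly_eq_sum[symmetric])
  also have "\<dots> = (\<Sum>\<mu>\<in>Poly_Mapping.keys p. \<Sum>\<nu>\<in>Poly_Mapping.keys q. eval x (?s p \<mu>) * eval x (?s q \<nu>))"
    by (simp add: sum_product mult_single eval_single eval_monom_add mult_ac)
  also have "\<dots> = (\<Sum>\<mu>\<in>Poly_Mapping.keys p. eval x (?s p \<mu>)) * (\<Sum>\<nu>\<in>Poly_Mapping.keys q. eval x (?s q \<nu>))"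
    by (simp add: sum_product)
  also have "\<dots> = eval x p * eval x q"
    by (simp only: mpoly_eq_sum[symmetric] flip: eval_sum)
  finally show ?thesis .
qed

lemma eval_1 [simp]: "eval x 1 = 1"
  using eval_single[of x 0 1] by (simp add: eval_monom_def)

lemma eval_Var [simp]: "eval x (Var i) = x i"
  by (simp add: Var_def eval_single eval_monom_def)

lemma eval_prod [simp]: "eval x (\<Prod>i\<in>A. f i) = (\<Prod>i\<in>A. eval x (f i))"
  by (induction A rule: infinite_finite_induct) simp_all

section \<open>Divisibility by a variable, read off the exponents\<close>

lemma Var_dvd_iff:
  "Var k dvd (f :: int mpoly) \<longleftrightarrow> (\<forall>\<nu>\<in>Poly_Mapping.keys f. 1 \<le> Poly_Mapping.lookup \<nu> k)"
proof
  assume "Var k dvd f"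
  then obtain g where g: "f = Var k * g" by blast
  show "\<forall>\<nu>\<in>Poly_Mapping.keys f. 1 \<le> Poly_Mapping.lookup \<nu> k"
    using keys_mult[of "Var k" g] by (fastforce simp: g Var_def lookup_add)
next
  assume *: "\<forall>\<nu>\<in>Poly_Mapping.keys f. 1 \<le> Poly_Mapping.lookup \<nu> k"
  have "Var k dvd (\<Sum>\<nu>\<in>Poly_Mapping.keys f. Poly_Mapping.single \<nu> (Poly_Mapping.lookup f \<nu>))"
  proof (rule dvd_sum)
    fix \<nu> assume \<nu>: "\<nu> \<in> Poly_Mapping.keys f"
    let ?\<mu> = "Poly_Mapping.single k 1 :: nat \<Rightarrow>\<^sub>0 nat"
    \<comment> \<open>Subtraction of exponents is truncated; it is exact here because the exponent
      of \<open>k\<close> is at least 1.\<close>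
    have "\<nu> = ?\<mu> + (\<nu> - ?\<mu>)"
      by (rule poly_mapping_eqI) (use * \<nu> in \<open>auto simp: lookup_add lookup_minus lookup_single when_def\<close>)
    then have "Poly_Mapping.single \<nu> (Poly_Mapping.lookup f \<nu>) =
        Var k * Poly_Mapping.single (\<nu> - ?\<mu>) (Poly_Mapping.lookup f \<nu>)"
      by (simp add: Var_def mult_single)
    then show "Var k dvd Poly_Mapping.single \<nu> (Poly_Mapping.lookup f \<nu>)" by simp
  qed
  then show "Var k dvd f" by (simp only: mpoly_eq_sum[symmetric])
qed

text \<open>Multiplication by a variable shifts exponents injectively, so no coefficients merge or
  cancel. This is why a variable other than \<open>Var l\<close> that divides
  \<open>f * Var l\<close> already divides \<open>f\<close>.\<close>

lemma lookup_mult_Var: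
  "Poly_Mapping.lookup (f * Var l) (\<nu> + Poly_Mapping.single l 1) = Poly_Mapping.lookup (f :: int mpoly) \<nu>"
proof -
  let ?\<mu> = "Poly_Mapping.single l 1 :: nat \<Rightarrow>\<^sub>0 nat"
  have "f * Var l = (\<Sum>\<mu>\<in>Poly_Mapping.keys f. Poly_Mapping.single \<mu> (Poly_Mapping.lookup f \<mu>)) * Var l"
    by (simp only: mpoly_eq_sum[symmetric])
  also have "\<dots> = (\<Sum>\<mu>\<in>Poly_Mapping.keys f. Poly_Mapping.single (\<mu> + ?\<mu>) (Poly_Mapping.lookup f \<mu>))"
    by (simp add: sum_distrib_right Var_def mult_single)
  finally show ?thesis
    by (simp add: lookup_sum lookup_single when_def in_keys_iff)
qed

lemma Var_dvd_mult_Var: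
  assumes "Var k dvd (f * Var l :: int mpoly)" "k \<noteq> l"
  shows "Var k dvd f"
  unfolding Var_dvd_iff
proof
  fix \<nu> assume "\<nu> \<in> Poly_Mapping.keys f"
  then have "\<nu> + Poly_Mapping.single l 1 \<in> Poly_Mapping.keys (f * Var l)"
    by (metis in_keys_iff lookup_mult_Var)
  then have "1 \<le> Poly_Mapping.lookup (\<nu> + Poly_Mapping.single l 1) k"
    using assms(1) by (auto simp: Var_dvd_iff)
  then show "1 \<le> Poly_Mapping.lookup \<nu> k"
    using assms(2) by (simp add: lookup_add lookup_single)
qed

text \<open>Serves to compare two fractions with monomial denominators: a variable missing from
  \<open>S\<close> can only come from the other factor.\<close>

lemma Var_dvd_mult_prod_Var:
  assumes "Var k dvd (f * (\<Prod>l\<in>S. Var l) :: int mpoly)" "k \<notin> S"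
  shows "Var k dvd f"
  using assms
proof (induction S arbitrary: f rule: infinite_finite_induct)
  case (insert l S)
  have "Var k dvd (f * Var l) * (\<Prod>l\<in>S. Var l)"
    using insert.prems(1) insert.hyps by (simp add: mult.assoc)
  then have "Var k dvd f * Var l"
    using insert.IH insert.prems(2) by blast
  then show ?case using insert.prems(2) Var_dvd_mult_Var by blast
qed simp_all

lemma eval_Var_dvd:
  assumes "Var k dvd p" "x k = 0"
  shows "eval x p = 0"
  using assms by (elim dvdE) simp

section \<open>Occurring variables and algebraic independence\<close>

lemma indets_Var: "indets (Var i :: int mpoly) \<subseteq> {i}"
  by (simp add: indets_def Var_def)

lemma indets_mult:
  assumes "indets (p :: int mpoly) \<subseteq> I" "indets q \<subseteq> I" shows "indets (p * q) \<subseteq> I"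
proof -
  have "Poly_Mapping.keys \<rho> \<subseteq> I" if "\<rho> \<in> Poly_Mapping.keys (p * q)" for \<rho>
  proof -
    obtain \<mu> \<nu> where "\<rho> = \<mu> + \<nu>" "\<mu> \<in> Poly_Mapping.keys p" "\<nu> \<in> Poly_Mapping.keys q"
      using keys_mult[of p q] \<open>\<rho> \<in> Poly_Mapping.keys (p * q)\<close> by blast
    then show ?thesis using keys_add[of \<mu> \<nu>] assms unfolding indets_def by blast
  qed
  then show ?thesis unfolding indets_def by blast
qed

lemma indets_add:
  assumes "indets (p :: int mpoly) \<subseteq> I" "indets q \<subseteq> I" shows "indets (p + q) \<subseteq> I"
  using assms keys_add[of p q] unfolding indets_def by blast

lemma indets_sum:
  assumes "\<And>i. i \<in> A \<Longrightarrow> indets (f i :: int mpoly) \<subseteq> I" shows "indets (\<Sum>i\<in>A. f i) \<subseteq> I"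
  using assms by (induction A rule: infinite_finite_induct) (simp_all add: indets_add, simp_all add: indets_def)

lemma indets_prod:
  assumes "\<And>i. i \<in> A \<Longrightarrow> indets (f i :: int mpoly) \<subseteq> I" shows "indets (\<Prod>i\<in>A. f i) \<subseteq> I"
  using assms by (induction A rule: infinite_finite_induct) (simp_all add: indets_mult, simp_all add: indets_def)

lemma indets_uminus: "indets (- p :: int mpoly) = indets p"
  by (simp add: indets_def)

lemma free_generating_set_eval_eq_0:
  fixes p :: "int mpoly" and x :: "nat \<Rightarrow> 'a::field_char_0"
  assumes "free_generating_set I x" "indets p \<subseteq> I" "eval x p = 0"
  shows "p = 0"
proof -
  \<comment> \<open>Independence is formulated over the rationals; since integers embed into them,
    passing to rational coefficients keeps the support.\<close>
  let ?q = "Poly_Mapping.map of_int p :: rat mpoly"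
  have lookup_q: "Poly_Mapping.lookup ?q \<mu> = of_int (Poly_Mapping.lookup p \<mu>)" for \<mu>
    by (simp add: map.rep_eq when_def)
  have keys_q: "Poly_Mapping.keys ?q = Poly_Mapping.keys p"
    by (auto simp: in_keys_iff lookup_q)
  have "eval_mpoly of_rat x ?q = eval x p"
    by (simp add: eval_mpoly_def keys_q lookup_q)
  moreover have "indets ?q \<subseteq> I"
    using assms(2) by (simp add: indets_def keys_q)
  ultimately have "?q = 0"
    using assms by (simp add: free_generating_set_def)
  then show "p = 0"
    by (metis keys_eq_empty keys_q)
qed

lemma free_generating_set_eval_inj:
  fixes p q :: "int mpoly" and x :: "nat \<Rightarrow> 'a::field_char_0"
  assumes "free_generating_set I x" "indets p \<subseteq> I" "indets q \<subseteq> I" "eval x p = eval x q"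
  shows "p = q"
proof -
  have "eval x (p + (- q)) = eval x (q + (- q))"
    using assms(4) by (simp only: eval_add)
  moreover have "indets (p + (- q)) \<subseteq> I"
    using assms by (intro indets_add) (simp_all add: indets_uminus)
  ultimately show ?thesis
    using free_generating_set_eval_eq_0[OF assms(1), of "p + (- q)"] by simp
qed

section \<open>Triangulations as maximal families of non-crossing chords\<close>

text \<open>Phrased over the reals, statements about cyclic order on natural numbers are decided by \<open>argo\<close>.\<close>

lemmas nat_order_real = of_nat_less_iff[where 'a=real, symmetric] of_nat_eq_iff[where 'a=real, symmetric]

lemma clockwise_rotate: "clockwise a b c \<Longrightarrow> clockwise b c a"
  unfolding clockwise_def by blast

lemma clockwise_distinct: "clockwise a b c \<Longrightarrow> a \<noteq> b \<and> b \<noteq> c \<and> c \<noteq> a"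
  unfolding clockwise_def nat_order_real by argo

lemma clockwise_total: "a \<noteq> b \<Longrightarrow> b \<noteq> c \<Longrightarrow> c \<noteq> a \<Longrightarrow> clockwise a b c \<or> clockwise c b a"
  unfolding clockwise_def nat_order_real by argo

lemma clockwise_trans: "clockwise a b c \<Longrightarrow> clockwise a c d \<Longrightarrow> clockwise a b d"
  unfolding clockwise_def nat_order_real by argo

text \<open>Crossing as a relation on endpoints instead of edge sets. It contains no quantifier, so
  statements about it are decided as pure order facts; degenerate chords with \<open>a = b\<close>
  or \<open>c = d\<close> separate nothing.\<close>

definition separates :: "nat \<Rightarrow> nat \<Rightarrow> nat \<Rightarrow> nat \<Rightarrow> bool" where
  "separates a b c d \<longleftrightarrow> clockwise a c b \<and> clockwise b d a \<or> clockwise a d b \<and> clockwise b c a"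

lemma separates_sym: "separates a b c d \<longleftrightarrow> separates c d a b"
  unfolding separates_def clockwise_def nat_order_real by argo

lemma separates_swap: "separates a b c d \<longleftrightarrow> separates b a c d" "separates a b c d \<longleftrightarrow> separates a b d c"
  unfolding separates_def by auto

lemma separates_cong:
  assumes "{a, b} = {a', b'}" "{c, d} = {c', d'}"
  shows "separates a b c d \<longleftrightarrow> separates a' b' c' d'"
  using assms unfolding separates_def doubleton_eq_iff by (elim disjE conjE) (simp_all, blast+)

lemma crossing_iff: "crossing {a, b} {c, d} \<longleftrightarrow> separates a b c d"
  unfolding crossing_def separates_def doubleton_eq_iff by blast

text \<open>Sides and diagonals are kept in one set, so that arguments about triangles and flips
  treat both kinds of edge alike.\<close>

definition full_triangulation :: "nat \<Rightarrow> nat set set \<Rightarrow> bool" where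
  "full_triangulation N E \<longleftrightarrow>
     (\<forall>s\<in>E. \<exists>v w. v < N \<and> w < N \<and> v \<noteq> w \<and> s = {v, w}) \<and>
     polygon_sides N \<subseteq> E \<and>
     (\<forall>a b c d. {a, b} \<in> E \<longrightarrow> {c, d} \<in> E \<longrightarrow> \<not> separates a b c d) \<and>
     (\<forall>a b. a < N \<longrightarrow> b < N \<longrightarrow> a \<noteq> b \<longrightarrow> {a, b} \<notin> E \<longrightarrow> (\<exists>c d. {c, d} \<in> E \<and> separates a b c d))"

lemma full_triangulation_edgeE:
  assumes "full_triangulation N E" "s \<in> E"
  obtains v w where "v < N" "w < N" "v \<noteq> w" "s = {v, w}"
proof -
  have "\<forall>s\<in>E. \<exists>v w. v < N \<and> w < N \<and> v \<noteq> w \<and> s = {v, w}"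
    using assms(1) unfolding full_triangulation_def by (rule conjunct1)
  then show thesis using assms(2) that by blast
qed

lemma full_triangulation_edge:
  assumes "full_triangulation N E" "{a, b} \<in> E"
  shows "a < N \<and> b < N \<and> a \<noteq> b"
  using assms by (elim full_triangulation_edgeE) (auto simp: doubleton_eq_iff)

lemma full_triangulation_sides: "full_triangulation N E \<Longrightarrow> polygon_sides N \<subseteq> E"
  unfolding full_triangulation_def by (elim conjE)

lemma full_triangulationI:
  assumes "\<And>s. s \<in> E \<Longrightarrow> \<exists>v w. v < N \<and> w < N \<and> v \<noteq> w \<and> s = {v, w}"
    and "polygon_sides N \<subseteq> E"
    and "\<And>a b c d. {a, b} \<in> E \<Longrightarrow> {c, d} \<in> E \<Longrightarrow> \<not> separates a b c d"
    and "\<And>a b. a < N \<Longrightarrow> b < N \<Longrightarrow> a \<noteq> b \<Longrightarrow> {a, b} \<notin> E \<Longrightarrow> \<exists>c d. {c, d} \<in> E \<and> separates a b c d"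
  shows "full_triangulation N E"
  unfolding full_triangulation_def using assms by (intro conjI allI impI ballI) auto

lemma full_triangulation_non_crossing:
  "full_triangulation N E \<Longrightarrow> {a, b} \<in> E \<Longrightarrow> {c, d} \<in> E \<Longrightarrow> \<not> separates a b c d"
  unfolding full_triangulation_def by blast

lemma full_triangulation_maximal:
  "full_triangulation N E \<Longrightarrow> a < N \<Longrightarrow> b < N \<Longrightarrow> a \<noteq> b \<Longrightarrow> {a, b} \<notin> E \<Longrightarrow>
    \<exists>c d. {c, d} \<in> E \<and> separates a b c d"
  unfolding full_triangulation_def by blast

section \<open>Sides of the polygon, and the link to triangulations by diagonals\<close>

lemma polygon_side_cases:
  assumes "s \<in> polygon_sides N"
  obtains v where "Suc v < N" "s = {v, Suc v}" | "0 < N" "s = {0, N - 1}"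
proof -
  obtain v where v: "v < N" "s = {v, (v + 1) mod N}"
    using assms unfolding polygon_sides_def by blast
  show thesis
  proof (cases "Suc v < N")
    case True
    then show ?thesis using that(1)[of v] v by simp
  next
    case False
    then have "v = N - 1" "Suc v = N" using v by auto
    then show ?thesis using that(2) v by auto
  qed
qed

lemma polygon_side_Suc: "Suc v < N \<Longrightarrow> {v, Suc v} \<in> polygon_sides N"
  unfolding polygon_sides_def by (auto intro!: exI[of _ v])

lemma polygon_side_0: "0 < N \<Longrightarrow> {0, N - 1} \<in> polygon_sides N"
  unfolding polygon_sides_def by (auto intro!: exI[of _ "N - 1"])

text \<open>One of the two arcs bounded by a side contains no vertex, so no chord has an endpoint on
  either side of it.\<close>

lemma polygon_side_not_separates:
  assumes "{a, b} \<in> polygon_sides N" "c < N" "d < N"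
  shows "\<not> separates a b c d"
  using assms(1)
proof (cases rule: polygon_side_cases)
  case (1 v)
  have "\<not> clockwise v c (Suc v)" "\<not> clockwise v d (Suc v)" unfolding clockwise_def by auto
  then show ?thesis using separates_cong[OF 1(2) refl, of c d] unfolding separates_def by blast
next
  case 2
  have "\<not> clockwise (N - 1) c 0" "\<not> clockwise (N - 1) d 0"
    using assms(2,3) unfolding clockwise_def by auto
  then show ?thesis using separates_cong[OF 2(2) refl, of c d] unfolding separates_def by blast
qed

lemma polygon_side_edge:
  assumes "s \<in> polygon_sides N" "2 \<le> N"
  shows "\<exists>v w. v < N \<and> w < N \<and> v \<noteq> w \<and> s = {v, w}"
  using assms(1)
proof (cases rule: polygon_side_cases)
  case (1 v) then show ?thesis by (intro exI[of _ v] exI[of _ "Suc v"]) simp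
next
  case 2 then show ?thesis using assms(2) by (intro exI[of _ 0] exI[of _ "N - 1"]) simp
qed

lemma full_triangulation_iff:
  assumes "2 \<le> N"
  shows "full_triangulation N E \<longleftrightarrow> polygon_sides N \<subseteq> E \<and> triangulation N (E - polygon_sides N)"
    (is "?L \<longleftrightarrow> ?R")
proof
  assume L: ?L
  let ?D = "E - polygon_sides N"
  have "?D \<subseteq> polygon_diagonals N"
    using full_triangulation_edgeE[OF L] unfolding polygon_diagonals_def by blast
  moreover have "\<not> crossing s t" if st: "s \<in> ?D" "t \<in> ?D" for s t
  proof -
    obtain a b c d where "s = {a, b}" "t = {c, d}"
      using st full_triangulation_edgeE[OF L] by (metis DiffD1)
    then show ?thesis
      using full_triangulation_non_crossing[OF L] st by (auto simp: crossing_iff)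
  qed
  moreover have "\<exists>t\<in>?D. crossing s t" if s: "s \<in> polygon_diagonals N - ?D" for s
  proof -
    obtain a b where ab: "a < N" "b < N" "a \<noteq> b" "s = {a, b}"
      using s unfolding polygon_diagonals_def by blast
    with s have "{a, b} \<notin> E" by (auto simp: polygon_diagonals_def)
    then obtain c d where cd: "{c, d} \<in> E" "separates a b c d"
      using full_triangulation_maximal[OF L] ab by blast
    then have "{c, d} \<notin> polygon_sides N"
      using ab polygon_side_not_separates separates_sym by blast
    then show ?thesis using cd ab by (auto simp: crossing_iff intro!: bexI[of _ "{c, d}"])
  qed
  ultimately show ?R using full_triangulation_sides[OF L] unfolding triangulation_def by blast
next
  assume R: ?R
  then have sub: "polygon_sides N \<subseteq> E" and T: "triangulation N (E - polygon_sides N)" by auto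
  have edge: "\<exists>v w. v < N \<and> w < N \<and> v \<noteq> w \<and> s = {v, w}" if "s \<in> E" for s
  proof (cases "s \<in> polygon_sides N")
    case True
    then show ?thesis using polygon_side_edge assms by blast
  next
    case False
    then have "s \<in> polygon_diagonals N" using T that unfolding triangulation_def by blast
    then show ?thesis unfolding polygon_diagonals_def by blast
  qed
  have bound: "a < N" "b < N" if "{a, b} \<in> E" for a b
    using edge[OF that] by (auto simp: doubleton_eq_iff)
  have "\<not> separates a b c d" if *: "{a, b} \<in> E" "{c, d} \<in> E" for a b c d
  proof (cases "{a, b} \<in> polygon_sides N \<or> {c, d} \<in> polygon_sides N")
    case True
    then show ?thesis
      using polygon_side_not_separates separates_sym bound[OF *(1)] bound[OF *(2)] by blast
  next
    case False
    then show ?thesis using T * unfolding triangulation_def crossing_iff[symmetric] by blast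
  qed
  moreover have "\<exists>c d. {c, d} \<in> E \<and> separates a b c d"
    if ab: "a < N" "b < N" "a \<noteq> b" "{a, b} \<notin> E" for a b
  proof -
    have "{a, b} \<in> polygon_diagonals N - (E - polygon_sides N)"
      using ab sub unfolding polygon_diagonals_def by blast
    then obtain t where t: "t \<in> E" "crossing {a, b} t"
      using T unfolding triangulation_def by blast
    then show ?thesis using edge[OF t(1)] crossing_iff by metis
  qed
  ultimately show ?L using edge sub by (intro full_triangulationI)
qed

text \<open>In this form a flip has three facts to preserve. Injectivity on all labels joins the two
  label ranges, because no diagonal is a side.\<close>

lemma labelled_triangulation_iff:
  "labelled_triangulation n e \<longleftrightarrow>
     full_triangulation (n + 3) (e ` {1..2*n+3}) \<and> inj_on e {1..2*n+3} \<and>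
     e ` {n+1..2*n+3} = polygon_sides (n + 3)" (is "?L \<longleftrightarrow> ?R")
proof -
  let ?S = "polygon_sides (n + 3)"
  have split: "{1..2*n+3} = {1..n} \<union> {n+1..2*n+3}" by auto
  show ?thesis
  proof
    assume L: ?L
    then have S: "e ` {n+1..2*n+3} = ?S" and D: "triangulation (n + 3) (e ` {1..n})"
      and inj: "inj_on e {1..n}" "inj_on e {n+1..2*n+3}"
      by (auto simp: labelled_triangulation_def bij_betw_def)
    have disj: "e ` {1..n} \<inter> ?S = {}"
      using D unfolding triangulation_def polygon_diagonals_def by blast
    then have "e ` {1..2*n+3} - ?S = e ` {1..n}"
      unfolding split image_Un S by blast
    then have "full_triangulation (n + 3) (e ` {1..2*n+3})"
      using D S unfolding full_triangulation_iff[of "n + 3", simplified] split image_Un by simp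
    moreover have "inj_on e {1..2*n+3}"
      unfolding split using inj disj S by (auto simp: inj_on_Un)
    ultimately show ?R using S by blast
  next
    assume R: ?R
    then have S: "e ` {n+1..2*n+3} = ?S" and D: "triangulation (n + 3) (e ` {1..2*n+3} - ?S)"
      and inj: "inj_on e {1..2*n+3}"
      unfolding full_triangulation_iff[of "n + 3", simplified] by auto
    have "e ` {1..n} \<inter> e ` {n+1..2*n+3} = {}"
      using inj_on_image_Int[OF inj, of "{1..n}" "{n+1..2*n+3}"] by auto
    then have "e ` {1..2*n+3} - ?S = e ` {1..n}"
      unfolding split image_Un S by blast
    then show ?L
      using D S inj unfolding labelled_triangulation_def bij_betw_def
      by (auto intro: inj_on_subset)
  qed
qed

text \<open>Of two apexes in the same arc, the edge from \<open>a\<close> to the farther one would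
  cross the edge from the nearer one to \<open>b\<close>.\<close>

lemma apex_unique:
  assumes T: "full_triangulation N E" and "clockwise a c b" "clockwise a d b"
    and "{a, c} \<in> E" "{c, b} \<in> E" "{a, d} \<in> E" "{d, b} \<in> E"
  shows "c = d"
proof (rule ccontr)
  assume "c \<noteq> d"
  then consider "clockwise a c d" | "clockwise a d c"
    using assms(2,3) clockwise_total[of a c d] clockwise_distinct clockwise_rotate by metis
  then show False
  proof cases
    case 1
    then have "separates a d c b"
      using assms(3) unfolding separates_def clockwise_def nat_order_real by argo
    then show False using full_triangulation_non_crossing[OF T] assms by blast
  next
    case 2
    then have "separates a c d b"
      using assms(2) unfolding separates_def clockwise_def nat_order_real by argo
    then show False using full_triangulation_non_crossing[OF T] assms by blast
  qed
qed

text \<open>The number of vertices passed clockwise from \<open>a\<close> measures the distance from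
  \<open>a\<close>; its maximum picks the last neighbour of \<open>a\<close> in an arc.\<close>

lemma card_clockwise_mono:
  assumes "c < N" "clockwise a c p"
  shows "card {v. v < N \<and> clockwise a v c} < card {v. v < (N::nat) \<and> clockwise a v p}"
proof (rule psubset_card_mono)
  have "c \<notin> {v. v < N \<and> clockwise a v c}" by (auto simp: clockwise_def)
  moreover have "c \<in> {v. v < N \<and> clockwise a v p}" using assms by auto
  moreover have "{v. v < N \<and> clockwise a v c} \<subseteq> {v. v < N \<and> clockwise a v p}"
    using assms clockwise_trans by blast
  ultimately show "{v. v < N \<and> clockwise a v c} \<subset> {v. v < N \<and> clockwise a v p}" by blast
qed simp

text \<open>The apex is the last vertex \<open>c\<close> before \<open>b\<close> that is joined to \<open>a\<close>: a chord crossing \<open>{c, b}\<close> could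
  only end in \<open>a\<close>, contradicting this choice.\<close>

lemma apex_exists:
  assumes T: "full_triangulation N E" and ab: "{a, b} \<in> E" and v: "v < N" "clockwise a v b"
  shows "\<exists>c. clockwise a c b \<and> {a, c} \<in> E \<and> {c, b} \<in> E"
proof -
  define C where "C = {c. c < N \<and> clockwise a c b \<and> {a, c} \<in> E}"
  have aN: "a < N" "b < N" using full_triangulation_edge[OF T ab] by auto
  have sides: "polygon_sides N \<subseteq> E" by (rule full_triangulation_sides[OF T])
  \<comment> \<open>The clockwise neighbour of \<open>a\<close> belongs to \<open>C\<close>, being
    joined to \<open>a\<close> by a side; after \<open>N - 1\<close> it is \<open>0\<close>.\<close>
  have "C \<noteq> {}"
  proof (cases "Suc a < N")
    case True
    then have "Suc a \<in> C"
      using sides polygon_side_Suc[OF True] v full_triangulation_edge[OF T ab] ab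
      unfolding C_def clockwise_def by auto
    then show ?thesis by blast
  next
    case False
    then have "a = N - 1" using aN by auto
    then have "0 \<in> C"
      using sides polygon_side_0[of N] v aN
      unfolding C_def clockwise_def by (auto simp: insert_commute)
    then show ?thesis by blast
  qed
  moreover have fin: "finite C" unfolding C_def by simp
  ultimately have "Max ((\<lambda>c. card {v. v < N \<and> clockwise a v c}) ` C) \<in> (\<lambda>c. card {v. v < N \<and> clockwise a v c}) ` C"
    by (intro Max_in) auto
  then obtain c where c: "c \<in> C"
    and c_Max: "card {v. v < N \<and> clockwise a v c} = Max ((\<lambda>c. card {v. v < N \<and> clockwise a v c}) ` C)"
    by force
  have max: "card {v. v < N \<and> clockwise a v p} \<le> card {v. v < N \<and> clockwise a v c}" if "p \<in> C" for p
    unfolding c_Max using fin that by (intro Max_ge) auto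
  have cC: "c < N" "clockwise a c b" "{a, c} \<in> E" using c unfolding C_def by auto
  have "{c, b} \<in> E"
  proof (rule ccontr)
    assume "{c, b} \<notin> E"
    then obtain p q where pq: "{p, q} \<in> E" "clockwise c p b" "clockwise b q c"
      using full_triangulation_maximal[OF T cC(1) aN(2)] clockwise_distinct[OF cC(2)]
      unfolding separates_def by (metis insert_commute)
    have p: "clockwise a p b" "clockwise a c p"
      using pq(2) cC(2) unfolding clockwise_def nat_order_real by argo+
    have "q = a"
    proof (rule ccontr)
      assume "q \<noteq> a"
      then have "separates a b p q \<or> separates a c p q"
        using pq(2,3) cC(2) p unfolding separates_def clockwise_def nat_order_real by argo
      then show False using full_triangulation_non_crossing[OF T] ab cC pq by blast
    qed
    then have "p \<in> C"
      using p(1) pq(1) full_triangulation_edge[OF T pq(1)] unfolding C_def by (simp add: insert_commute)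
    then show False
      using max card_clockwise_mono[OF cC(1) p(2)] by fastforce
  qed
  then show ?thesis using cC by blast
qed

text \<open>One fact about quadrilaterals serves twice: a chord that crosses one diagonal and none
  of the four sides is the other diagonal. Applied to \<open>{b, d}\<close> it shows that nothing
  new crosses, applied to \<open>{a, c}\<close> that the new family is maximal.\<close>

lemma full_triangulation_flip:
  assumes T: "full_triangulation N E"
    and abc: "clockwise a b c" "clockwise c d a"
    and E: "{a, b} \<in> E" "{b, c} \<in> E" "{c, d} \<in> E" "{d, a} \<in> E" "{a, c} \<in> E"
  shows "full_triangulation N (E - {{a, c}} \<union> {{b, d}})" (is "full_triangulation N ?E")
proof -
  have N: "a < N" "b < N" "c < N" "d < N"
    using full_triangulation_edge[OF T] E by blast+
  have bd: "b \<noteq> d" using abc unfolding clockwise_def by auto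
  have "separates a c b d" using abc unfolding separates_def by auto
  then have "{a, c} \<notin> polygon_sides N" using polygon_side_not_separates N by blast
  then have sides: "polygon_sides N \<subseteq> ?E" using full_triangulation_sides[OF T] by blast
  have quad: "{a, b} \<in> ?E" "{b, c} \<in> ?E" "{c, d} \<in> ?E" "{d, a} \<in> ?E"
    using E clockwise_distinct[OF abc(1)] clockwise_distinct[OF abc(2)]
    by (auto simp: doubleton_eq_iff)
  have only: "\<not> separates b d p q" if pq: "{p, q} \<in> E - {{a, c}}" for p q
  proof
    assume sep: "separates b d p q"
    have "\<not> separates a b p q" "\<not> separates b c p q" "\<not> separates c d p q" "\<not> separates d a p q"
      using full_triangulation_non_crossing[OF T] E pq by blast+
    then have "{p, q} = {a, c}"
      using sep abc unfolding separates_def clockwise_def doubleton_eq_iff nat_order_real by argo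
    then show False using pq by blast
  qed
  have E_cases: "s \<in> E - {{a, c}} \<or> s = {b, d}" if "s \<in> ?E" for s using that by auto
  have "\<not> separates p q r s" if A: "{p, q} \<in> ?E" and B: "{r, s} \<in> ?E" for p q r s
  proof -
    consider "{p, q} = {b, d}" "{r, s} = {b, d}" | "{p, q} = {b, d}" "{r, s} \<in> E - {{a, c}}"
      | "{p, q} \<in> E - {{a, c}}" "{r, s} = {b, d}" | "{p, q} \<in> E" "{r, s} \<in> E"
      using E_cases[OF A] E_cases[OF B] by (metis DiffD1)
    then show ?thesis
    proof cases
      case 1
      have "\<not> separates b d b d" unfolding separates_def clockwise_def by simp
      then show ?thesis using separates_cong[OF 1] by simp
    next
      case 2
      then show ?thesis using only[OF 2(2)] separates_cong[OF 2(1) refl] by simp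
    next
      case 3
      then show ?thesis using only[OF 3(1)] separates_cong[OF refl 3(2)] separates_sym by simp
    next
      case 4
      then show ?thesis using full_triangulation_non_crossing[OF T] by blast
    qed
  qed
  moreover have "\<exists>r s. {r, s} \<in> ?E \<and> separates p q r s"
    if pq: "p < N" "q < N" "p \<noteq> q" "{p, q} \<notin> ?E" for p q
  proof (rule ccontr)
    assume "\<not> ?thesis"
    then have none': "\<not> separates p q r s" if "{r, s} \<in> ?E" for r s using that by blast
    \<comment> \<open>A chord that no new edge crosses could be blocked in \<open>E\<close> only by
      the removed \<open>{a, c}\<close>; and it is not \<open>{a, c}\<close> itself, because
      \<open>{b, d}\<close> crosses that.\<close>
    have "separates p q a c"
    proof (cases "{p, q} = {a, c}")
      case True
      then have "separates p q b d"
        using \<open>separates a c b d\<close> separates_cong[OF True refl] by simp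
      then show ?thesis using none' by blast
    next
      case False
      then obtain r s where rs: "{r, s} \<in> E" "separates p q r s"
        using full_triangulation_maximal[OF T] pq by blast
      then have "{r, s} = {a, c}" using none' by blast
      then show ?thesis using rs(2) separates_cong[OF refl] by metis
    qed
    moreover have "\<not> separates p q a b" "\<not> separates p q b c" "\<not> separates p q c d" "\<not> separates p q d a"
      using quad[THEN none'] by simp_all
    ultimately have "{p, q} = {b, d}"
      using abc unfolding separates_def clockwise_def doubleton_eq_iff nat_order_real by argo
    then show False using pq by blast
  qed
  moreover have "\<exists>v w. v < N \<and> w < N \<and> v \<noteq> w \<and> s = {v, w}" if "s \<in> ?E" for s
    using E_cases[OF that] full_triangulation_edgeE[OF T] N bd by (metis DiffD1)
  ultimately show ?thesis using sides by (intro full_triangulationI)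
qed

section \<open>Chord lengths satisfying the Ptolemy relations\<close>

definition det2 :: "'a::comm_ring_1 \<times> 'a \<Rightarrow> 'a \<times> 'a \<Rightarrow> 'a" where
  "det2 p q = fst p * snd q - snd p * fst q"

text \<open>The vertices strictly between \<open>a\<close> and \<open>b\<close> are placed one apex
  at a time, each apex splitting the arc in two. Agreement with \<open>p\<close> off the open arc is
  what lets the two halves be placed independently.\<close>

lemma points_between:
  fixes y :: "nat set \<Rightarrow> 'a::field"
  assumes T: "full_triangulation N E" and y: "\<And>s. s \<in> E \<Longrightarrow> y s \<noteq> 0"
  shows "a < b \<Longrightarrow> {a, b} \<in> E \<Longrightarrow> det2 (p a) (p b) = y {a, b} \<Longrightarrow>
    \<exists>q. (\<forall>v. v \<le> a \<or> b \<le> v \<longrightarrow> q v = p v) \<and>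
      (\<forall>c d. a \<le> c \<and> c < d \<and> d \<le> b \<and> {c, d} \<in> E \<longrightarrow> det2 (q c) (q d) = y {c, d})"
proof (induction "b - a" arbitrary: a b p rule: less_induct)
  case less
  show ?case
  proof (cases "b = Suc a")
    case True
    have "c = a \<and> d = b" if "a \<le> c \<and> c < d \<and> d \<le> b \<and> {c, d} \<in> E" for c d
      using that True by auto
    then show ?thesis using less.prems by (intro exI[of _ p]) blast
  next
    case False
    have "b < N" using full_triangulation_edge[OF T less.prems(2)] by simp
    moreover have "clockwise a (Suc a) b" using False less.prems(1) by (simp add: clockwise_def)
    ultimately obtain c where c: "clockwise a c b" "{a, c} \<in> E" "{c, b} \<in> E"
      using apex_exists[OF T less.prems(2), of "Suc a"] False less.prems(1) by auto
    have ac: "a < c" "c < b" using c(1) less.prems(1) unfolding clockwise_def by linarith+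
    define D where "D = det2 (p a) (p b)"
    have D: "D \<noteq> 0" using y[OF less.prems(2)] less.prems(3) by (simp add: D_def)
    \<comment> \<open>Cramer's rule for the two linear equations
      \<open>det2 (p a) P = y {a, c}\<close> and \<open>det2 P (p b) = y {c, b}\<close>; the
      denominator is \<open>y {a, b}\<close>, which is nonzero.\<close>
    define P where "P = ((y {c, b} * fst (p a) + y {a, c} * fst (p b)) / D,
      (y {c, b} * snd (p a) + y {a, c} * snd (p b)) / D)"
    have "D * det2 (p a) P = D * y {a, c}" "D * det2 P (p b) = D * y {c, b}"
      using D unfolding P_def det2_def by (simp_all add: field_simps) (simp_all add: D_def det2_def algebra_simps)
    then have P: "det2 (p a) P = y {a, c}" "det2 P (p b) = y {c, b}" using D by simp_all
    define p1 where "p1 = p(c := P)"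
    have "\<exists>q. (\<forall>v. v \<le> a \<or> c \<le> v \<longrightarrow> q v = p1 v) \<and>
        (\<forall>v w. a \<le> v \<and> v < w \<and> w \<le> c \<and> {v, w} \<in> E \<longrightarrow> det2 (q v) (q w) = y {v, w})"
      by (rule less.hyps) (use ac c(2) P(1) in \<open>auto simp: p1_def\<close>)
    then obtain q1 where q1: "\<And>v. v \<le> a \<or> c \<le> v \<Longrightarrow> q1 v = p1 v"
      "\<And>v w. a \<le> v \<Longrightarrow> v < w \<Longrightarrow> w \<le> c \<Longrightarrow> {v, w} \<in> E \<Longrightarrow> det2 (q1 v) (q1 w) = y {v, w}"
      by blast
    have q1_cb: "q1 c = P" "q1 b = p b"
      using q1(1)[of c] q1(1)[of b] ac by (simp_all add: p1_def)
    have "\<exists>q. (\<forall>v. v \<le> c \<or> b \<le> v \<longrightarrow> q v = q1 v) \<and>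
        (\<forall>v w. c \<le> v \<and> v < w \<and> w \<le> b \<and> {v, w} \<in> E \<longrightarrow> det2 (q v) (q w) = y {v, w})"
      by (rule less.hyps) (use ac c(3) P(2) q1_cb in auto)
    then obtain q2 where q2: "\<And>v. v \<le> c \<or> b \<le> v \<Longrightarrow> q2 v = q1 v"
      "\<And>v w. c \<le> v \<Longrightarrow> v < w \<Longrightarrow> w \<le> b \<Longrightarrow> {v, w} \<in> E \<Longrightarrow> det2 (q2 v) (q2 w) = y {v, w}"
      by blast
    have "det2 (q2 v) (q2 w) = y {v, w}" if vw: "a \<le> v" "v < w" "w \<le> b" "{v, w} \<in> E" for v w
    proof -
      \<comment> \<open>Cases 3 and 4 would cross an edge of the triangle with apex
        \<open>c\<close>; every other edge lies in one half or is \<open>{a, b}\<close>.\<close>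
      consider "w \<le> c" | "c \<le> v" | "a < v" "v < c" "c < w" | "v = a" "c < w" "w < b" | "v = a" "w = b"
        using vw by linarith
      then show ?thesis
      proof cases
        case 1
        then show ?thesis using q2(1)[of v] q2(1)[of w] q1(2)[OF vw(1,2) _ vw(4)] vw by simp
      next
        case 2
        then show ?thesis using q2(2) vw by simp
      next
        case 3
        then have "separates a c v w" unfolding separates_def clockwise_def by simp
        then show ?thesis using full_triangulation_non_crossing[OF T c(2) vw(4)] by simp
      next
        case 4
        then have "separates c b v w" using ac unfolding separates_def clockwise_def by simp
        then show ?thesis using full_triangulation_non_crossing[OF T c(3) vw(4)] by simp
      next
        case 5
        then show ?thesis
          using q2(1)[of a] q2(1)[of b] q1(1)[of a] q1(1)[of b] ac less.prems(3) by (simp add: p1_def)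
      qed
    qed
    moreover have "q2 v = p v" if "v \<le> a \<or> b \<le> v" for v
      using that ac q2(1)[of v] q1(1)[of v] by (auto simp: p1_def)
    ultimately show ?thesis by blast
  qed
qed

text \<open>\<open>det2\<close> changes sign when its arguments are swapped. Taking the smaller
  vertex first gives an unordered edge a definite sign, and with this choice Ptolemy's relation has
  plus signs wherever the cyclic order is cut.\<close>

definition chord_length :: "(nat \<Rightarrow> 'a \<times> 'a) \<Rightarrow> nat set \<Rightarrow> 'a::comm_ring_1" where
  "chord_length p s = det2 (p (Min s)) (p (Max s))"

lemma chord_length_less: "a < b \<Longrightarrow> chord_length p {a, b} = det2 (p a) (p b)"
  by (simp add: chord_length_def)

lemma ptolemy:
  assumes "clockwise a b c" "clockwise c d a"
  shows "chord_length p {a, c} * chord_length p {b, d} =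
    chord_length p {a, b} * chord_length p {c, d} + chord_length p {b, c} * chord_length p {d, a}"
proof -
  have ptolemy_less: "chord_length p {a, c} * chord_length p {b, d} =
      chord_length p {a, b} * chord_length p {c, d} + chord_length p {b, c} * chord_length p {d, a}"
    if "a < b" "b < c" "c < d" for a b c d
    using that chord_length_less[of a d p]
    by (simp add: chord_length_less insert_commute[of d a] det2_def algebra_simps)
  \<comment> \<open>A cyclic order of four vertices has four linear readings; rotating the names
    merely permutes the terms of the relation.\<close>
  consider "a < b" "b < c" "c < d" | "b < c" "c < d" "d < a" | "c < d" "d < a" "a < b" | "d < a" "a < b" "b < c"
    using assms unfolding clockwise_def by linarith
  then show ?thesis
  proof cases
    case 1 then show ?thesis by (rule ptolemy_less)
  next
    case 2 then show ?thesis using ptolemy_less[of b c d a] by (simp add: insert_commute mult.commute add.commute)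
  next
    case 3 then show ?thesis using ptolemy_less[of c d a b] by (simp add: insert_commute mult.commute add.commute)
  next
    case 4 then show ?thesis using ptolemy_less[of d a b c] by (simp add: insert_commute mult.commute add.commute)
  qed
qed

lemma exists_chord_length:
  fixes y :: "nat set \<Rightarrow> 'a::field"
  assumes T: "full_triangulation N E" and y: "\<And>s. s \<in> E \<Longrightarrow> y s \<noteq> 0" and N: "2 \<le> N"
  obtains p where "\<And>s. s \<in> E \<Longrightarrow> chord_length p s = y s"
proof -
  \<comment> \<open>The start is the side \<open>{0, N - 1}\<close>, with two vectors of the
    prescribed determinant; its long arc contains every edge.\<close>
  let ?p = "\<lambda>v. if v = 0 then (1, 0) else (0, y {0, N - 1})"
  have side: "{0, N - 1} \<in> E"
    using full_triangulation_sides[OF T] polygon_side_0[of N] N by auto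
  have "det2 (?p 0) (?p (N - 1)) = y {0, N - 1}" using N by (simp add: det2_def)
  then have "\<exists>q. (\<forall>v. v \<le> 0 \<or> N - 1 \<le> v \<longrightarrow> q v = ?p v) \<and>
      (\<forall>c d. 0 \<le> c \<and> c < d \<and> d \<le> N - 1 \<and> {c, d} \<in> E \<longrightarrow> det2 (q c) (q d) = y {c, d})"
    by (intro points_between[OF T y _ side]) (use N in auto)
  then obtain q where
    "\<forall>c d. 0 \<le> c \<and> c < d \<and> d \<le> N - 1 \<and> {c, d} \<in> E \<longrightarrow> det2 (q c) (q d) = y {c, d}"
    by (elim exE conjE)
  then have q: "\<And>c d. c < d \<Longrightarrow> d \<le> N - 1 \<Longrightarrow> {c, d} \<in> E \<Longrightarrow> det2 (q c) (q d) = y {c, d}"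
    by simp
  have "chord_length q s = y s" if s: "s \<in> E" for s
  proof -
    obtain v w where vw: "v < N" "w < N" "v \<noteq> w" "s = {v, w}"
      using full_triangulation_edgeE[OF T s] by blast
    show ?thesis
    proof (cases "v < w")
      case True
      then show ?thesis using q[of v w] vw s by (simp add: chord_length_less)
    next
      case False
      then have "w < v" "s = {w, v}" using vw by auto
      then show ?thesis using q[of w v] vw s by (simp add: chord_length_less)
    qed
  qed
  then show thesis by (rule that)
qed


section \<open>Flips are mutations\<close>

text \<open>\<open>follows\<close> without labels: the effect of a flip is computed on edge sets and
  carried over to labels afterwards.\<close>

definition next_side :: "nat set set \<Rightarrow> nat set \<Rightarrow> nat set \<Rightarrow> bool" where
  "next_side E s t \<longleftrightarrow>
     (\<exists>a b c. clockwise a b c \<and> {a, b} \<in> E \<and> {b, c} \<in> E \<and> {c, a} \<in> E \<and> s = {a, b} \<and> t = {b, c})"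

lemma next_sideI:
  "clockwise a b c \<Longrightarrow> {a, b} \<in> E \<Longrightarrow> {b, c} \<in> E \<Longrightarrow> {c, a} \<in> E \<Longrightarrow> next_side E {a, b} {b, c}"
  unfolding next_side_def by blast

lemma triangles_edge:
  assumes "\<Delta> \<in> triangles n e" "v \<in> \<Delta>" "w \<in> \<Delta>" "v \<noteq> w"
  shows "{v, w} \<in> e ` {1..2*n+3}"
proof -
  obtain a b c where \<Delta>: "\<Delta> = {a, b, c}" and "{{a, b}, {b, c}, {c, a}} \<subseteq> e ` {1..2*n+3}"
    using assms(1) unfolding triangles_def mem_Collect_eq by (elim exE conjE)
  then have "{a, b} \<in> e ` {1..2*n+3}" "{b, c} \<in> e ` {1..2*n+3}" "{c, a} \<in> e ` {1..2*n+3}"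
    by (simp_all only: insert_subset)
  moreover have "{v, w} = {a, b} \<or> {v, w} = {b, c} \<or> {v, w} = {c, a}"
    using assms(2-4) \<Delta> by auto
  ultimately show ?thesis by (elim disjE) (simp_all only:)
qed

lemma triangles_iff:
  assumes "clockwise a b c"
  shows "{a, b, c} \<in> triangles n e \<longleftrightarrow>
    {a, b} \<in> e ` {1..2*n+3} \<and> {b, c} \<in> e ` {1..2*n+3} \<and> {c, a} \<in> e ` {1..2*n+3}"
proof
  assume *: "{a, b, c} \<in> triangles n e"
  show "{a, b} \<in> e ` {1..2*n+3} \<and> {b, c} \<in> e ` {1..2*n+3} \<and> {c, a} \<in> e ` {1..2*n+3}"
    by (intro conjI triangles_edge[OF *]) (use clockwise_distinct[OF assms] in simp_all)
next
  assume "{a, b} \<in> e ` {1..2*n+3} \<and> {b, c} \<in> e ` {1..2*n+3} \<and> {c, a} \<in> e ` {1..2*n+3}"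
  then have "{{a, b}, {b, c}, {c, a}} \<subseteq> e ` {1..2*n+3}"
    by (simp only: insert_subset empty_subsetI simp_thms)
  then show "{a, b, c} \<in> triangles n e"
    using assms unfolding triangles_def mem_Collect_eq by (intro exI conjI) (rule refl)
qed

lemma follows_iff: "follows n e i j \<longleftrightarrow> next_side (e ` {1..2*n+3}) (e i) (e j)"
  unfolding follows_def next_side_def using triangles_iff by metis

lemma next_side_asym: "next_side E s t \<Longrightarrow> \<not> next_side E t s"
proof
  assume "next_side E s t" "next_side E t s"
  then obtain a b c a' b' c' where
    1: "clockwise a b c" "s = {a, b}" "t = {b, c}" and
    2: "clockwise a' b' c'" "t = {a', b'}" "s = {b', c'}"
    unfolding next_side_def by blast
  have "{a, b} = {b', c'}" "{b, c} = {a', b'}" using 1 2 by simp_all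
  then show False using 1(1) 2(1) unfolding doubleton_eq_iff clockwise_def nat_order_real by argo
qed

text \<open>The quadrilateral around a diagonal \<open>{a, c}\<close> that is to be flipped, with
  its corners in clockwise order.\<close>

definition quad :: "nat set set \<Rightarrow> nat \<Rightarrow> nat \<Rightarrow> nat \<Rightarrow> nat \<Rightarrow> bool" where
  "quad E a b c d \<longleftrightarrow> clockwise a b c \<and> clockwise c d a \<and>
     {a, b} \<in> E \<and> {b, c} \<in> E \<and> {c, d} \<in> E \<and> {d, a} \<in> E \<and> {a, c} \<in> E"

abbreviation flip :: "nat set set \<Rightarrow> nat \<Rightarrow> nat \<Rightarrow> nat \<Rightarrow> nat \<Rightarrow> nat set set" where
  "flip E a b c d \<equiv> E - {{a, c}} \<union> {{b, d}}"

lemma quad_distinct: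
  assumes "quad E a b c d"
  shows "a \<noteq> b" "a \<noteq> c" "a \<noteq> d" "b \<noteq> c" "b \<noteq> d" "c \<noteq> d"
  using assms unfolding quad_def clockwise_def by auto

lemma quad_diagonal:
  assumes "full_triangulation N E" "quad E a b c d"
  shows "{b, d} \<notin> E"
  using assms full_triangulation_non_crossing unfolding quad_def separates_def by blast

text \<open>Rotating the names gives the flipped quadrilateral the same form, so every fact about
  arrows at the old diagonal also applies to the new one.\<close>

lemma quad_flip:
  assumes "quad E a b c d"
  shows "quad (flip E a b c d) b c d a"
proof -
  have "clockwise b c d" "clockwise d a b"
    using assms unfolding quad_def clockwise_def nat_order_real by argo+
  then show ?thesis
    using assms quad_distinct[OF assms] unfolding quad_def by (auto simp: doubleton_eq_iff)
qed

lemma full_triangulation_quad_flip: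
  "full_triangulation N E \<Longrightarrow> quad E a b c d \<Longrightarrow> full_triangulation N (flip E a b c d)"
  unfolding quad_def by (intro full_triangulation_flip) auto

lemma flip_flip:
  assumes "full_triangulation N E" "quad E a b c d"
  shows "flip (flip E a b c d) b c d a = E"
proof -
  have "{c, a} \<in> E" using assms(2) by (simp add: quad_def insert_commute)
  then show ?thesis using quad_diagonal[OF assms] by (auto simp: insert_commute)
qed

text \<open>By \<open>apex_unique\<close> each side of \<open>{a, c}\<close> carries a single
  triangle, and each of these two triangles contributes one arrow into the diagonal and one out of
  it.\<close>

lemma next_side_to_diagonal:
  assumes T: "full_triangulation N E" and q: "quad E a b c d"
  shows "next_side E s {a, c} \<longleftrightarrow> s = {b, c} \<or> s = {d, a}"
proof
  assume "next_side E s {a, c}"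
  then obtain p q' r where *: "clockwise p q' r" "{p, q'} \<in> E" "{q', r} \<in> E" "{r, p} \<in> E"
      "s = {p, q'}" "{a, c} = {q', r}"
    unfolding next_side_def by blast
  from *(6) consider "q' = a" "r = c" | "q' = c" "r = a" unfolding doubleton_eq_iff by blast
  then show "s = {b, c} \<or> s = {d, a}"
  proof cases
    case 1
    then have "clockwise c p a" using *(1) clockwise_rotate by blast
    then have "p = d"
      by (rule apex_unique[OF T]) (use *(2-4) 1 q in \<open>simp_all add: quad_def insert_commute\<close>)
    then show ?thesis using *(5) 1 by simp
  next
    case 2
    then have "clockwise a p c" using *(1) clockwise_rotate by blast
    then have "p = b"
      by (rule apex_unique[OF T]) (use *(2-4) 2 q in \<open>simp_all add: quad_def insert_commute\<close>)
    then show ?thesis using *(5) 2 by simp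
  qed
next
  assume s: "s = {b, c} \<or> s = {d, a}"
  have "clockwise b c a" "clockwise d a c" using q clockwise_rotate unfolding quad_def by blast+
  then show "next_side E s {a, c}"
    using s q next_sideI[of b c a E] next_sideI[of d a c E]
    by (elim disjE) (simp_all add: quad_def insert_commute)
qed

lemma next_side_from_diagonal:
  assumes T: "full_triangulation N E" and q: "quad E a b c d"
  shows "next_side E {a, c} t \<longleftrightarrow> t = {a, b} \<or> t = {c, d}"
proof
  assume "next_side E {a, c} t"
  then obtain p q' r where *: "clockwise p q' r" "{p, q'} \<in> E" "{q', r} \<in> E" "{r, p} \<in> E"
      "{a, c} = {p, q'}" "t = {q', r}"
    unfolding next_side_def by blast
  from *(5) consider "p = a" "q' = c" | "p = c" "q' = a" unfolding doubleton_eq_iff by blast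
  then show "t = {a, b} \<or> t = {c, d}"
  proof cases
    case 1
    then have "clockwise c r a" using *(1) clockwise_rotate by blast
    then have "r = d"
      by (rule apex_unique[OF T]) (use *(2-4) 1 q in \<open>simp_all add: quad_def insert_commute\<close>)
    then show ?thesis using *(6) 1 by simp
  next
    case 2
    then have "clockwise a r c" using *(1) clockwise_rotate by blast
    then have "r = b"
      by (rule apex_unique[OF T]) (use *(2-4) 2 q in \<open>simp_all add: quad_def insert_commute\<close>)
    then show ?thesis using *(6) 2 by simp
  qed
next
  assume t: "t = {a, b} \<or> t = {c, d}"
  have "clockwise c a b" "clockwise a c d" using q clockwise_rotate unfolding quad_def by blast+
  then show "next_side E {a, c} t"
    using t q next_sideI[of c a b E] next_sideI[of a c d E]
    by (elim disjE) (simp_all add: quad_def insert_commute)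
qed

lemma next_side_in_quad:
  assumes "quad E a b c d"
  shows "next_side E {a, b} {b, c}" "next_side E {c, d} {d, a}"
  using assms next_sideI[of a b c E] next_sideI[of c d a E]
  by (simp_all add: quad_def insert_commute)

text \<open>Two sides that meet in \<open>c\<close> or in \<open>a\<close> could be consecutive only
  in a triangle whose third side is \<open>{b, d}\<close>, and this chord is absent before the
  flip.\<close>

lemma not_next_side_in_quad:
  assumes T: "full_triangulation N E" and q: "quad E a b c d"
  shows "\<not> next_side E {b, c} {c, d}" "\<not> next_side E {d, a} {a, b}"
    "\<not> next_side E {c, d} {b, c}" "\<not> next_side E {a, b} {d, a}"
proof -
  have *: "{v, w} \<in> E" if "next_side E {u, v} {u, w}" "v \<noteq> w" for u v w
    using that unfolding next_side_def by (auto simp: doubleton_eq_iff insert_commute)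
  show "\<not> next_side E {b, c} {c, d}" "\<not> next_side E {d, a} {a, b}"
    "\<not> next_side E {c, d} {b, c}" "\<not> next_side E {a, b} {d, a}"
    using *[of c b d] *[of c d b] *[of a b d] *[of a d b] quad_diagonal[OF T q] quad_distinct[OF q]
    by (auto simp: insert_commute)
qed

text \<open>A triangle of the flipped triangulation that supplies the arrow either avoids
  \<open>{b, d}\<close> and is an old one, or has \<open>{b, d}\<close> as its third side; then its
  apex is \<open>a\<close> or \<open>c\<close>.\<close>

lemma next_side_flip_imp:
  assumes T: "full_triangulation N E" and q: "quad E a b c d"
    and st: "next_side (flip E a b c d) s t" "s \<noteq> {b, d}" "t \<noteq> {b, d}"
  shows "next_side E s t \<or> s = {d, a} \<and> t = {a, b} \<or> s = {b, c} \<and> t = {c, d}"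
proof -
  obtain p q' r where *: "clockwise p q' r" "{p, q'} \<in> flip E a b c d" "{q', r} \<in> flip E a b c d"
      "{r, p} \<in> flip E a b c d" "s = {p, q'}" "t = {q', r}"
    using st(1) unfolding next_side_def by blast
  show ?thesis
  proof (cases "{r, p} = {b, d}")
    case False
    then have "{p, q'} \<in> E" "{q', r} \<in> E" "{r, p} \<in> E" using * st(2,3) by auto
    then show ?thesis using next_sideI[OF *(1)] *(5,6) by simp
  next
    case True
    have T': "full_triangulation N (flip E a b c d)" using T q by (rule full_triangulation_quad_flip)
    have q2: "quad (flip E a b c d) b c d a" using q by (rule quad_flip)
    from True consider "r = b" "p = d" | "r = d" "p = b" unfolding doubleton_eq_iff by blast
    then show ?thesis
    proof cases
      case 1
      then have "clockwise d q' b" using *(1) by simp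
      then have "q' = a"
        by (rule apex_unique[OF T']) (use *(2,3) 1 q2 in \<open>simp_all add: quad_def insert_commute\<close>)
      then show ?thesis using *(5,6) 1 by simp
    next
      case 2
      then have "clockwise b q' d" using *(1) by simp
      then have "q' = c"
        by (rule apex_unique[OF T']) (use *(2,3) 2 q2 in \<open>simp_all add: quad_def insert_commute\<close>)
      then show ?thesis using *(5,6) 2 by simp
    qed
  qed
qed

text \<open>Both directions come from \<open>next_side_flip_imp\<close>, used for the flip and,
  through \<open>flip_flip\<close>, for its inverse. The exceptions are consecutive sides of the
  quadrilateral: two pairs lose their common triangle, the other two gain one.\<close>

lemma next_side_flip:
  assumes T: "full_triangulation N E" and q: "quad E a b c d"
    and s: "s \<noteq> {a, c}" "s \<noteq> {b, d}" and t: "t \<noteq> {a, c}" "t \<noteq> {b, d}"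
  shows "next_side (flip E a b c d) s t \<longleftrightarrow>
    next_side E s t \<and> \<not> (s = {a, b} \<and> t = {b, c}) \<and> \<not> (s = {c, d} \<and> t = {d, a}) \<or>
    s = {d, a} \<and> t = {a, b} \<or> s = {b, c} \<and> t = {c, d}"
proof -
  let ?E = "flip E a b c d"
  have T': "full_triangulation N ?E" using T q by (rule full_triangulation_quad_flip)
  have q': "quad ?E b c d a" using q by (rule quad_flip)
  have imp: "next_side E s t \<Longrightarrow>
      next_side ?E s t \<or> s = {a, b} \<and> t = {b, c} \<or> s = {c, d} \<and> t = {d, a}"
    using next_side_flip_imp[OF T' q', of s t] s t unfolding flip_flip[OF T q]
    by (simp add: insert_commute)
  have imp': "next_side ?E s t \<Longrightarrow>
      next_side E s t \<or> s = {d, a} \<and> t = {a, b} \<or> s = {b, c} \<and> t = {c, d}"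
    by (rule next_side_flip_imp[OF T q _ s(2) t(2)])
  have not_next: "\<not> (s = {a, b} \<and> t = {b, c})" "\<not> (s = {c, d} \<and> t = {d, a})" if "next_side ?E s t"
    using that not_next_side_in_quad[OF T' q'] by metis+
  have is_next: "next_side ?E s t" if "s = {d, a} \<and> t = {a, b} \<or> s = {b, c} \<and> t = {c, d}"
    using that next_side_in_quad[OF q'] by metis
  show ?thesis
    using imp imp' not_next is_next by argo
qed

section \<open>Flips of labelled triangulations and mutation of their quivers\<close>

lemma labelled_triangulation_edges:
  "labelled_triangulation n e \<Longrightarrow> full_triangulation (n + 3) (e ` {1..2*n+3})"
  "labelled_triangulation n e \<Longrightarrow> inj_on e {1..2*n+3}"
  by (simp_all add: labelled_triangulation_iff)

lemma flip_image:
  assumes L: "labelled_triangulation n e" and k: "k \<in> {1..n}" and ek: "e k = {a, c}"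
  shows "e(k := {b, d}) ` {1..2*n+3} = flip (e ` {1..2*n+3}) a b c d"
proof -
  have kI: "k \<in> {1..2*n+3}" using k by auto
  have "e ` ({1..2*n+3} - {k}) = e ` {1..2*n+3} - {e k}"
    using inj_on_image_set_diff[OF labelled_triangulation_edges(2)[OF L], of "{1..2*n+3}" "{k}"] kI by simp
  then show ?thesis
    by (simp only: fun_upd_image kI if_True ek Un_insert_right Un_empty_right)
qed

lemma labelled_triangulation_flip:
  assumes L: "labelled_triangulation n e" and k: "k \<in> {1..n}" and ek: "e k = {a, c}"
    and q: "quad (e ` {1..2*n+3}) a b c d"
  shows "labelled_triangulation n (e(k := {b, d}))"
proof -
  note T = labelled_triangulation_edges(1)[OF L] and inj = labelled_triangulation_edges(2)[OF L]
  have "full_triangulation (n + 3) (e(k := {b, d}) ` {1..2*n+3})"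
    unfolding flip_image[OF L k ek] using T q by (rule full_triangulation_quad_flip)
  moreover have "inj_on (e(k := {b, d})) {1..2*n+3}"
    using inj quad_diagonal[OF T q] by (intro inj_on_fun_updI) auto
  moreover have "e(k := {b, d}) ` {n+1..2*n+3} = e ` {n+1..2*n+3}"
    using k by (intro image_cong) auto
  ultimately show ?thesis using L unfolding labelled_triangulation_iff by simp
qed

text \<open>Without loops, completing paths leaves the arrows at \<open>k\<close> alone, and without
  2-cycles nothing cancels there: they are just reversed.\<close>

lemma mutate_quiver_simple:
  assumes "ice_quiver n m R"
  shows "mutate_quiver n k R i j = (if i > n \<and> j > n then 0 else if i = k \<or> j = k then R j i
    else R i j + R i k * R k j - min (R i j + R i k * R k j) (R j i + R j k * R k i))"
proof -
  have "R k k = 0" and "R i j = 0 \<or> R j i = 0"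
    using assms by (simp_all add: ice_quiver_def)
  then have "R k k = 0" and "min (R i j) (R j i) = 0" and "min (R j i) (R i j) = 0"
    by auto
  then show ?thesis unfolding mutate_quiver_def Let_def by auto
qed

text \<open>The paths through \<open>k\<close> run from \<open>l2\<close> or \<open>l4\<close> to
  \<open>l1\<close> or \<open>l3\<close>. Two of these four cancel the arrows \<open>l1\<close> to
  \<open>l2\<close> and \<open>l3\<close> to \<open>l4\<close> of the old triangles; the paths
  \<open>l2\<close> to \<open>l3\<close> and \<open>l4\<close> to \<open>l1\<close> become arrows of
  the new triangles.\<close>

lemma Qbar_of_flip:
  assumes L: "labelled_triangulation n e" and k: "k \<in> {1..n}" and ek: "e k = {a, c}"
    and q: "quad (e ` {1..2*n+3}) a b c d"
    and l: "l1 \<in> {1..2*n+3}" "e l1 = {a, b}" "l2 \<in> {1..2*n+3}" "e l2 = {b, c}"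
      "l3 \<in> {1..2*n+3}" "e l3 = {c, d}" "l4 \<in> {1..2*n+3}" "e l4 = {d, a}"
  shows "Qbar_of n (e(k := {b, d})) = mutate_quiver n k (Qbar_of n e)"
    and "Qbar_of n e i k = (if i = l2 \<or> i = l4 then 1 else 0)"
    and "Qbar_of n e k i = (if i = l1 \<or> i = l3 then 1 else 0)"
    and "l1 \<noteq> l3" "l2 \<noteq> l4" "k \<notin> {l1, l2, l3, l4}"
proof -
  let ?I = "{1..2*n+3}" and ?e = "e(k := {b, d})"
  let ?E = "e ` ?I"
  let ?F = "flip ?E a b c d"
  let ?R = "Qbar_of n e" and ?R' = "Qbar_of n ?e"
  note T = labelled_triangulation_edges(1)[OF L] and inj = labelled_triangulation_edges(2)[OF L]
  have T': "full_triangulation (n + 3) ?F" using T q by (rule full_triangulation_quad_flip)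
  have q': "quad ?F b c d a" using q by (rule quad_flip)
  note img = flip_image[OF L k ek, of b d]
  note ne = quad_distinct[OF q]
  have kI: "k \<in> ?I" "k \<le> n" using k by auto
  have lab: "e i = {a, b} \<longleftrightarrow> i = l1" "e i = {b, c} \<longleftrightarrow> i = l2" "e i = {c, d} \<longleftrightarrow> i = l3" "e i = {d, a} \<longleftrightarrow> i = l4"
    "e i = {a, c} \<longleftrightarrow> i = k" "e i \<noteq> {b, d}" if "i \<in> ?I" for i
    using inj_on_eq_iff[OF inj that l(1)] inj_on_eq_iff[OF inj that l(3)] inj_on_eq_iff[OF inj that l(5)]
      inj_on_eq_iff[OF inj that l(7)] inj_on_eq_iff[OF inj that kI(1)] l(2,4,6,8) ek
      imageI[OF that, of e] quad_diagonal[OF T q]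
    by metis+
  have dist: "l1 \<noteq> l2" "l1 \<noteq> l3" "l1 \<noteq> l4" "l2 \<noteq> l3" "l2 \<noteq> l4" "l3 \<noteq> l4"
    "k \<noteq> l1" "k \<noteq> l2" "k \<noteq> l3" "k \<noteq> l4"
    using l ek ne by (auto simp: doubleton_eq_iff)
  then show "l1 \<noteq> l3" "l2 \<noteq> l4" "k \<notin> {l1, l2, l3, l4}" by auto
  have R: "?R i j = (if i \<in> ?I \<and> j \<in> ?I \<and> (i \<le> n \<or> j \<le> n) \<and> next_side ?E (e i) (e j) then 1 else 0)" for i j
    unfolding Qbar_of_def follows_iff ..
  have R': "?R' i j = (if i \<in> ?I \<and> j \<in> ?I \<and> (i \<le> n \<or> j \<le> n) \<and> next_side ?F (?e i) (?e j) then 1 else 0)" for i j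
    unfolding Qbar_of_def follows_iff img ..
  have Rik: "?R i k = (if i = l2 \<or> i = l4 then 1 else 0)" for i
    unfolding R ek next_side_to_diagonal[OF T q] using lab[of i] l kI by auto
  then show "?R i k = (if i = l2 \<or> i = l4 then 1 else 0)" .
  have Rki: "?R k i = (if i = l1 \<or> i = l3 then 1 else 0)" for i
    unfolding R ek next_side_from_diagonal[OF T q] using lab[of i] l kI by auto
  then show "?R k i = (if i = l1 \<or> i = l3 then 1 else 0)" .
  have R'ik: "?R' i k = (if i = l1 \<or> i = l3 then 1 else 0)" for i
  proof (cases "i = k")
    case True
    then show ?thesis using dist ice_quiver_Qbar_of[of n ?e] unfolding ice_quiver_def by simp
  next
    case False
    have "next_side ?F (e i) {b, d} \<longleftrightarrow> e i = {c, d} \<or> e i = {a, b}"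
      by (rule next_side_to_diagonal[OF T' q'])
    then show ?thesis unfolding R' using False lab[of i] l kI by auto
  qed
  have R'ki: "?R' k i = (if i = l2 \<or> i = l4 then 1 else 0)" for i
  proof (cases "i = k")
    case True
    then show ?thesis using dist ice_quiver_Qbar_of[of n ?e] unfolding ice_quiver_def by simp
  next
    case False
    have "next_side ?F {b, d} (e i) \<longleftrightarrow> e i = {b, c} \<or> e i = {d, a}"
      by (rule next_side_from_diagonal[OF T' q'])
    then show ?thesis unfolding R' using False lab[of i] l kI by auto
  qed
  have ice: "ice_quiver n (2*n+3) ?R" by (rule ice_quiver_Qbar_of)
  show "?R' = mutate_quiver n k ?R"
  proof (intro ext)
    fix i j
    show "?R' i j = mutate_quiver n k ?R i j"
    proof (cases "i \<in> ?I \<and> j \<in> ?I \<and> (i \<le> n \<or> j \<le> n)")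
      case False
      have "?R' i j = 0" unfolding R' using False by auto
      moreover have "?R i j = 0" "?R j i = 0" unfolding R using False by auto
      \<comment> \<open>Two frozen vertices may well be joined by a path through \<open>k\<close>,
        but the arrow completing it is deleted again.\<close>
      moreover have "?R i k * ?R k j = 0 \<or> i > n \<and> j > n" unfolding R using False by auto
      ultimately show ?thesis unfolding mutate_quiver_simple[OF ice] by auto
    next
      case I: True
      then have fr: "\<not> (i > n \<and> j > n)" by auto
      consider "i = k" | "j = k" | "i \<noteq> k" "j \<noteq> k" by blast
      then show ?thesis
      proof cases
        case 1
        then show ?thesis unfolding mutate_quiver_simple[OF ice] using fr by (simp add: R'ki Rik)
      next
        case 2
        then show ?thesis unfolding mutate_quiver_simple[OF ice] using fr by (simp add: R'ik Rki)
      next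
        case 3
        have Rij: "?R i j = of_bool (next_side ?E (e i) (e j))" "?R j i = of_bool (next_side ?E (e j) (e i))"
          unfolding R using I by auto
        have "?R' i j = of_bool (next_side ?F (e i) (e j))"
          unfolding R' using I 3 by auto
        also have "next_side ?F (e i) (e j) \<longleftrightarrow> next_side ?E (e i) (e j) \<and> \<not> (i = l1 \<and> j = l2) \<and>
            \<not> (i = l3 \<and> j = l4) \<or> i = l4 \<and> j = l1 \<or> i = l2 \<and> j = l3"
          using next_side_flip[OF T q, of "e i" "e j"] lab[of i] lab[of j] I 3 by auto
        finally have R'ij: "?R' i j = of_bool (next_side ?E (e i) (e j) \<and> \<not> (i = l1 \<and> j = l2) \<and>
            \<not> (i = l3 \<and> j = l4) \<or> i = l4 \<and> j = l1 \<or> i = l2 \<and> j = l3)" .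
        have adj: "next_side ?E (e i) (e j)" if "i = l1 \<and> j = l2 \<or> i = l3 \<and> j = l4"
          using that next_side_in_quad[OF q] l by auto
        have adj': "next_side ?E (e j) (e i)" if "j = l1 \<and> i = l2 \<or> j = l3 \<and> i = l4"
          using that next_side_in_quad[OF q] l by auto
        have nadj: "\<not> next_side ?E (e i) (e j)" "\<not> next_side ?E (e j) (e i)"
          if "i = l2 \<and> j = l3 \<or> i = l3 \<and> j = l2 \<or> i = l4 \<and> j = l1 \<or> i = l1 \<and> j = l4"
          using that not_next_side_in_quad[OF T q] l by auto
        note asym = next_side_asym[of ?E "e i" "e j"] next_side_asym[of ?E "e j" "e i"]
        have mut: "mutate_quiver n k ?R i j = ?R i j + ?R i k * ?R k j - min (?R i j + ?R i k * ?R k j) (?R j i + ?R j k * ?R k i)"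
          unfolding mutate_quiver_simple[OF ice] using fr 3 by auto
        \<comment> \<open>Cases 1 and 3: a path through \<open>k\<close> cancels an old arrow, seen
          from its two ends. Cases 2 and 4: a path creates a new arrow, likewise. Case 5: no path
          through \<open>k\<close> joins \<open>i\<close> and \<open>j\<close>.\<close>
        consider "i = l2 \<and> j = l1 \<or> i = l4 \<and> j = l3" | "i = l2 \<and> j = l3 \<or> i = l4 \<and> j = l1"
          | "i = l1 \<and> j = l2 \<or> i = l3 \<and> j = l4" | "i = l1 \<and> j = l4 \<or> i = l3 \<and> j = l2"
          | "\<not> ((i = l2 \<or> i = l4) \<and> (j = l1 \<or> j = l3))" "\<not> ((i = l1 \<or> i = l3) \<and> (j = l2 \<or> j = l4))"
          by blast
        then show ?thesis
        proof cases
          case 1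
          then have arrows: "?R i k = 1" "?R k j = 1" "?R j k = 0" "?R k i = 0"
            unfolding Rik Rki using dist by (elim disjE conjE; simp)+
          have "next_side ?E (e j) (e i)" using 1 adj' by blast
          then have "?R i j = 0" "?R j i = 1" using asym Rij by simp_all
          moreover have "?R' i j = 0"
            using 1 dist \<open>next_side ?E (e j) (e i)\<close> asym unfolding R'ij by (elim disjE conjE) simp_all
          ultimately show ?thesis unfolding mut arrows by simp
        next
          case 2
          then have arrows: "?R i k = 1" "?R k j = 1" "?R j k = 0" "?R k i = 0"
            unfolding Rik Rki using dist by (elim disjE conjE; simp)+
          have "?R i j = 0" "?R j i = 0" using 2 nadj Rij by auto
          moreover have "?R' i j = 1" using 2 unfolding R'ij by auto
          ultimately show ?thesis unfolding mut arrows by simp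
        next
          case 3
          then have arrows: "?R i k = 0" "?R k j = 0" "?R j k = 1" "?R k i = 1"
            unfolding Rik Rki using dist by (elim disjE conjE; simp)+
          have "next_side ?E (e i) (e j)" using 3 adj by blast
          then have "?R i j = 1" "?R j i = 0" using asym Rij by simp_all
          moreover have "?R' i j = 0"
            using 3 dist unfolding R'ij by (elim disjE conjE) simp_all
          ultimately show ?thesis unfolding mut arrows by simp
        next
          case 4
          then have arrows: "?R i k = 0" "?R k j = 0" "?R j k = 1" "?R k i = 1"
            unfolding Rik Rki using dist by (elim disjE conjE; simp)+
          have "\<not> next_side ?E (e i) (e j)" "?R i j = 0" "?R j i = 0" using 4 nadj Rij by auto
          moreover from this(1) have "?R' i j = 0"
            using 4 dist unfolding R'ij by (elim disjE conjE) simp_all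
          ultimately show ?thesis unfolding mut arrows by simp
        next
          case 5
          then have z: "?R i k * ?R k j = 0" "?R j k * ?R k i = 0" unfolding Rik Rki by auto
          have "\<not> (i = l1 \<and> j = l2)" "\<not> (i = l3 \<and> j = l4)" "\<not> (i = l4 \<and> j = l1)" "\<not> (i = l2 \<and> j = l3)"
            using 5 by blast+
          then show ?thesis using asym unfolding mut R'ij z by (simp add: Rij)
        qed
      qed
    qed
  qed
qed

text \<open>The invariant of mutation: the vectors \<open>p\<close> stay fixed for all seeds, only
  the labelling \<open>e\<close> moves.\<close>

definition realizes :: "nat \<Rightarrow> (nat \<Rightarrow> 'a \<times> 'a) \<Rightarrow> (nat \<Rightarrow> nat set) \<Rightarrow> 'a::field_char_0 seed \<Rightarrow> bool" where
  "realizes n p e S \<longleftrightarrow> labelled_triangulation n e \<and> snd S = Qbar_of n e \<and>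
     (\<forall>l\<in>{1..2*n+3}. fst S l = chord_length p (e l))"

lemma prod_power_of_bool:
  fixes x :: "nat \<Rightarrow> 'a::comm_monoid_mult"
  assumes "finite A" "u \<in> A" "v \<in> A" "u \<noteq> v"
  shows "(\<Prod>j\<in>A. x j ^ (if j = u \<or> j = v then 1 else 0)) = x u * x v"
proof -
  have "(\<Prod>j\<in>A. x j ^ (if j = u \<or> j = v then 1 else 0)) = (\<Prod>j\<in>{u, v}. x j ^ (if j = u \<or> j = v then 1 else 0))"
    using assms by (intro prod.mono_neutral_right) auto
  also have "\<dots> = x u * x v" using assms(4) by simp
  finally show ?thesis .
qed

text \<open>The arrows into \<open>k\<close> come from one pair of opposite sides of the
  quadrilateral and those out of \<open>k\<close> go to the other pair, so the exchange relation is
  Ptolemy's relation, solved for the length of the new diagonal.\<close>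

lemma realizes_mutate:
  assumes S: "realizes n p e S" and k: "k \<in> {1..n}" and ek: "e k = {a, c}"
    and q: "quad (e ` {1..2*n+3}) a b c d" and nz: "chord_length p {a, c} \<noteq> 0"
  shows "realizes n p (e(k := {b, d})) (mutate n (2*n+3) k S)"
proof -
  let ?I = "{1..2*n+3}"
  have L: "labelled_triangulation n e" and Q: "snd S = Qbar_of n e"
    and X: "\<And>l. l \<in> ?I \<Longrightarrow> fst S l = chord_length p (e l)"
    using S by (auto simp: realizes_def)
  have qE: "{a, b} \<in> e ` ?I" "{b, c} \<in> e ` ?I" "{c, d} \<in> e ` ?I" "{d, a} \<in> e ` ?I"
    using q by (simp_all only: quad_def)
  obtain l1 where l1: "l1 \<in> ?I" "e l1 = {a, b}" using qE(1) by (metis imageE)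
  obtain l2 where l2: "l2 \<in> ?I" "e l2 = {b, c}" using qE(2) by (metis imageE)
  obtain l3 where l3: "l3 \<in> ?I" "e l3 = {c, d}" using qE(3) by (metis imageE)
  obtain l4 where l4: "l4 \<in> ?I" "e l4 = {d, a}" using qE(4) by (metis imageE)
  note l = l1 l2 l3 l4
  note quiver = Qbar_of_flip[OF L k ek q l]
  have cw: "clockwise a b c" "clockwise c d a" using q by (simp_all only: quad_def)
  have kI: "k \<in> ?I" using k by auto
  have "(\<Prod>j=1..2*n+3. fst S j ^ Qbar_of n e j k) + (\<Prod>j=1..2*n+3. fst S j ^ Qbar_of n e k j)
      = fst S l2 * fst S l4 + fst S l1 * fst S l3"
    unfolding quiver(2,3)
    by (rule arg_cong2[where f = "(+)"])
       (rule prod_power_of_bool[OF finite_atLeastAtMost l2(1) l4(1) quiver(5)]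
          prod_power_of_bool[OF finite_atLeastAtMost l1(1) l3(1) quiver(4)])+
  also have "\<dots> = chord_length p {a, c} * chord_length p {b, d}"
    using X l ptolemy[OF cw, of p] by (simp add: add.commute)
  finally have "(((\<Prod>j=1..2*n+3. fst S j ^ Qbar_of n e j k) + (\<Prod>j=1..2*n+3. fst S j ^ Qbar_of n e k j)) / fst S k)
      = chord_length p {b, d}"
    using X[OF kI] ek nz by simp
  then show ?thesis
    using labelled_triangulation_flip[OF L k ek q] quiver(1) X Q
    unfolding realizes_def mutate_def Let_def by simp
qed

text \<open>A diagonal is not a side, so each of its two arcs contains a vertex and
  \<open>apex_exists\<close> applies on both sides.\<close>

lemma diagonal_quad:
  assumes L: "labelled_triangulation n e" and k: "k \<in> {1..n}"
  obtains a b c d where "e k = {a, c}" "quad (e ` {1..2*n+3}) a b c d"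
proof -
  let ?E = "e ` {1..2*n+3}"
  note T = labelled_triangulation_edges(1)[OF L]
  have kE: "e k \<in> ?E" using k by auto
  have "e k \<in> polygon_diagonals (n + 3)"
    using L k unfolding labelled_triangulation_def triangulation_def by auto
  then obtain a c where ac: "a < c" "c < n + 3" "e k = {a, c}" "{a, c} \<notin> polygon_sides (n + 3)"
    unfolding polygon_diagonals_def by (auto simp: insert_commute neq_iff)
  have "c \<noteq> Suc a" using ac polygon_side_Suc[of a "n + 3"] by auto
  then have v: "clockwise a (Suc a) c" "Suc a < n + 3" using ac unfolding clockwise_def by auto
  have "\<exists>w<n + 3. clockwise c w a"
  proof (cases "a = 0")
    case True
    then have "c \<noteq> n + 2" using ac polygon_side_0[of "n + 3"] by auto
    then show ?thesis using ac True by (intro exI[of _ "Suc c"]) (auto simp: clockwise_def)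
  next
    case False
    then show ?thesis using ac by (intro exI[of _ 0]) (auto simp: clockwise_def)
  qed
  then obtain w where w: "w < n + 3" "clockwise c w a" by blast
  have E: "{a, c} \<in> ?E" "{c, a} \<in> ?E" using kE ac(3) by (simp_all add: insert_commute)
  obtain b where b: "clockwise a b c" "{a, b} \<in> ?E" "{b, c} \<in> ?E"
    using apex_exists[OF T E(1) v(2,1)] by blast
  obtain d where d: "clockwise c d a" "{c, d} \<in> ?E" "{d, a} \<in> ?E"
    using apex_exists[OF T E(2) w] by blast
  show thesis
    by (rule that[of a c b d, OF ac(3)]) (use b d E(1) in \<open>simp only: quad_def simp_thms\<close>)
qed

text \<open>The flipped diagonals are arbitrary, hence the hypothesis on all chords;
  \<open>chord_length_nonzero\<close> discharges it by means of the matching formula.\<close>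

lemma reachable_realizes:
  assumes S0: "realizes n p e S0" and S: "S \<in> reachable_seeds n (2*n+3) S0"
    and nz: "\<And>v w. v < n + 3 \<Longrightarrow> w < n + 3 \<Longrightarrow> v \<noteq> w \<Longrightarrow> chord_length p {v, w} \<noteq> 0"
  shows "\<exists>e'. realizes n p e' S"
  using S
proof induction
  case initial
  then show ?case using S0 by blast
next
  case (step S k)
  then obtain e' where e': "realizes n p e' S" by blast
  then have L: "labelled_triangulation n e'" by (simp add: realizes_def)
  obtain a b c d where q: "e' k = {a, c}" "quad (e' ` {1..2*n+3}) a b c d"
    by (rule diagonal_quad[OF L step.hyps(2)])
  have "{a, c} \<in> e' ` {1..2*n+3}" using q(2) by (simp only: quad_def)
  from full_triangulation_edge[OF labelled_triangulation_edges(1)[OF L] this]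
  have "chord_length p {a, c} \<noteq> 0" using nz by simp
  then show ?case using realizes_mutate[OF e' step.hyps(2) q] by blast
qed

section \<open>Weighted sums over matchings\<close>

text \<open>The set \<open>W\<close> of marked vertices is left free, so that after removing a
  triangle together with its marked vertex the rest is again of this form.\<close>

definition matchings :: "nat set set \<Rightarrow> nat set \<Rightarrow> angle set set" where
  "matchings \<T> W = {A. A \<subseteq> angles \<T> \<and> bij_betw fst A \<T> \<and> bij_betw snd A W}"

lemma angles_iff: "a \<in> angles \<T> \<longleftrightarrow> fst a \<in> \<T> \<and> snd a \<in> fst a"
  by (cases a) (simp add: angles_def)

lemma bij_betw_iff_ex1: "bij_betw f A B \<longleftrightarrow> f ` A \<subseteq> B \<and> (\<forall>b\<in>B. \<exists>!a. a \<in> A \<and> f a = b)"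
proof
  assume *: "bij_betw f A B"
  then have inj: "inj_on f A" and im: "f ` A = B" by (auto simp: bij_betw_def)
  have "\<exists>!a. a \<in> A \<and> f a = b" if "b \<in> B" for b
    using that inj im by (auto dest: inj_onD)
  then show "f ` A \<subseteq> B \<and> (\<forall>b\<in>B. \<exists>!a. a \<in> A \<and> f a = b)" using im by blast
next
  assume *: "f ` A \<subseteq> B \<and> (\<forall>b\<in>B. \<exists>!a. a \<in> A \<and> f a = b)"
  have "inj_on f A"
  proof (rule inj_onI)
    fix a a' assume "a \<in> A" "a' \<in> A" "f a = f a'"
    moreover from this have "f a \<in> B" using * by blast
    ultimately show "a = a'" using * by metis
  qed
  moreover have "f ` A = B" using * by (intro equalityI subsetI) (blast, metis imageI)
  ultimately show "bij_betw f A B" by (simp add: bij_betw_def)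
qed

lemma angle_matchings_eq: "angle_matchings \<T> D = matchings \<T> (\<Union>\<T> \<inter> \<Union>D)"
proof (intro equalityI subsetI)
  fix A assume "A \<in> angle_matchings \<T> D"
  then have *: "A \<subseteq> angles \<T> \<and>
     (\<forall>v\<in>\<Union>\<T>. if v \<in> \<Union>D then \<exists>!a. a \<in> A \<and> snd a = v else \<not> (\<exists>a\<in>A. snd a = v)) \<and>
     (\<forall>\<Delta>\<in>\<T>. \<exists>!a. a \<in> A \<and> fst a = \<Delta>)"
    unfolding angle_matchings_def mem_Collect_eq .
  have sub: "A \<subseteq> angles \<T>" using * by (elim conjE)
  have T: "\<forall>\<Delta>\<in>\<T>. \<exists>!a. a \<in> A \<and> fst a = \<Delta>" using * by (elim conjE)
  have V0: "\<forall>v\<in>\<Union>\<T>. if v \<in> \<Union>D then \<exists>!a. a \<in> A \<and> snd a = v else \<not> (\<exists>a\<in>A. snd a = v)"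
    using * by (elim conjE)
  have V: "\<exists>!a. a \<in> A \<and> snd a = v" if "v \<in> \<Union>\<T>" "v \<in> \<Union>D" for v
    using bspec[OF V0 that(1)] that(2) by (simp only: if_True)
  have V2: "snd a \<in> \<Union>D" if "a \<in> A" "snd a \<in> \<Union>\<T>" for a
    using bspec[OF V0 that(2)] that(1) by (cases "snd a \<in> \<Union>D") (simp_all only: if_False, blast)
  have a: "fst a \<in> \<T>" "snd a \<in> \<Union>\<T>" if "a \<in> A" for a
    using subsetD[OF sub that] unfolding angles_iff by auto
  have "snd ` A \<subseteq> \<Union>\<T> \<inter> \<Union>D"
    by (intro image_subsetI IntI a(2) V2)
  moreover have "\<forall>v\<in>\<Union>\<T> \<inter> \<Union>D. \<exists>!a. a \<in> A \<and> snd a = v"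
    by (intro ballI V) (elim IntE, assumption)+
  moreover have "fst ` A \<subseteq> \<T>" using a(1) by (metis image_subsetI)
  ultimately show "A \<in> matchings \<T> (\<Union>\<T> \<inter> \<Union>D)"
    unfolding matchings_def bij_betw_iff_ex1 mem_Collect_eq by (intro conjI sub T)
next
  fix A assume "A \<in> matchings \<T> (\<Union>\<T> \<inter> \<Union>D)"
  then have conj: "A \<subseteq> angles \<T> \<and> (fst ` A \<subseteq> \<T> \<and> (\<forall>\<Delta>\<in>\<T>. \<exists>!a. a \<in> A \<and> fst a = \<Delta>)) \<and>
      snd ` A \<subseteq> \<Union>\<T> \<inter> \<Union>D \<and> (\<forall>v\<in>\<Union>\<T> \<inter> \<Union>D. \<exists>!a. a \<in> A \<and> snd a = v)"
    unfolding matchings_def bij_betw_iff_ex1 mem_Collect_eq .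
  have sub: "A \<subseteq> angles \<T>" using conj by (elim conjE)
  have T: "\<forall>\<Delta>\<in>\<T>. \<exists>!a. a \<in> A \<and> fst a = \<Delta>" using conj by (elim conjE)
  have V: "snd ` A \<subseteq> \<Union>\<T> \<inter> \<Union>D" using conj by (elim conjE)
  have V1: "\<forall>v\<in>\<Union>\<T> \<inter> \<Union>D. \<exists>!a. a \<in> A \<and> snd a = v" using conj by (elim conjE)
  have "if v \<in> \<Union>D then \<exists>!a. a \<in> A \<and> snd a = v else \<not> (\<exists>a\<in>A. snd a = v)" if v: "v \<in> \<Union>\<T>" for v
  proof (cases "v \<in> \<Union>D")
    case True
    then show ?thesis using bspec[OF V1 IntI[OF v True]] by (simp only: if_True)
  next
    case False
    then have "v \<notin> snd ` A" using V by (elim contrapos_nn) (rule IntD2[OF subsetD])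
    then show ?thesis using False by (simp only: if_False) (metis imageI)
  qed
  then show "A \<in> angle_matchings \<T> D"
    unfolding angle_matchings_def mem_Collect_eq by (intro conjI sub T ballI)
qed

text \<open>Matchings are sorted by the angle that they mark in the new triangle.\<close>

lemma matchings_insert:
  assumes "\<Delta> \<notin> \<T>"
  shows "matchings (insert \<Delta> \<T>) W = (\<Union>v\<in>\<Delta> \<inter> W. insert (\<Delta>, v) ` matchings \<T> (W - {v}))"
proof (intro equalityI subsetI)
  fix A assume "A \<in> matchings (insert \<Delta> \<T>) W"
  then have sub: "A \<subseteq> angles (insert \<Delta> \<T>)" and bij: "bij_betw fst A (insert \<Delta> \<T>)" "bij_betw snd A W"
    unfolding matchings_def by auto
  obtain v where v: "(\<Delta>, v) \<in> A"
    using bij(1) unfolding bij_betw_def by (metis imageE insertI1 prod.collapse)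
  have vW: "v \<in> \<Delta> \<inter> W"
    using subsetD[OF sub v] bij_betwE[OF bij(2)] v unfolding angles_iff by auto
  let ?B = "A - {(\<Delta>, v)}"
  have B1: "bij_betw fst ?B \<T>"
    using bij_betw_DiffI[OF bij(1), of "{(\<Delta>, v)}" "{\<Delta>}"] v assms by (simp add: bij_betw_def)
  have B2: "bij_betw snd ?B (W - {v})"
    using bij_betw_DiffI[OF bij(2), of "{(\<Delta>, v)}" "{v}"] v vW by (simp add: bij_betw_def)
  have "a \<in> angles \<T>" if "a \<in> ?B" for a
    using that subsetD[OF sub, of a] bij_betwE[OF B1] unfolding angles_iff by auto
  then have "?B \<in> matchings \<T> (W - {v})" using B1 B2 unfolding matchings_def by blast
  moreover have "A = insert (\<Delta>, v) ?B" using v by blast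
  ultimately show "A \<in> (\<Union>v\<in>\<Delta> \<inter> W. insert (\<Delta>, v) ` matchings \<T> (W - {v}))" using vW by blast
next
  fix A assume "A \<in> (\<Union>v\<in>\<Delta> \<inter> W. insert (\<Delta>, v) ` matchings \<T> (W - {v}))"
  then obtain v B where v: "v \<in> \<Delta>" "v \<in> W" and A: "A = insert (\<Delta>, v) B"
    and B: "B \<subseteq> angles \<T>" "bij_betw fst B \<T>" "bij_betw snd B (W - {v})"
    unfolding matchings_def by blast
  have n: "(\<Delta>, v) \<notin> B" using B(1) assms unfolding angles_def by blast
  have "bij_betw fst (B \<union> {(\<Delta>, v)}) (\<T> \<union> {fst (\<Delta>, v)})"
    by (rule notIn_Un_bij_betw[OF n _ B(2)]) (use assms in simp)
  moreover have "bij_betw snd (B \<union> {(\<Delta>, v)}) (W - {v} \<union> {snd (\<Delta>, v)})"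
    by (rule notIn_Un_bij_betw[OF n _ B(3)]) simp
  moreover have "insert v W = W" using v by blast
  moreover have "A \<subseteq> angles (insert \<Delta> \<T>)" using A B(1) v unfolding angles_def by auto
  ultimately show "A \<in> matchings (insert \<Delta> \<T>) W" unfolding matchings_def A by simp
qed

definition matching_sum :: "(angle \<Rightarrow> 'c::comm_ring_1) \<Rightarrow> nat set set \<Rightarrow> nat set \<Rightarrow> 'c" where
  "matching_sum wt \<T> W = (\<Sum>A\<in>matchings \<T> W. \<Prod>a\<in>A. wt a)"

lemma finite_angles: "finite \<T> \<Longrightarrow> (\<And>\<Delta>. \<Delta> \<in> \<T> \<Longrightarrow> finite \<Delta>) \<Longrightarrow> finite (angles \<T>)"
proof -
  assume "finite \<T>" "\<And>\<Delta>. \<Delta> \<in> \<T> \<Longrightarrow> finite \<Delta>"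
  then have "finite (SIGMA \<Delta>:\<T>. \<Delta>)" by (rule finite_SigmaI)
  moreover have "angles \<T> = (SIGMA \<Delta>:\<T>. \<Delta>)" unfolding angles_def by auto
  ultimately show ?thesis by simp
qed

lemma matching_sum_insert:
  assumes "finite \<T>" "\<And>\<Delta>'. \<Delta>' \<in> \<T> \<Longrightarrow> finite \<Delta>'" "finite \<Delta>" "\<Delta> \<notin> \<T>"
  shows "matching_sum wt (insert \<Delta> \<T>) W = (\<Sum>v\<in>\<Delta> \<inter> W. wt (\<Delta>, v) * matching_sum wt \<T> (W - {v}))"
proof -
  have fin: "finite (angles \<T>)" using assms by (intro finite_angles) auto
  have finm: "finite (matchings \<T> W)" for W
    by (rule finite_subset[of _ "Pow (angles \<T>)"]) (use fin in \<open>auto simp: matchings_def\<close>)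
  have notin: "(\<Delta>, v) \<notin> A" "finite A" if "A \<in> matchings \<T> W" for A v W
    using that assms(4) finite_subset[OF _ fin] unfolding matchings_def angles_def by auto
  have "matching_sum wt (insert \<Delta> \<T>) W =
      (\<Sum>v\<in>\<Delta> \<inter> W. \<Sum>A\<in>insert (\<Delta>, v) ` matchings \<T> (W - {v}). \<Prod>a\<in>A. wt a)"
    unfolding matching_sum_def matchings_insert[OF assms(4)]
  proof (rule sum.UNION_disjoint)
    \<comment> \<open>Distinct \<open>v\<close> mark distinct angles of \<open>\<Delta>\<close>, and
      a matching of the other triangles contains none of them.\<close>
    show "\<forall>v\<in>\<Delta> \<inter> W. \<forall>v'\<in>\<Delta> \<inter> W. v \<noteq> v' \<longrightarrow>
      insert (\<Delta>, v) ` matchings \<T> (W - {v}) \<inter> insert (\<Delta>, v') ` matchings \<T> (W - {v'}) = {}"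
    proof (intro ballI impI equals0I)
      fix v v' A assume "v \<noteq> v'"
        "A \<in> insert (\<Delta>, v) ` matchings \<T> (W - {v}) \<inter> insert (\<Delta>, v') ` matchings \<T> (W - {v'})"
      then obtain B B' where "A = insert (\<Delta>, v) B" "A = insert (\<Delta>, v') B'" "B' \<in> matchings \<T> (W - {v'})"
        by (elim IntE imageE)
      then have "(\<Delta>, v) \<in> insert (\<Delta>, v') B'" "(\<Delta>, v) \<notin> B'" using notin(1) by auto
      then show False using \<open>v \<noteq> v'\<close> by simp
    qed
  qed (use assms(3) finm in auto)
  also have "\<dots> = (\<Sum>v\<in>\<Delta> \<inter> W. wt (\<Delta>, v) * matching_sum wt \<T> (W - {v}))"
  proof (rule sum.cong[OF refl])
    fix v
    have "inj_on (insert (\<Delta>, v)) (matchings \<T> (W - {v}))"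
    proof (rule inj_onI)
      fix A B assume AB: "A \<in> matchings \<T> (W - {v})" "B \<in> matchings \<T> (W - {v})"
        "insert (\<Delta>, v) A = insert (\<Delta>, v) B"
      then show "A = B" using insert_ident[OF notin(1)[OF AB(1)] notin(1)[OF AB(2)]] by simp
    qed
    then have "(\<Sum>A\<in>insert (\<Delta>, v) ` matchings \<T> (W - {v}). \<Prod>a\<in>A. wt a) =
        (\<Sum>A\<in>matchings \<T> (W - {v}). \<Prod>a\<in>insert (\<Delta>, v) A. wt a)"
      by (simp add: sum.reindex)
    also have "\<dots> = (\<Sum>A\<in>matchings \<T> (W - {v}). wt (\<Delta>, v) * (\<Prod>a\<in>A. wt a))"
      using notin by (intro sum.cong refl prod.insert) auto
    finally show "(\<Sum>A\<in>insert (\<Delta>, v) ` matchings \<T> (W - {v}). \<Prod>a\<in>A. wt a) =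
        wt (\<Delta>, v) * matching_sum wt \<T> (W - {v})"
      by (simp add: matching_sum_def sum_distrib_left)
  qed
  finally show ?thesis .
qed

lemma matching_sum_outside:
  assumes "w \<in> W" "w \<notin> \<Union>\<T>"
  shows "matching_sum wt \<T> W = 0"
proof -
  have "A \<notin> matchings \<T> W" for A
  proof
    assume "A \<in> matchings \<T> W"
    then have "A \<subseteq> angles \<T>" "snd ` A = W" unfolding matchings_def bij_betw_def by auto
    then show False using assms unfolding angles_def by force
  qed
  then show ?thesis unfolding matching_sum_def by (metis equals0I sum.empty)
qed

lemma matching_sum_empty: "matching_sum wt {} {} = 1"
proof -
  have "matchings {} {} = {{}}" unfolding matchings_def angles_def by (auto simp: bij_betw_def)
  then show ?thesis by (simp add: matching_sum_def)
qed

lemma matching_sum_singleton: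
  assumes "finite \<Delta>" "v \<in> \<Delta>"
  shows "matching_sum wt {\<Delta>} {v} = wt (\<Delta>, v)"
  using matching_sum_insert[of "{}" \<Delta> wt "{v}"] assms by (simp add: matching_sum_empty)

text \<open>The vertex \<open>w\<close> belongs to the ear alone. If \<open>w\<close> is to stay
  unmarked, the ear marks \<open>s\<close> or \<open>t\<close>; if \<open>w\<close> must be marked,
  only the ear can do it, which uses up its angle.\<close>

lemma matching_sum_ear:
  assumes fin: "finite \<T>" "\<And>\<Delta>. \<Delta> \<in> \<T> \<Longrightarrow> finite \<Delta>"
    and w: "w \<notin> \<Union>\<T>" and st: "s \<in> \<Union>\<T>" "t \<in> \<Union>\<T>" "s \<noteq> t" and u: "u \<in> \<Union>\<T>" "u \<noteq> s" "u \<noteq> t"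
  shows "matching_sum wt (insert {s, t, w} \<T>) (insert w (\<Union>\<T>) - {u, w}) =
      wt ({s, t, w}, s) * matching_sum wt \<T> (\<Union>\<T> - {u, s}) + wt ({s, t, w}, t) * matching_sum wt \<T> (\<Union>\<T> - {u, t})"
    and "v \<in> \<Union>\<T> \<Longrightarrow> matching_sum wt (insert {s, t, w} \<T>) (insert w (\<Union>\<T>) - {u, v}) =
      wt ({s, t, w}, w) * matching_sum wt \<T> (\<Union>\<T> - {u, v})"
proof -
  let ?\<Delta> = "{s, t, w}" and ?V = "\<Union>\<T>"
  have n: "?\<Delta> \<notin> \<T>" using w by blast
  have uw: "u \<noteq> w" "s \<noteq> w" "t \<noteq> w" using u w st by blast+
  have ins: "matching_sum wt (insert ?\<Delta> \<T>) W = (\<Sum>v\<in>?\<Delta> \<inter> W. wt (?\<Delta>, v) * matching_sum wt \<T> (W - {v}))" for W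
    by (rule matching_sum_insert) (use fin n in auto)
  have W: "insert w ?V - {u, w} = ?V - {u}" using w by blast
  have I: "?\<Delta> \<inter> (?V - {u}) = {s, t}" using st u uw w by blast
  have D: "?V - {u} - {v} = ?V - {u, v}" for v by blast
  show "matching_sum wt (insert ?\<Delta> \<T>) (insert w ?V - {u, w}) =
      wt (?\<Delta>, s) * matching_sum wt \<T> (?V - {u, s}) + wt (?\<Delta>, t) * matching_sum wt \<T> (?V - {u, t})"
    unfolding ins W I using st(3) by (simp add: D)
  assume v: "v \<in> ?V"
  let ?W = "insert w ?V - {u, v}"
  have wW: "w \<in> ?\<Delta> \<inter> ?W" using uw v w by auto
  have "matching_sum wt (insert ?\<Delta> \<T>) ?W = (\<Sum>x\<in>{w}. wt (?\<Delta>, x) * matching_sum wt \<T> (?W - {x}))"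
    unfolding ins
  proof (rule sum.mono_neutral_right)
    show "\<forall>x\<in>?\<Delta> \<inter> ?W - {w}. wt (?\<Delta>, x) * matching_sum wt \<T> (?W - {x}) = 0"
      using wW w matching_sum_outside[of w _ \<T> wt] by auto
  qed (use wW in auto)
  moreover have "?W - {w} = ?V - {u, v}" using w by blast
  ultimately show "matching_sum wt (insert ?\<Delta> \<T>) ?W = wt (?\<Delta>, w) * matching_sum wt \<T> (?V - {u, v})"
    by simp
qed

section \<open>Chains of triangles\<close>

lemma separates_irrefl: "\<not> separates v v s t"
  unfolding separates_def clockwise_def by simp

text \<open>Being on the same side of a chord passes on through \<open>p\<close> only when
  \<open>p\<close> is off that chord: an endpoint counts as being on both sides.\<close>

lemma separates_trans:
  "\<not> separates v p s t \<Longrightarrow> \<not> separates p q s t \<Longrightarrow> p \<noteq> s \<Longrightarrow> p \<noteq> t \<Longrightarrow> \<not> separates v q s t"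
  unfolding separates_def clockwise_def nat_order_real by argo

lemma ptolemy_separates:
  assumes "separates a c b d"
  shows "chord_length p {a, c} * chord_length p {b, d} =
    chord_length p {a, b} * chord_length p {c, d} + chord_length p {b, c} * chord_length p {d, a}"
proof -
  consider "clockwise a b c" "clockwise c d a" | "clockwise a d c" "clockwise c b a"
    using assms unfolding separates_def by blast
  then show ?thesis
  proof cases
    case 1 then show ?thesis by (rule ptolemy)
  next
    case 2 then show ?thesis using ptolemy[of a d c b p] by (simp add: insert_commute mult.commute add.commute)
  qed
qed

lemma doubleton_eq_subset:
  assumes "s = {a, b}" "t = {c, d}" "a \<noteq> b" "s \<subseteq> t"
  shows "s = t"
  using assms by auto

text \<open>Only neighbouring triangles are related here. That distant ones do not meet again across
  a hinge is derived from the cyclic order in \<open>left_side\<close> and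
  \<open>right_side\<close>.\<close>

locale triangle_chain =
  fixes N n :: nat and E :: "nat set set" and e D :: "nat \<Rightarrow> nat set"
  assumes T: "full_triangulation N E"
    and D_edge: "\<And>k v w. k \<le> n \<Longrightarrow> v \<in> D k \<Longrightarrow> w \<in> D k \<Longrightarrow> v \<noteq> w \<Longrightarrow> {v, w} \<in> E"
    and D_card: "\<And>k. k \<le> n \<Longrightarrow> card (D k) = 3"
    and e_edge: "\<And>k. k \<in> {1..n} \<Longrightarrow> e k \<in> E"
    and e_left: "\<And>k. k \<in> {1..n} \<Longrightarrow> e k \<subseteq> D (k - 1)"
    and e_right: "\<And>k. k \<in> {1..n} \<Longrightarrow> e k \<subseteq> D k"
    and D_neq: "\<And>k. k \<in> {1..n} \<Longrightarrow> D (k - 1) \<noteq> D k"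
    and e_inj: "inj_on e {1..n}"
begin

text \<open>The tips opposite to hinge \<open>k\<close>: \<open>u k\<close> in the triangle before
  it, \<open>w k\<close> in the triangle after it.\<close>

definition u :: "nat \<Rightarrow> nat" where "u k = the_elem (D (k - 1) - e k)"
definition w :: "nat \<Rightarrow> nat" where "w k = the_elem (D k - e k)"

lemma third_vertex:
  assumes "card X = 3" "{s, t} \<subseteq> X" "s \<noteq> t"
  obtains v where "X = {s, t, v}" "v \<noteq> s" "v \<noteq> t" "the_elem (X - {s, t}) = v"
proof -
  have "finite X" using assms(1) by (metis card.infinite zero_neq_numeral)
  then have "card (X - {s, t}) = 1" using assms by (simp add: card_Diff_subset)
  then obtain v where v: "X - {s, t} = {v}" by (metis card_1_singletonE)
  then have "X = {s, t, v}" "v \<noteq> s" "v \<noteq> t" using assms(2) by auto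
  then show thesis using that[of v] v by simp
qed

lemma hinge:
  assumes k: "k \<in> {1..n}"
  obtains s t where "e k = {s, t}" "s \<noteq> t" "D (k - 1) = {s, t, u k}" "D k = {s, t, w k}"
    "u k \<noteq> s" "u k \<noteq> t" "w k \<noteq> s" "w k \<noteq> t" "clockwise s (u k) t" "clockwise t (w k) s"
proof -
  obtain s t where st: "s \<noteq> t" "e k = {s, t}"
    using full_triangulation_edgeE[OF T e_edge[OF k]] by metis
  have kn: "k \<le> n" "k - 1 \<le> n" using k by auto
  obtain v where v: "D (k - 1) = {s, t, v}" "v \<noteq> s" "v \<noteq> t" "u k = v"
    using third_vertex[OF D_card[OF kn(2)] _ st(1)] e_left[OF k] st(2) unfolding u_def by metis
  obtain v' where v': "D k = {s, t, v'}" "v' \<noteq> s" "v' \<noteq> t" "w k = v'"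
    using third_vertex[OF D_card[OF kn(1)] _ st(1)] e_right[OF k] st(2) unfolding w_def by metis
  have "v \<noteq> v'" using v v' D_neq[OF k] by auto
  have E: "{s, v} \<in> E" "{v, s} \<in> E" "{t, v} \<in> E" "{v, t} \<in> E"
    by (rule D_edge[OF kn(2)]; use v in simp)+
  have E': "{s, v'} \<in> E" "{v', s} \<in> E" "{t, v'} \<in> E" "{v', t} \<in> E"
    by (rule D_edge[OF kn(1)]; use v' in simp)+
  \<comment> \<open>Two different triangles on one edge cannot have their apexes on the same side.
    The ends of the hinge are then named so that \<open>u k\<close> lies on the arc from
    \<open>s\<close> to \<open>t\<close>.\<close>
  have n1: "\<not> (clockwise s v t \<and> clockwise s v' t)" "\<not> (clockwise t v s \<and> clockwise t v' s)"
    using apex_unique[OF T _ _ E(1,4) E'(1,4)] apex_unique[OF T _ _ E(3,2) E'(3,2)] \<open>v \<noteq> v'\<close> by blast+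
  have "clockwise s v t \<or> clockwise t v s" "clockwise s v' t \<or> clockwise t v' s"
    using clockwise_total v v' st by metis+
  then consider "clockwise s v t" "clockwise t v' s" | "clockwise t v s" "clockwise s v' t"
    using n1 by blast
  then show thesis
  proof cases
    case 1
    then show ?thesis using that[of s t] v v' st by simp
  next
    case 2
    have "e k = {t, s}" "D (k - 1) = {t, s, u k}" "D k = {t, s, w k}" using st v v' by auto
    then show ?thesis using that[of t s] v v' st 2 by simp
  qed
qed

lemma w_mem: "k \<in> {1..n} \<Longrightarrow> w k \<in> D k"
  by (elim hinge) simp

lemma u_mem: "k \<in> {1..n} \<Longrightarrow> u k \<in> D (k - 1)"
  by (elim hinge) simp

lemma e_doubleton:
  assumes "k \<in> {1..n}" obtains s t where "e k = {s, t}" "s \<noteq> t"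
  using assms by (elim hinge) blast

section \<open>The two sides of a hinge\<close>

lemma e_diff:
  assumes "k \<in> {1..n}" "l \<in> {1..n}" "k \<noteq> l"
  obtains p where "p \<in> e k" "p \<notin> e l"
proof -
  have ne: "e k \<noteq> e l" using assms e_inj by (meson inj_onD)
  obtain s t where st: "e k = {s, t}" "s \<noteq> t" using e_doubleton[OF assms(1)] by blast
  obtain s' t' where st': "e l = {s', t'}" "s' \<noteq> t'" using e_doubleton[OF assms(2)] by blast
  have "\<not> e k \<subseteq> e l" using doubleton_eq_subset[OF st(1) st'(1) st(2)] ne by blast
  then show thesis using that by blast
qed

text \<open>The edge from \<open>v\<close> to \<open>p\<close> does not cross \<open>e k\<close>,
  and \<open>p\<close> is off \<open>e k\<close>, so the side of \<open>p\<close> is passed on to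
  every vertex of its triangle.\<close>

lemma same_side_step:
  assumes m: "m \<le> n" and k: "k \<in> {1..n}" and p: "p \<in> D m" "p \<notin> e k" "\<not> crossing {p, x} (e k)" and v: "v \<in> D m"
  shows "\<not> crossing {v, x} (e k)"
proof -
  obtain s t where st: "e k = {s, t}" using e_doubleton[OF k] by blast
  have "\<not> separates v p s t"
  proof (cases "v = p")
    case True then show ?thesis by (simp add: separates_irrefl)
  next
    case False
    then have "{v, p} \<in> E" using D_edge[OF m v p(1)] by simp
    moreover have "{s, t} \<in> E" using e_edge[OF k] st by simp
    ultimately show ?thesis using full_triangulation_non_crossing[OF T] by blast
  qed
  then show ?thesis using separates_trans[of v p s t x] p(2,3) unfolding st crossing_iff by simp
qed

text \<open>The side is passed on triangle by triangle, backwards from \<open>D (k - 1)\<close>: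
  consecutive triangles share a hinge different from \<open>e k\<close>, hence a vertex off
  \<open>e k\<close>. \<open>right_side\<close> is the mirror image.\<close>

lemma left_side:
  assumes k: "k \<in> {1..n}" and m: "m < k" and v: "v \<in> D m"
  shows "\<not> crossing {v, u k} (e k)"
proof -
  have "m \<le> k - 1" using m by simp
  then have "\<forall>v\<in>D m. \<not> crossing {v, u k} (e k)"
  proof (induction rule: inc_induct)
    case base
    have n: "k - 1 \<le> n" using k by auto
    have u: "u k \<notin> e k" using k by (elim hinge) simp
    obtain s t where st: "e k = {s, t}" using e_doubleton[OF k] by blast
    have c: "\<not> crossing {u k, u k} (e k)" unfolding st crossing_iff by (rule separates_irrefl)
    show ?case using same_side_step[OF n k u_mem[OF k] u c] by blast
  next
    case (step m)
    have Sm: "Suc m \<in> {1..n}" "Suc m \<noteq> k" and m: "m \<le> n" using step.hyps k by auto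
    obtain p where p: "p \<in> e (Suc m)" "p \<notin> e k" using e_diff[OF Sm(1) k Sm(2)] by blast
    have pD: "p \<in> D m" "p \<in> D (Suc m)" using e_left[OF Sm(1)] e_right[OF Sm(1)] p(1) by auto
    show ?case using same_side_step[OF m k pD(1) p(2)] step.IH pD(2) by blast
  qed
  then show ?thesis using v by blast
qed

lemma right_side:
  assumes k: "k \<in> {1..n}" and m: "k \<le> m" "m \<le> n" and v: "v \<in> D m"
  shows "\<not> crossing {v, w k} (e k)"
proof -
  have "m \<le> n \<longrightarrow> (\<forall>v\<in>D m. \<not> crossing {v, w k} (e k))"
    using m(1)
  proof (induction rule: dec_induct)
    case base
    have n: "k \<le> n" using k by auto
    have u: "w k \<notin> e k" using k by (elim hinge) simp
    obtain s t where st: "e k = {s, t}" using e_doubleton[OF k] by blast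
    have c: "\<not> crossing {w k, w k} (e k)" unfolding st crossing_iff by (rule separates_irrefl)
    show ?case using same_side_step[OF n k w_mem[OF k] u c] by blast
  next
    case (step m)
    show ?case
    proof
      assume Sn: "Suc m \<le> n"
      have Sm: "Suc m \<in> {1..n}" "Suc m \<noteq> k" and m: "m \<le> n" using step.hyps Sn by auto
      obtain p where p: "p \<in> e (Suc m)" "p \<notin> e k" using e_diff[OF Sm(1) k Sm(2)] by blast
      have pD: "p \<in> D m" "p \<in> D (Suc m)" using e_left[OF Sm(1)] e_right[OF Sm(1)] p(1) by auto
      show "\<forall>v\<in>D (Suc m). \<not> crossing {v, w k} (e k)"
        using same_side_step[OF Sn k pD(2) p(2)] step.IH m pD(1) by blast
    qed
  qed
  then show ?thesis using v m(2) by blast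
qed

lemma crossing_tips: "k \<in> {1..n} \<Longrightarrow> crossing {u k, w k} (e k)" "k \<in> {1..n} \<Longrightarrow> crossing {w k, u k} (e k)"
proof -
  assume "k \<in> {1..n}"
  then obtain s t where st: "e k = {s, t}" "clockwise s (u k) t" "clockwise t (w k) s" by (elim hinge)
  show "crossing {u k, w k} (e k)" "crossing {w k, u k} (e k)"
    unfolding st(1) crossing_iff using st(2,3) unfolding separates_def clockwise_def nat_order_real by argo+
qed

text \<open>\<open>w k\<close> lies across \<open>e k\<close> from all earlier triangles; hence each
  new triangle brings a fresh vertex.\<close>

lemma w_notin: "k \<in> {1..n} \<Longrightarrow> m < k \<Longrightarrow> w k \<notin> D m"
  using left_side crossing_tips by blast

lemma u_notin: "k \<in> {1..n} \<Longrightarrow> k \<le> m \<Longrightarrow> m \<le> n \<Longrightarrow> u k \<notin> D m"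
  using right_side crossing_tips by blast

lemma w_notin_e: "k \<in> {1..n} \<Longrightarrow> 1 \<le> l \<Longrightarrow> l \<le> k \<Longrightarrow> w k \<notin> e l"
  using w_notin[of k "l - 1"] e_left[of l] by fastforce

lemma u_notin_e: "k \<in> {1..n} \<Longrightarrow> k \<le> l \<Longrightarrow> l \<le> n \<Longrightarrow> u k \<notin> e l"
  using u_notin[of k l] e_right[of l] by fastforce

text \<open>Seen from the hinge \<open>e j\<close>, the early tip \<open>u i\<close> is on the same
  side as \<open>u j\<close>.\<close>

lemma crossing_far_tips:
  assumes "i \<in> {1..n}" "j \<in> {1..n}" "i \<le> j"
  shows "crossing {u i, w j} (e j)"
proof -
  obtain s t where st: "e j = {s, t}" using e_doubleton[OF assms(2)] by blast
  have "\<not> separates (u j) (u i) s t"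
    using left_side[OF assms(2) _ u_mem[OF assms(1)]] assms separates_swap unfolding st crossing_iff by fastforce
  moreover have "separates (u j) (w j) s t" using crossing_tips(1)[OF assms(2)] unfolding st crossing_iff .
  moreover have "u i \<noteq> s" "u i \<noteq> t" using u_notin_e[OF assms(1,3)] assms st by auto
  ultimately show ?thesis unfolding st crossing_iff using separates_trans by blast
qed

text \<open>The next hinge is a side of \<open>D k\<close> other than \<open>e k\<close>, and both
  such sides pass through the tip.\<close>

lemma w_mem_next:
  assumes "1 \<le> k" "Suc k \<le> n" shows "w k \<in> e (Suc k)"
proof (rule ccontr)
  assume w: "w k \<notin> e (Suc k)"
  have k: "k \<in> {1..n}" "Suc k \<in> {1..n}" using assms by auto
  have "e (Suc k) \<subseteq> D k" using e_left[OF k(2)] by simp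
  moreover have "D k - {w k} \<subseteq> e k" using k(1) by (elim hinge) auto
  ultimately have "e (Suc k) \<subseteq> e k" using w by blast
  then show False using e_diff[OF k(2,1)] by (metis n_not_Suc_n subsetD)
qed

section \<open>Vertices and chords of a chain\<close>

abbreviation V :: "nat \<Rightarrow> nat \<Rightarrow> nat set" where "V h j \<equiv> \<Union>(D ` {h..j})"

lemma V_Suc: "h \<le> Suc j \<Longrightarrow> V h (Suc j) = V h j \<union> D (Suc j)"
  by (auto simp: atLeastAtMostSuc_conv)

lemma D_subset_V: "h \<le> m \<Longrightarrow> m \<le> j \<Longrightarrow> D m \<subseteq> V h j"
  by auto

lemma w_notin_V: "Suc j \<le> n \<Longrightarrow> w (Suc j) \<notin> V h j"
  using w_notin[of "Suc j"] by fastforce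

lemma V_insert:
  assumes "h \<le> j" "Suc j \<le> n"
  shows "V h (Suc j) = insert (w (Suc j)) (V h j)"
proof -
  have Sj: "Suc j \<in> {1..n}" using assms by simp
  have "e (Suc j) \<subseteq> V h j" using e_left[OF Sj] D_subset_V[OF assms(1), of j] by auto
  moreover have "D (Suc j) = insert (w (Suc j)) (e (Suc j))" using Sj by (elim hinge) auto
  ultimately show ?thesis unfolding V_Suc[OF le_SucI[OF assms(1)]] by auto
qed

lemma card_V: "j \<le> n \<Longrightarrow> finite (V 0 j) \<and> card (V 0 j) = j + 3"
proof (induction j)
  case 0
  then show ?case using D_card[of 0] by (simp add: card_ge_0_finite)
next
  case (Suc j)
  then show ?case using V_insert[of 0 j] w_notin_V[of j 0] by simp
qed

text \<open>Counting suffices: three vertices from \<open>D 0\<close> and one fresh tip for each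
  hinge make \<open>n + 3\<close>.\<close>

lemma V_eq_all:
  assumes "N = n + 3" shows "V 0 n = {..<N}"
proof (rule card_subset_eq)
  have "v < N" if v: "v \<in> D m" "m \<le> n" for v m
  proof -
    obtain v' where "v' \<in> D m" "v' \<noteq> v"
      using D_card[OF v(2)] v(1) by (metis card_1_singleton_iff is_singletonI' is_singleton_altdef numeral_eq_one_iff semiring_norm(86) empty_iff)
    then show ?thesis using full_triangulation_edge[OF T D_edge[OF v(2,1)]] by metis
  qed
  then show "V 0 n \<subseteq> {..<N}" by auto
  show "card (V 0 n) = card {..<N}" using card_V[of n] assms by simp
qed simp

text \<open>Passing hinge \<open>a\<close> drops exactly one vertex of \<open>D (a - 1)\<close>,
  namely \<open>u a\<close>; a vertex that is not on the current hinge was dropped at this or an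
  earlier one.\<close>

lemma left_vertex:
  assumes "j < n" "v \<in> V 0 j" "v \<notin> e (Suc j)"
  shows "\<exists>a\<in>{1..Suc j}. v = u a"
  using assms
proof (induction j)
  case 0
  then have "Suc 0 \<in> {1..n}" by simp
  then have "D 0 \<subseteq> insert (u 1) (e 1)" by (elim hinge) auto
  then show ?case using 0 by auto
next
  case (Suc j)
  have k: "Suc (Suc j) \<in> {1..n}" "Suc j \<in> {1..n}" using Suc.prems by auto
  have D: "D (Suc j) \<subseteq> insert (u (Suc (Suc j))) (e (Suc (Suc j)))" using k(1) by (elim hinge) auto
  show ?case
  proof (cases "v \<in> D (Suc j)")
    case True
    then show ?thesis using D Suc.prems by auto
  next
    case False
    then have "v \<in> V 0 j" "v \<notin> e (Suc j)" using Suc.prems(2) V_Suc[of 0 j] e_right[OF k(2)] by auto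
    then show ?thesis using Suc.IH Suc.prems(1) by fastforce
  qed
qed

text \<open>Each step adds only the chords at the new tip. Their other end is on the hinge, which
  gives an edge, or has been dropped before and is some \<open>u a\<close>.\<close>

lemma chord_cases_V:
  assumes "j \<le> n" "v \<in> V 0 j" "v' \<in> V 0 j" "v \<noteq> v'"
  shows "{v, v'} \<in> E \<or> (\<exists>a b. 1 \<le> a \<and> a \<le> b \<and> b \<le> n \<and> {v, v'} = {u a, w b})"
  using assms
proof (induction j arbitrary: v v')
  case 0
  then show ?case using D_edge[of 0 v v'] by auto
next
  case (Suc j)
  have k: "Suc j \<in> {1..n}" using Suc.prems by auto
  have new: "{v, w (Suc j)} \<in> E \<or> (\<exists>a b. 1 \<le> a \<and> a \<le> b \<and> b \<le> n \<and> {v, w (Suc j)} = {u a, w b})"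
    if v: "v \<in> V 0 j" for v
  proof (cases "v \<in> e (Suc j)")
    case True
    then have "v \<in> D (Suc j)" "v \<noteq> w (Suc j)" using e_right[OF k] w_notin_e[OF k] by auto
    then show ?thesis using D_edge[OF _ _ w_mem[OF k]] k by auto
  next
    case False
    then obtain a where "a \<in> {1..Suc j}" "v = u a" using left_vertex[of j v] k v by auto
    then show ?thesis using k by (intro disjI2 exI[of _ a] exI[of _ "Suc j"]) auto
  qed
  have VS: "V 0 (Suc j) = insert (w (Suc j)) (V 0 j)" using V_insert[of 0 j] k by simp
  consider "v \<in> V 0 j" "v' \<in> V 0 j" | "v = w (Suc j)" "v' \<in> V 0 j" | "v' = w (Suc j)" "v \<in> V 0 j"
    using Suc.prems unfolding VS by blast
  then show ?case
  proof cases
    case 1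
    then show ?thesis using Suc.IH[OF _ 1 Suc.prems(4)] Suc.prems(1) by simp
  next
    case 2
    then show ?thesis using new[OF 2(2)] by (simp add: insert_commute)
  next
    case 3
    then show ?thesis using new[OF 3(2)] by simp
  qed
qed

lemma chord_cases:
  assumes "N = n + 3" "v < N" "v' < N" "v \<noteq> v'"
  obtains "{v, v'} \<in> E" | a b where "1 \<le> a" "a \<le> b" "b \<le> n" "{v, v'} = {u a, w b}"
  using chord_cases_V[of n v v'] assms V_eq_all by auto

end

section \<open>Matching sums along a chain\<close>

context triangle_chain
begin

text \<open>Here \<open>h\<close> is the first triangle, so the first hinge inside is
  \<open>Suc h\<close>. A free \<open>v\<close> makes the recursion close; for \<open>j > h\<close>
  the choice \<open>v = w j\<close> gives the angle matchings of the subpolygon.\<close>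

definition path_sum :: "(angle \<Rightarrow> 'c::comm_ring_1) \<Rightarrow> nat \<Rightarrow> nat \<Rightarrow> nat \<Rightarrow> 'c" where
  "path_sum wt h j v = matching_sum wt (D ` {h..j}) (V h j - {u (Suc h), v})"

lemma finite_D: "k \<le> n \<Longrightarrow> finite (D k)"
  using D_card by (metis card.infinite zero_neq_numeral)

lemma ear_facts:
  assumes h: "h \<le> j" "Suc j \<le> n" and st: "e (Suc j) = {s, t}" "s \<noteq> t"
  shows "D (Suc j) = {s, t, w (Suc j)}" "finite (D ` {h..j})" "\<And>\<Delta>. \<Delta> \<in> D ` {h..j} \<Longrightarrow> finite \<Delta>"
    "s \<in> V h j" "t \<in> V h j" "u (Suc h) \<in> V h j" "u (Suc h) \<noteq> s" "u (Suc h) \<noteq> t"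
    "D ` {h..Suc j} = insert {s, t, w (Suc j)} (D ` {h..j})"
proof -
  have k: "Suc j \<in> {1..n}" "Suc h \<in> {1..n}" using h by auto
  show D: "D (Suc j) = {s, t, w (Suc j)}" using k(1) by (elim hinge) (use st in auto)
  show "finite (D ` {h..j})" by simp
  show "\<And>\<Delta>. \<Delta> \<in> D ` {h..j} \<Longrightarrow> finite \<Delta>" using finite_D h by fastforce
  have "e (Suc j) \<subseteq> V h j" using e_left[OF k(1)] D_subset_V[OF h(1), of j] by auto
  then show "s \<in> V h j" "t \<in> V h j" using st by auto
  show "u (Suc h) \<in> V h j" using u_mem[OF k(2)] D_subset_V[of h h j] h by auto
  show "u (Suc h) \<noteq> s" "u (Suc h) \<noteq> t" using u_notin_e[OF k(2), of "Suc j"] h st by auto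
  show "D ` {h..Suc j} = insert {s, t, w (Suc j)} (D ` {h..j})"
    unfolding D[symmetric] using h by (simp add: atLeastAtMostSuc_conv)
qed

lemma path_sum_tip:
  assumes h: "h \<le> j" "Suc j \<le> n" and st: "e (Suc j) = {s, t}" "s \<noteq> t"
  shows "path_sum wt h (Suc j) (w (Suc j)) =
    wt (D (Suc j), s) * path_sum wt h j s + wt (D (Suc j), t) * path_sum wt h j t"
  unfolding path_sum_def V_insert[OF h]
  unfolding ear_facts(9)[OF assms] ear_facts(1)[OF assms]
  by (rule matching_sum_ear(1)[OF ear_facts(2,3)[OF assms] w_notin_V[OF h(2)]
      ear_facts(4,5)[OF assms] st(2) ear_facts(6,7,8)[OF assms]])

lemma path_sum_old:
  assumes h: "h \<le> j" "Suc j \<le> n" and v: "v \<in> V h j"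
  shows "path_sum wt h (Suc j) v = wt (D (Suc j), w (Suc j)) * path_sum wt h j v"
proof -
  obtain s t where st: "e (Suc j) = {s, t}" "s \<noteq> t" using e_doubleton[of "Suc j"] h by auto
  note facts = ear_facts[OF h st]
  show ?thesis
    unfolding path_sum_def V_insert[OF h]
    unfolding facts(9) facts(1)
    by (rule matching_sum_ear(2)[OF facts(2,3) w_notin_V[OF h(2)] facts(4,5) st(2) facts(6,7,8) v])
qed

text \<open>With \<open>u (Suc h)\<close> and one end of the hinge omitted, the single triangle must
  mark the other end; hence the exchange of \<open>s\<close> and \<open>t\<close>.\<close>

lemma path_sum_base:
  assumes h: "h < n" and st: "e (Suc h) = {s, t}" "s \<noteq> t"
  shows "D h = {s, t, u (Suc h)}" "u (Suc h) \<noteq> s" "u (Suc h) \<noteq> t"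
    "path_sum wt h h s = wt (D h, t)" "path_sum wt h h t = wt (D h, s)"
proof -
  have k: "Suc h \<in> {1..n}" using h by simp
  show D: "D h = {s, t, u (Suc h)}" and u: "u (Suc h) \<noteq> s" "u (Suc h) \<noteq> t"
    using k by (elim hinge; use st in auto)+
  have "D h - {u (Suc h), s} = {t}" "D h - {u (Suc h), t} = {s}" using D u st(2) by auto
  then show "path_sum wt h h s = wt (D h, t)" "path_sum wt h h t = wt (D h, s)"
    unfolding path_sum_def
    using matching_sum_singleton[of "D h" t wt] matching_sum_singleton[of "D h" s wt] D by simp_all
qed

text \<open>An angle weighs as much as its opposite side is long. At a new tip the recursion is then
  Ptolemy's relation for \<open>u (Suc h)\<close>, the tip and the two ends of the last hinge; at an
  old vertex both sides gain the length of that hinge.\<close>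

lemma path_sum_chord_length:
  fixes p :: "nat \<Rightarrow> 'a::comm_ring_1 \<times> 'a"
  assumes wt: "\<And>\<Delta> v. wt (\<Delta>, v) = chord_length p (\<Delta> - {v})"
    and h: "h < n" "h \<le> j" "j \<le> n" and v: "v \<in> V h j" "v \<noteq> u (Suc h)"
  shows "path_sum wt h j v = chord_length p {u (Suc h), v} * (\<Prod>k=Suc h..j. chord_length p (e k))"
  using h(2,3) v
proof (induction j arbitrary: v rule: dec_induct)
  case base
  obtain s t where st: "e (Suc h) = {s, t}" "s \<noteq> t" using e_doubleton[of "Suc h"] h by auto
  note facts = path_sum_base[OF h(1) st]
  have "v = s \<or> v = t" using base.prems facts(1) by auto
  moreover have "D h - {t} = {u (Suc h), s}" "D h - {s} = {u (Suc h), t}" using facts(1-3) st(2) by auto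
  ultimately show ?case using facts(4,5)[of wt] by (elim disjE) (simp_all add: wt)
next
  case (step j)
  have k: "Suc j \<in> {1..n}" "Suc h \<in> {1..n}" and j: "Suc j \<le> n" "j \<le> n" "h \<le> j" using step by auto
  obtain s t where st: "e (Suc j) = {s, t}" "s \<noteq> t" using e_doubleton[OF k(1)] by blast
  note facts = ear_facts[OF j(3,1) st]
  let ?u = "u (Suc h)" and ?w = "w (Suc j)"
  have w: "?w \<noteq> s" "?w \<noteq> t" using w_notin_V[OF j(1), of h] facts(4,5) by auto
  have Ds: "D (Suc j) - {s} = {t, ?w}" "D (Suc j) - {t} = {s, ?w}" "D (Suc j) - {?w} = {s, t}"
    using facts(1) w st(2) by auto
  have prod: "(\<Prod>k=Suc h..Suc j. chord_length p (e k)) =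
      chord_length p {s, t} * (\<Prod>k=Suc h..j. chord_length p (e k))"
    using j st by (simp add: mult.commute)
  show ?case
  proof (cases "v = ?w")
    case True
    have "separates ?u ?w s t"
      using crossing_far_tips[OF k(2,1)] j unfolding st(1) crossing_iff by simp
    then have "chord_length p {?u, ?w} * chord_length p {s, t} =
        chord_length p {?u, s} * chord_length p {?w, t} + chord_length p {s, ?w} * chord_length p {t, ?u}"
      by (rule ptolemy_separates)
    moreover have "path_sum wt h j s = chord_length p {?u, s} * (\<Prod>k=Suc h..j. chord_length p (e k))"
      by (rule step.IH[OF j(2) facts(4)]) (use facts(7) in simp)
    moreover have "path_sum wt h j t = chord_length p {?u, t} * (\<Prod>k=Suc h..j. chord_length p (e k))"
      by (rule step.IH[OF j(2) facts(5)]) (use facts(8) in simp)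
    ultimately show ?thesis
      unfolding True path_sum_tip[OF j(3,1) st] wt Ds prod mult.assoc[symmetric]
      by (simp add: insert_commute algebra_simps)
  next
    case False
    then have v: "v \<in> V h j" using step.prems(2) unfolding V_insert[OF j(3,1)] by blast
    show ?thesis
      unfolding path_sum_old[OF j(3,1) v] wt Ds prod step.IH[OF j(2) v step.prems(3)] by (simp add: mult_ac)
  qed
qed

lemma path_sum_nonneg:
  fixes wt :: "angle \<Rightarrow> int"
  assumes "\<And>a. 0 \<le> wt a" shows "0 \<le> path_sum wt h j v"
  unfolding path_sum_def matching_sum_def by (intro sum_nonneg prod_nonneg assms)

text \<open>The weights count the matchings in which no marked angle is opposite to \<open>e k\<close>. Before step \<open>k\<close> all
  the counts are positive; from step \<open>k\<close> on the new tip cannot lie on \<open>e k\<close>, so its count is the sum of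
  those of the two ends of the last diagonal, one of which is the previous tip.\<close>

lemma path_sum_pos:
  fixes wt :: "angle \<Rightarrow> int"
  assumes wt: "\<And>\<Delta> v. wt (\<Delta>, v) = (if \<Delta> - {v} = e k then 0 else 1)" and k: "k \<in> {1..n}"
    and h: "h < n" "h \<le> j" "Suc j \<le> n"
  shows "0 < path_sum wt h (Suc j) (w (Suc j))"
proof -
  let ?u = "u (Suc h)"
  have hn: "Suc h \<in> {1..n}" using h by simp
  have wt0: "0 \<le> wt a" for a using wt[of "fst a" "snd a"] by simp
  have nonneg: "0 \<le> path_sum wt h j v" for h j v by (rule path_sum_nonneg[OF wt0])
  have tip_eq: "path_sum wt h (Suc j) (w (Suc j)) = path_sum wt h j s + path_sum wt h j t"
    if j: "h \<le> j" "Suc j \<le> n" "k \<le> Suc j" and st: "e (Suc j) = {s, t}" "s \<noteq> t" for j s t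
  proof -
    have w: "w (Suc j) \<notin> e k" "w (Suc j) \<notin> {s, t}"
      using w_notin_e[of "Suc j" k] w_notin_e[of "Suc j" "Suc j"] j k st by auto
    then have "D (Suc j) - {s} \<noteq> e k" "D (Suc j) - {t} \<noteq> e k"
      using ear_facts(1)[OF j(1,2) st] by auto
    then show ?thesis unfolding path_sum_tip[OF j(1,2) st] wt by simp
  qed
  have old: "0 < path_sum wt h j v" if "Suc h \<le> k" "h \<le> j" "j < k" "v \<in> V h j" "v \<noteq> ?u" for j v
    using that(2-)
  proof (induction j arbitrary: v rule: dec_induct)
    case base
    obtain s t where st: "e (Suc h) = {s, t}" "s \<noteq> t" using e_doubleton[OF hn] by blast
    note facts = path_sum_base[OF h(1) st]
    have "?u \<notin> e k" using u_notin_e[OF hn that(1)] k by simp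
    then have "D h - {s} \<noteq> e k" "D h - {t} \<noteq> e k" using facts(1-3) by auto
    moreover have "v = s \<or> v = t" using base.prems facts(1) by auto
    ultimately show ?case using facts(4,5)[of wt] by (elim disjE) (simp_all add: wt)
  next
    case (step j)
    have kj: "Suc j \<in> {1..n}" and j: "Suc j \<le> n" "j < k" "h \<le> j" using step k by auto
    obtain s t where st: "e (Suc j) = {s, t}" "s \<noteq> t" using e_doubleton[OF kj] by blast
    note facts = ear_facts[OF j(3,1) st]
    let ?w = "w (Suc j)"
    have w: "?w \<noteq> s" "?w \<noteq> t" using w_notin_V[OF j(1), of h] facts(4,5) by auto
    have Ds: "D (Suc j) - {s} = {t, ?w}" "D (Suc j) - {t} = {s, ?w}" "D (Suc j) - {?w} = {s, t}"
      using facts(1) w st(2) by auto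
    show ?case
    proof (cases "v = ?w")
      case True
      have "0 < path_sum wt h j s" "0 < path_sum wt h j t"
        using step.IH[OF j(2) facts(4)] step.IH[OF j(2) facts(5)] facts(7,8) by auto
      \<comment> \<open>The two sides at the new tip are different, so at most one term of the
        recursion vanishes.\<close>
      moreover have "\<not> ({t, ?w} = e k \<and> {s, ?w} = e k)" using st(2) w by (metis doubleton_eq_iff)
      ultimately show ?thesis unfolding True path_sum_tip[OF j(3,1) st] wt Ds by auto
    next
      case False
      then have v: "v \<in> V h j" using step.prems(2) unfolding V_insert[OF j(3,1)] by blast
      have "e (Suc j) \<noteq> e k" using e_inj kj k step.prems(1) by (metis inj_onD less_irrefl)
      then show ?thesis
        unfolding path_sum_old[OF j(3,1) v] wt Ds using step.IH[OF j(2) v step.prems(3)] st by simp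
    qed
  qed
  show ?thesis
    using h(2,3)
  proof (induction j rule: dec_induct)
    case base
    obtain s t where st: "e (Suc h) = {s, t}" "s \<noteq> t" using e_doubleton[OF hn] by blast
    note facts = path_sum_base[OF h(1) st]
    have st_V: "s \<in> V h h" "t \<in> V h h" using facts(1) by auto
    show ?case
    proof (cases "k \<le> Suc h")
      case True
      \<comment> \<open>At most one of the two sides through the first tip is \<open>e k\<close>, so
        one summand survives.\<close>
      have "D h - {s} \<noteq> D h - {t}" using facts(1-3) st(2) by auto
      then show ?thesis unfolding tip_eq[OF order_refl base.prems True st] facts(4,5) wt by auto
    next
      case False
      then show ?thesis
        using old[of "Suc h" "w (Suc h)"] w_mem[OF hn] w_notin_V[of h h] u_mem[OF hn] hn by fastforce
    qed
  next
    case (step j)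
    have kj: "Suc (Suc j) \<in> {1..n}" "Suc j \<in> {1..n}" using step by auto
    obtain s t where st: "e (Suc (Suc j)) = {s, t}" "s \<noteq> t" using e_doubleton[OF kj(1)] by blast
    have hj: "h \<le> Suc j" "Suc (Suc j) \<le> n" using step by auto
    note facts = ear_facts[OF hj st]
    consider "Suc (Suc j) < k" | "k = Suc (Suc j)" | "k \<le> Suc j" by linarith
    then show ?case
    proof cases
      case 1
      have "w (Suc (Suc j)) \<noteq> ?u" using w_notin_V[OF hj(2), of h] facts(6) by auto
      moreover have "w (Suc (Suc j)) \<in> V h (Suc (Suc j))" using V_insert[OF hj] by blast
      ultimately show ?thesis using old[of "Suc (Suc j)"] 1 hj by simp
    next
      case 2
      then have "0 < path_sum wt h (Suc j) s" using old[of "Suc j" s] facts(4,7) hj by auto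
      then show ?thesis using tip_eq[OF hj _ st] 2 nonneg[of h "Suc j" t] by simp
    next
      case 3
      have "w (Suc j) = s \<or> w (Suc j) = t" using w_mem_next[of "Suc j"] st kj by auto
      then have "0 < path_sum wt h (Suc j) s + path_sum wt h (Suc j) t"
        using step.IH hj nonneg[of h "Suc j" t] nonneg[of h "Suc j" s] by (elim disjE) auto
      then show ?thesis using tip_eq[OF hj _ st] 3 by simp
    qed
  qed
qed

text \<open>The extreme tips are the only vertices of the subpolygon on none of its diagonals: an
  intermediate tip \<open>w m\<close> lies on the next hinge.\<close>

lemma V_conv_tips:
  assumes "h \<le> j" "Suc j \<le> n"
  shows "V h (Suc j) - {u (Suc h), w (Suc j)} = V h (Suc j) \<inter> \<Union>(e ` {Suc h..Suc j})"
proof (intro equalityI subsetI)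
  fix v assume v: "v \<in> V h (Suc j) \<inter> \<Union>(e ` {Suc h..Suc j})"
  then obtain l where l: "Suc h \<le> l" "l \<le> Suc j" "v \<in> e l" by auto
  then show "v \<in> V h (Suc j) - {u (Suc h), w (Suc j)}"
    using v u_notin_e[of "Suc h" l] w_notin_e[of "Suc j" l] assms by auto
next
  fix v assume v: "v \<in> V h (Suc j) - {u (Suc h), w (Suc j)}"
  then obtain m where m: "h \<le> m" "m \<le> Suc j" "v \<in> D m" by auto
  have "v \<in> e m \<and> Suc h \<le> m \<or> v \<in> e (Suc m) \<and> m \<le> j"
  proof (cases "m = h")
    case True
    have "Suc h \<in> {1..n}" using assms by simp
    then have "D h \<subseteq> insert (u (Suc h)) (e (Suc h))" by (elim hinge) auto
    then show ?thesis using True v m assms by auto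
  next
    case False
    then have mn: "m \<in> {1..n}" "Suc h \<le> m" using m assms by auto
    have Dm: "D m \<subseteq> insert (w m) (e m)" using mn(1) by (elim hinge) auto
    show ?thesis
    proof (cases "v = w m")
      case True
      then have "m \<le> j" using v m(2) by (metis DiffD2 insertI1 insertI2 le_SucE)
      then show ?thesis using True w_mem_next[of m] mn assms by auto
    next
      case False
      then show ?thesis using Dm m(3) mn(2) by auto
    qed
  qed
  then show "v \<in> V h (Suc j) \<inter> \<Union>(e ` {Suc h..Suc j})" using v m by fastforce
qed

lemma angle_matchings_chain:
  assumes "h \<le> j" "Suc j \<le> n"
  shows "(\<Sum>A\<in>angle_matchings (D ` {h..Suc j}) (e ` {Suc h..Suc j}). \<Prod>a\<in>A. wt a) =
    path_sum wt h (Suc j) (w (Suc j))"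
  unfolding angle_matchings_eq path_sum_def matching_sum_def V_conv_tips[OF assms] ..

end

section \<open>The triangles along a path quiver\<close>

lemma trianglesE:
  assumes "\<Delta> \<in> triangles n e"
  obtains a b c where "\<Delta> = {a, b, c}" "clockwise a b c"
  using assms unfolding triangles_def mem_Collect_eq by (elim exE conjE) (rule that)

text \<open>The third vertex of a triangle at a diagonal is the unique apex on its side.\<close>

lemma diagonal_triangles:
  assumes L: "labelled_triangulation n e" and k: "k \<in> {1..n}"
  obtains \<Delta>1 \<Delta>2 where "\<Delta>1 \<noteq> \<Delta>2" "{\<Delta> \<in> triangles n e. e k \<subseteq> \<Delta>} = {\<Delta>1, \<Delta>2}"
proof -
  note T = labelled_triangulation_edges(1)[OF L]
  obtain a b c d where ek: "e k = {a, c}" and q: "quad (e ` {1..2*n+3}) a b c d"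
    by (rule diagonal_quad[OF L k])
  define E where "E = e ` {1..2*n+3}"
  note T = T[folded E_def] and q = q[folded E_def]
  note ne = quad_distinct[OF q]
  have cw: "clockwise a b c" "clockwise c d a" "clockwise a c d"
    and E: "{a, b} \<in> E" "{b, c} \<in> E" "{c, d} \<in> E" "{d, a} \<in> E" "{a, c} \<in> E" "{c, a} \<in> E"
    using q clockwise_rotate by (auto simp: quad_def insert_commute)
  have "{a, b, c} \<in> triangles n e" "{a, c, d} \<in> triangles n e"
    unfolding triangles_iff[OF cw(1)] triangles_iff[OF cw(3)] E_def[symmetric] using E by blast+
  moreover have "\<Delta> = {a, b, c} \<or> \<Delta> = {a, c, d}" if \<Delta>: "\<Delta> \<in> triangles n e" "{a, c} \<subseteq> \<Delta>" for \<Delta>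
  proof -
    have edge: "{v, v'} \<in> E" if "v \<in> \<Delta>" "v' \<in> \<Delta>" "v \<noteq> v'" for v v'
      unfolding E_def using triangles_edge[OF \<Delta>(1)] that by simp
    obtain p q' r where "\<Delta> = {p, q', r}" "clockwise p q' r" using \<Delta>(1) by (rule trianglesE)
    then have "card \<Delta> = 3" using clockwise_distinct[of p q' r] by auto
    then have "card (\<Delta> - {a, c}) = 1" using \<Delta>(2) ne(2) by (simp add: card_Diff_subset)
    then obtain v where "\<Delta> - {a, c} = {v}" by (metis card_1_singletonE)
    then have v: "\<Delta> = {a, c, v}" "v \<noteq> a" "v \<noteq> c" using \<Delta>(2) by auto
    have Ev: "{a, v} \<in> E" "{v, c} \<in> E" "{c, v} \<in> E" "{v, a} \<in> E"
      by (rule edge; use v in simp)+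
    consider "clockwise a v c" | "clockwise c v a"
      using clockwise_total[of a v c] v ne(2) by metis
    then show ?thesis
    proof cases
      case 1
      then have "v = b" using apex_unique[OF T 1 cw(1) Ev(1,2) E(1,2)] by simp
      then show ?thesis using v(1) by auto
    next
      case 2
      then have "v = d" using apex_unique[OF T 2 cw(2) Ev(3,4) E(3,4)] by simp
      then show ?thesis using v(1) by auto
    qed
  qed
  ultimately have "{\<Delta> \<in> triangles n e. e k \<subseteq> \<Delta>} = {{a, b, c}, {a, c, d}}"
    unfolding ek by auto
  moreover have "b \<in> {a, b, c}" "b \<notin> {a, c, d}" using ne by auto
  ultimately show thesis using that by metis
qed

lemma follows_common_triangle:
  assumes "follows n e k l"
  shows "\<exists>\<Delta>\<in>triangles n e. e k \<subseteq> \<Delta> \<and> e l \<subseteq> \<Delta>"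
proof -
  obtain a b c where "{a, b, c} \<in> triangles n e" "e k = {a, b}" "e l = {b, c}"
    using assms unfolding follows_def by blast
  then show ?thesis by (intro bexI[of _ "{a, b, c}"]) auto
qed

lemma doubleton_in_triple: "{s, t} \<subseteq> {a, b, c} \<Longrightarrow> s \<noteq> t \<Longrightarrow> {s, t} = {a, b} \<or> {s, t} = {b, c} \<or> {s, t} = {c, a}"
  by auto

text \<open>Of two distinct sides of a triangle one always follows the other in the cyclic order of
  the three.\<close>

lemma common_triangle_follows:
  assumes L: "labelled_triangulation n e" and k: "k \<in> {1..2*n+3}" "l \<in> {1..2*n+3}" "k \<noteq> l"
    and \<Delta>: "\<Delta> \<in> triangles n e" "e k \<subseteq> \<Delta>" "e l \<subseteq> \<Delta>"
  shows "follows n e k l \<or> follows n e l k"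
proof -
  define E where "E = e ` {1..2*n+3}"
  note T = labelled_triangulation_edges(1)[OF L, folded E_def]
  have ne: "e k \<noteq> e l" using labelled_triangulation_edges(2)[OF L] k by (metis inj_onD)
  obtain a b c where abc: "\<Delta> = {a, b, c}" "clockwise a b c"
    using \<Delta>(1) by (rule trianglesE)
  have E: "{a, b} \<in> E" "{b, c} \<in> E" "{c, a} \<in> E"
    using \<Delta>(1) unfolding abc(1) triangles_iff[OF abc(2)] E_def[symmetric] by blast+
  have cw: "clockwise b c a" "clockwise c a b" using abc(2) clockwise_rotate by blast+
  have "e k \<in> E" "e l \<in> E" using k unfolding E_def by (simp_all only: imageI)
  then obtain s t s' t' where st: "e k = {s, t}" "s \<noteq> t" "e l = {s', t'}" "s' \<noteq> t'"
    using full_triangulation_edgeE[OF T] by metis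
  have side: "e k = {a, b} \<or> e k = {b, c} \<or> e k = {c, a}" "e l = {a, b} \<or> e l = {b, c} \<or> e l = {c, a}"
    using \<Delta>(2,3) doubleton_in_triple st unfolding abc(1) by metis+
  note next_sides = next_sideI[OF abc(2) E(1,2,3)] next_sideI[OF cw(1) E(2,3,1)] next_sideI[OF cw(2) E(3,1,2)]
  have "next_side E (e k) (e l) \<or> next_side E (e l) (e k)"
    using side ne next_sides by (elim disjE) simp_all
  then show ?thesis unfolding follows_iff E_def .
qed

text \<open>Neighbouring diagonals share a triangle, those two steps apart share none. So the
  triangle shared with the next diagonal is not the one shared with the previous diagonal, and the
  triangles line up.\<close>

lemma path_quiver_triangles:
  assumes L: "labelled_triangulation n e" and Q: "acyclic_path_quiver n (Q_of n e)" and "1 \<le> n"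
  obtains D where "\<And>k. k \<in> {1..n} \<Longrightarrow> {\<Delta> \<in> triangles n e. e k \<subseteq> \<Delta>} = {D (k - 1), D k}"
    "\<And>k. k \<in> {1..n} \<Longrightarrow> D (k - 1) \<noteq> D k"
proof -
  define X where "X k = {\<Delta> \<in> triangles n e. e k \<subseteq> \<Delta>}" for k
  have X: "\<exists>\<Delta>1 \<Delta>2. \<Delta>1 \<noteq> \<Delta>2 \<and> X k = {\<Delta>1, \<Delta>2}" if "k \<in> {1..n}" for k
    using diagonal_triangles[OF L that] unfolding X_def by metis
  have arrows: "follows n e k l \<or> follows n e l k \<longleftrightarrow> l = Suc k \<or> k = Suc l"
    if k: "k \<in> {1..n}" and l: "l \<in> {1..n}" for k l
  proof -
    have "Q_of n e k l + Q_of n e l k = (if l = k + 1 \<or> k = l + 1 then 1 else 0)"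
      using Q k l unfolding acyclic_path_quiver_def by (elim conjE) (drule bspec, assumption, drule bspec, assumption)
    moreover have "Q_of n e k l = of_bool (follows n e k l)" "Q_of n e l k = of_bool (follows n e l k)"
      using k l by (simp_all add: Q_of_def)
    ultimately have "of_bool (follows n e k l) + of_bool (follows n e l k) =
        (if l = Suc k \<or> k = Suc l then 1 else (0::nat))"
      by (simp only: Suc_eq_plus1)
    then show ?thesis unfolding of_bool_def by (metis add_is_0 zero_neq_one)
  qed
  have common: "X k \<inter> X (Suc k) \<noteq> {}" if "k \<in> {1..n}" "Suc k \<in> {1..n}" for k
  proof -
    have "follows n e k (Suc k) \<or> follows n e (Suc k) k" using arrows[OF that] by simp
    then have "\<exists>\<Delta>\<in>triangles n e. e k \<subseteq> \<Delta> \<and> e (Suc k) \<subseteq> \<Delta>"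
      using follows_common_triangle by metis
    then show ?thesis unfolding X_def by blast
  qed
  have apart: "X k \<inter> X (Suc (Suc k)) = {}" if kl: "k \<in> {1..n}" "Suc (Suc k) \<in> {1..n}" for k
  proof (rule equals0I)
    fix \<Delta> assume "\<Delta> \<in> X k \<inter> X (Suc (Suc k))"
    then have \<Delta>: "\<Delta> \<in> triangles n e" "e k \<subseteq> \<Delta>" "e (Suc (Suc k)) \<subseteq> \<Delta>" unfolding X_def by simp_all
    have "follows n e k (Suc (Suc k)) \<or> follows n e (Suc (Suc k)) k"
      by (rule common_triangle_follows[OF L _ _ _ \<Delta>]) (use kl in auto)
    then show False using arrows[OF kl] by simp
  qed
  \<comment> \<open>The last conjunct keeps the open end of the chain at the triangle from which the
    next diagonal continues.\<close>
  have "\<exists>D. (\<forall>k\<in>{1..j}. X k = {D (k - 1), D k} \<and> D (k - 1) \<noteq> D k) \<and> (j < n \<longrightarrow> D j \<in> X (Suc j))"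
    if "1 \<le> j" "j \<le> n" for j
    using that
  proof (induction j rule: dec_induct)
    case base
    obtain \<Delta>1 \<Delta>2 where \<Delta>: "\<Delta>1 \<noteq> \<Delta>2" "X 1 = {\<Delta>1, \<Delta>2}" using X[of 1] base by auto
    \<comment> \<open>The two triangles at the first diagonal are named so that \<open>D 1\<close>
      also contains the second diagonal; for \<open>n = 1\<close> either order will do.\<close>
    have "n = 1 \<or> \<Delta>2 \<in> X 2 \<or> \<Delta>1 \<in> X 2"
      using common[of 1] base \<Delta>(2) by (cases "n = 1") (auto simp: numeral_2_eq_2)
    then consider "n = 1 \<or> \<Delta>2 \<in> X 2" | "\<Delta>1 \<in> X 2" by blast
    then show ?case
    proof cases
      case 1
      then show ?thesis
        using \<Delta> by (intro exI[of _ "\<lambda>k. if k = 0 then \<Delta>1 else \<Delta>2"]) (auto simp: numeral_2_eq_2)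
    next
      case 2
      then show ?thesis
        using \<Delta> by (intro exI[of _ "\<lambda>k. if k = 0 then \<Delta>2 else \<Delta>1"]) (auto simp: numeral_2_eq_2)
    qed
  next
    case (step j)
    have "j \<le> n" "j < n" using step.prems by auto
    then obtain D where D_all: "\<forall>k\<in>{1..j}. X k = {D (k - 1), D k} \<and> D (k - 1) \<noteq> D k" and Dj: "D j \<in> X (Suc j)"
      using step.IH by metis
    note D = bspec[OF D_all]
    have Sj: "Suc j \<in> {1..n}" "j \<in> {1..n}" using step by auto
    obtain \<Delta> where \<Delta>: "\<Delta> \<noteq> D j" "X (Suc j) = {D j, \<Delta>}" using X[OF Sj(1)] Dj by (metis doubleton_eq_iff insert_iff singletonD)
    have last: "\<Delta> \<in> X (Suc (Suc j))" if "Suc j < n"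
    proof -
      have SSj: "Suc (Suc j) \<in> {1..n}" using that by simp
      have "D j \<in> X j" using D[of j] step.hyps by auto
      then have "D j \<notin> X (Suc (Suc j))" using apart[OF Sj(2) SSj] by blast
      then show ?thesis using common[OF Sj(1) SSj, unfolded \<Delta>(2)] by auto
    qed
    have "X k = {(D(Suc j := \<Delta>)) (k - 1), (D(Suc j := \<Delta>)) k} \<and> (D(Suc j := \<Delta>)) (k - 1) \<noteq> (D(Suc j := \<Delta>)) k"
      if k: "k \<in> {1..Suc j}" for k
    proof (cases "k = Suc j")
      case True
      then show ?thesis using \<Delta>(2) not_sym[OF \<Delta>(1)] by simp
    next
      case False
      then have "k \<in> {1..j}" "k - 1 \<noteq> Suc j" using k by auto
      then show ?thesis using D[of k] False by (simp only: fun_upd_apply if_False simp_thms)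
    qed
    then show ?case using last by (intro exI[of _ "D(Suc j := \<Delta>)"]) simp
  qed
  from this[OF assms(3) order_refl] obtain D
    where D: "\<forall>k\<in>{1..n}. X k = {D (k - 1), D k} \<and> D (k - 1) \<noteq> D k"
    by (elim exE conjE)
  note D' = bspec[OF D, unfolded X_def]
  show thesis by (rule that[OF conjunct1[OF D'] conjunct2[OF D']])
qed

lemma path_quiver_chain:
  assumes L: "labelled_triangulation n e" and n: "1 \<le> n"
    and D: "\<And>k. k \<in> {1..n} \<Longrightarrow> {\<Delta> \<in> triangles n e. e k \<subseteq> \<Delta>} = {D (k - 1), D k}"
    "\<And>k. k \<in> {1..n} \<Longrightarrow> D (k - 1) \<noteq> D k"
  shows "triangle_chain (n + 3) n (e ` {1..2*n+3}) e D"
proof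
  show "full_triangulation (n + 3) (e ` {1..2*n+3})" by (rule labelled_triangulation_edges(1)[OF L])
  have tri: "D k \<in> triangles n e" if "k \<le> n" for k
  proof -
    \<comment> \<open>\<open>D 0\<close> is a triangle at diagonal 1, every other \<open>D k\<close>
      one at diagonal \<open>k\<close>.\<close>
    define l where "l = max k 1"
    have "l \<in> {1..n}" "k = l \<or> k = l - 1" using n that by (auto simp: l_def)
    then have "D k \<in> {\<Delta> \<in> triangles n e. e l \<subseteq> \<Delta>}" using D(1)[of l] by auto
    then show ?thesis by simp
  qed
  show "{v, w} \<in> e ` {1..2*n+3}" if "k \<le> n" "v \<in> D k" "w \<in> D k" "v \<noteq> w" for k v w
    by (rule triangles_edge[OF tri[OF that(1)] that(2-4)])
  show "card (D k) = 3" if k: "k \<le> n" for k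
  proof -
    obtain a b c where "D k = {a, b, c}" "clockwise a b c" using tri[OF k] by (rule trianglesE)
    then show ?thesis using clockwise_distinct[of a b c] by auto
  qed
  fix k assume k: "k \<in> {1..n}"
  show "e k \<in> e ` {1..2*n+3}" by (rule imageI) (use k in auto)
  have "D (k - 1) \<in> {\<Delta> \<in> triangles n e. e k \<subseteq> \<Delta>}" "D k \<in> {\<Delta> \<in> triangles n e. e k \<subseteq> \<Delta>}"
    unfolding D(1)[OF k] by simp_all
  then show "e k \<subseteq> D (k - 1)" "e k \<subseteq> D k" by simp_all
  show "D (k - 1) \<noteq> D k" by (rule D(2)[OF k])
next
  show "inj_on e {1..n}" by (rule inj_on_subset[OF labelled_triangulation_edges(2)[OF L]]) auto
qed

text \<open>The flips produce a fan at \<open>u (Suc h)\<close>. As it already joins this vertex to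
  both ends of hinge \<open>Suc j\<close>, the quadrilateral around that still unflipped hinge has
  the corners \<open>u (Suc h)\<close> and \<open>w (Suc j)\<close>, and flipping it extends the fan
  to the next tip.\<close>

lemma (in triangle_chain) flips_reach_tips:
  fixes p :: "nat \<Rightarrow> 'a::field_char_0 \<times> 'a"
  assumes E: "E = e ` {1..2*n+3}" and S0: "realizes n p e S0"
    and nz: "\<And>k. k \<in> {1..n} \<Longrightarrow> chord_length p (e k) \<noteq> 0"
    and h: "h < n" and j: "h \<le> j" "j \<le> n"
  shows "\<exists>S e'. S \<in> reachable_seeds n (2*n+3) S0 \<and> realizes n p e' S \<and>
    (\<forall>l\<in>{1..2*n+3}. l \<notin> {Suc h..j} \<longrightarrow> e' l = e l) \<and>
    (\<forall>v\<in>D j. v \<noteq> u (Suc h) \<longrightarrow> {u (Suc h), v} \<in> e' ` {1..2*n+3}) \<and>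
    (Suc h \<le> j \<longrightarrow> e' j = {u (Suc h), w j})"
  using j
proof (induction j rule: dec_induct)
  case base
  have "{u (Suc h), v} \<in> E" if "v \<in> D h" "v \<noteq> u (Suc h)" for v
    using D_edge[of h "u (Suc h)" v] u_mem[of "Suc h"] that h by auto
  then show ?case
    using S0 reachable_seeds.initial[of S0 n "2*n+3"] unfolding E by (intro exI[of _ S0] exI[of _ e]) auto
next
  case (step j)
  have j: "h \<le> j" "Suc j \<le> n" "Suc j \<in> {1..n}" "Suc j \<in> {1..2*n+3}" "Suc h \<in> {1..n}" "j \<le> n" using step h by auto
  let ?I = "{1..2*n+3}" and ?u = "u (Suc h)" and ?w = "w (Suc j)"
  obtain S e' where S: "S \<in> reachable_seeds n (2*n+3) S0" "realizes n p e' S"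
    and same_all: "\<forall>l\<in>?I. l \<notin> {Suc h..j} \<longrightarrow> e' l = e l"
    and fan_all: "\<forall>v\<in>D j. v \<noteq> ?u \<longrightarrow> {?u, v} \<in> e' ` ?I"
    using step.IH[OF j(6)] by (elim exE conjE)
  note same = mp[OF bspec[OF same_all]]
  define E' where "E' = e' ` ?I"
  note fan = mp[OF bspec[OF fan_all[folded E'_def]]]
  obtain s t where st: "e (Suc j) = {s, t}" "s \<noteq> t" "D (Suc j) = {s, t, ?w}" "?w \<noteq> s" "?w \<noteq> t" "clockwise t ?w s"
    using j(3) by (elim hinge) (rule that)
  note facts = ear_facts[OF j(1,2) st(1,2)]
  have st_D: "s \<in> D j" "t \<in> D j" using e_left[OF j(3)] st(1) by auto
  have Ew: "{t, ?w} \<in> E" "{?w, s} \<in> E"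
    using D_edge[OF j(2)] st(3-5) by auto
  \<comment> \<open>The diagonals flipped so far do not end in the new tip, so all edges there are
    still present.\<close>
  have keep: "X \<in> E'" if X: "X \<in> E" "?w \<in> X" for X
  proof -
    obtain l where l: "l \<in> ?I" "X = e l" using X(1) unfolding E by (rule imageE)
    have "l \<notin> {Suc h..j}" using w_notin_e[OF j(3), of l] X(2) l(2) by auto
    then show ?thesis using same[OF l(1)] l unfolding E'_def by (metis imageI)
  qed
  have e'j: "e' (Suc j) = {s, t}" using same[OF j(4)] st(1) by simp
  have "separates ?u ?w s t" using crossing_far_tips[OF j(5,3)] j(1) unfolding st(1) crossing_iff by simp
  then have cw: "clockwise s ?u t"
    using st(6) unfolding separates_def clockwise_def nat_order_real by argo
  have "{s, t} \<in> E'" using e'j j(4) unfolding E'_def by (metis imageI)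
  then have q: "quad E' s ?u t ?w"
    unfolding quad_def using cw st(6) fan[OF st_D(1)] fan[OF st_D(2)] facts(7,8) keep[OF Ew(1)] keep[OF Ew(2)]
    by (simp add: insert_commute)
  let ?e = "e'(Suc j := {?u, ?w})" and ?S = "mutate n (2*n+3) (Suc j) S"
  have real: "realizes n p ?e ?S"
    using realizes_mutate[OF S(2) j(3) e'j q[unfolded E'_def]] nz[OF j(3)] st(1) by simp
  have L': "labelled_triangulation n e'" using S(2) by (simp only: realizes_def)
  have img: "?e ` ?I = flip E' s ?u t ?w"
    unfolding E'_def by (rule flip_image[OF L' j(3) e'j])
  have fan': "\<forall>v\<in>D (Suc j). v \<noteq> ?u \<longrightarrow> {?u, v} \<in> ?e ` ?I"
    unfolding img
  proof (intro ballI impI)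
    fix v assume v: "v \<in> D (Suc j)" "v \<noteq> ?u"
    show "{?u, v} \<in> flip E' s ?u t ?w"
    proof (cases "v = ?w")
      case True
      then show ?thesis by simp
    next
      case False
      then have "v \<in> D j" using v st(3) st_D by auto
      then have "{?u, v} \<in> E'" using v(2) by (rule fan)
      moreover have "{?u, v} \<noteq> {s, t}" using facts(7,8) by (auto simp: doubleton_eq_iff)
      ultimately show ?thesis by simp
    qed
  qed
  have "?S \<in> reachable_seeds n (2*n+3) S0" using S(1) j(3) by (rule reachable_seeds.step)
  moreover have "\<forall>l\<in>?I. l \<notin> {Suc h..Suc j} \<longrightarrow> ?e l = e l"
    using same j(1) by (simp add: atLeastAtMostSuc_conv)
  moreover have "Suc h \<le> Suc j \<longrightarrow> ?e (Suc j) = {?u, ?w}" by simp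
  ultimately show ?case using real fan' by (intro exI conjI)
qed

section \<open>Cluster variables and matchings\<close>

lemma eval_matching_sum: "eval y (matching_sum wt \<T> W) = matching_sum (\<lambda>a. eval y (wt a)) \<T> W"
  by (simp add: matching_sum_def)

lemma matching_sum_cong:
  assumes "\<And>a. a \<in> angles \<T> \<Longrightarrow> wt a = wt' a"
  shows "matching_sum wt \<T> W = matching_sum wt' \<T> W"
  unfolding matching_sum_def
proof (intro sum.cong refl prod.cong)
  fix A a assume "A \<in> matchings \<T> W" "a \<in> A"
  then have "a \<in> angles \<T>" unfolding matchings_def by blast
  then show "wt a = wt' a" by (rule assms)
qed

lemma free_generating_set_nonzero:
  fixes x :: "nat \<Rightarrow> 'a::field_char_0"
  assumes "free_generating_set I x" "l \<in> I"
  shows "x l \<noteq> 0"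
proof
  assume "x l = 0"
  then have "eval x (Var l) = 0" by simp
  moreover have "indets (Var l :: int mpoly) \<subseteq> I" using indets_Var[of l] assms(2) by blast
  ultimately have "Var l = (0 :: int mpoly)" using free_generating_set_eval_eq_0[OF assms(1)] by blast
  then have "Poly_Mapping.keys (Var l :: int mpoly) = {}" by simp
  then show False by (simp add: Var_def)
qed

locale path_seed = triangle_chain "n + 3" n "e ` {1..2*n+3}" e D
  for n :: nat and e D :: "nat \<Rightarrow> nat set" +
  fixes x :: "nat \<Rightarrow> 'a::field_char_0" and p :: "nat \<Rightarrow> 'a \<times> 'a"
  assumes L: "labelled_triangulation n e"
    and tri: "\<And>k. k \<in> {1..n} \<Longrightarrow> {\<Delta> \<in> triangles n e. e k \<subseteq> \<Delta>} = {D (k - 1), D k}"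
    and free: "free_generating_set {1..2*n+3} x"
    and p: "\<And>l. l \<in> {1..2*n+3} \<Longrightarrow> chord_length p (e l) = x l"
begin

abbreviation S0 :: "'a seed" where "S0 \<equiv> (x, Qbar_of n e)"

abbreviation opp_var :: "angle \<Rightarrow> int mpoly" where "opp_var a \<equiv> Var (opposite_label n e a)"

text \<open>Indices are shifted: \<open>F h j\<close> belongs to the pair
  \<open>(Suc h, Suc j)\<close>, \<open>h\<close> being the triangle before the first hinge.\<close>

definition F :: "nat \<Rightarrow> nat \<Rightarrow> int mpoly" where
  "F h j = path_sum opp_var h (Suc j) (w (Suc j))"

lemma x_nonzero: "l \<in> {1..2*n+3} \<Longrightarrow> x l \<noteq> 0"
  by (rule free_generating_set_nonzero[OF free])

lemma realizes_S0: "realizes n p e S0"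
  using L p by (simp add: realizes_def)

lemma subpolygon_triangles_eq:
  assumes "h \<le> j" "Suc j \<le> n"
  shows "subpolygon_triangles n e (Suc h) (Suc j) = D ` {h..Suc j}"
proof -
  have "subpolygon_triangles n e (Suc h) (Suc j) = (\<Union>k\<in>{Suc h..Suc j}. {\<Delta> \<in> triangles n e. e k \<subseteq> \<Delta>})"
    unfolding subpolygon_triangles_def by blast
  also have "\<dots> = (\<Union>k\<in>{Suc h..Suc j}. {D (k - 1), D k})"
    using assms by (intro SUP_cong refl tri) simp
  also have "\<dots> = D ` (\<Union>k\<in>{Suc h..Suc j}. {k - 1, k})" by blast
  also have "(\<Union>k\<in>{Suc h..Suc j}. {k - 1, k}) = {h..Suc j}"
  proof (intro equalityI subsetI)
    fix k assume k: "k \<in> {h..Suc j}"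
    show "k \<in> (\<Union>k\<in>{Suc h..Suc j}. {k - 1, k})"
    proof (cases "k = h")
      case True
      then show ?thesis using assms by (intro UN_I[of "Suc h"]) auto
    next
      case False
      then show ?thesis using k by (intro UN_I[of k]) auto
    qed
  qed auto
  finally show ?thesis .
qed

lemma angle_matchings_sum_eq:
  assumes "h \<le> j" "Suc j \<le> n"
  shows "(\<Sum>A\<in>angle_matchings (subpolygon_triangles n e (Suc h) (Suc j)) (subpolygon_diagonals e (Suc h) (Suc j)).
    \<Prod>a\<in>A. opp_var a) = F h j"
  unfolding subpolygon_triangles_eq[OF assms] subpolygon_diagonals_def F_def
  by (rule angle_matchings_chain[OF assms])

lemma opposite_label_in:
  assumes "k \<le> n" "v \<in> D k"
  shows "opposite_label n e (D k, v) \<in> {1..2*n+3}" "e (opposite_label n e (D k, v)) = D k - {v}"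
proof -
  have "card (D k - {v}) = 2" using D_card[OF assms(1)] assms(2) by simp
  then obtain v1 v2 where v: "D k - {v} = {v1, v2}" "v1 \<noteq> v2" by (auto simp: card_2_iff)
  then have "v1 \<in> D k" "v2 \<in> D k" by blast+
  then have "D k - {v} \<in> e ` {1..2*n+3}" unfolding v(1) using D_edge[OF assms(1)] v(2) by blast
  then show "opposite_label n e (D k, v) \<in> {1..2*n+3}" "e (opposite_label n e (D k, v)) = D k - {v}"
    unfolding opposite_label_def fst_conv snd_conv
    using the_inv_into_into[OF labelled_triangulation_edges(2)[OF L] _ order_refl]
      f_the_inv_into_f[OF labelled_triangulation_edges(2)[OF L]] by blast+
qed

text \<open>Evaluated twice: at \<open>x\<close> it yields chord lengths, at the point with a single
  zero coordinate it counts matchings and shows indivisibility.\<close>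

lemma eval_F:
  assumes h: "h \<le> j" "Suc j \<le> n"
    and wt: "\<And>k v. k \<le> n \<Longrightarrow> v \<in> D k \<Longrightarrow> y (opposite_label n e (D k, v)) = wt (D k, v)"
  shows "eval y (F h j) = path_sum wt h (Suc j) (w (Suc j))"
  unfolding F_def path_sum_def eval_matching_sum eval_Var
proof (rule matching_sum_cong)
  fix a assume "a \<in> angles (D ` {h..Suc j})"
  then obtain k v where "a = (D k, v)" "k \<in> {h..Suc j}" "v \<in> D k" unfolding angles_def by blast
  then show "y (opposite_label n e a) = wt a" using wt[of k v] h by simp
qed

lemma eval_x_F:
  assumes h: "h \<le> j" "Suc j \<le> n"
  shows "eval x (F h j) = chord_length p {u (Suc h), w (Suc j)} * (\<Prod>k=Suc h..Suc j. x k)"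
proof -
  have "eval x (F h j) = path_sum (\<lambda>(\<Delta>, v). chord_length p (\<Delta> - {v})) h (Suc j) (w (Suc j))"
    using opposite_label_in p by (intro eval_F[OF h]) (metis case_prod_conv)
  also have "\<dots> = chord_length p {u (Suc h), w (Suc j)} * (\<Prod>k=Suc h..Suc j. chord_length p (e k))"
  proof (rule path_sum_chord_length)
    show "w (Suc j) \<in> V h (Suc j)" unfolding V_insert[OF h] by blast
    have "Suc h \<in> {1..n}" "Suc j \<in> {1..n}" using h by auto
    then show "w (Suc j) \<noteq> u (Suc h)"
      using u_mem[of "Suc h"] w_notin[of "Suc j" h] h by auto
  qed (use h in auto)
  also have "(\<Prod>k=Suc h..Suc j. chord_length p (e k)) = (\<Prod>k=Suc h..Suc j. x k)"
    using h by (intro prod.cong refl p) auto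
  finally show ?thesis .
qed

lemma not_Var_dvd_F:
  assumes h: "h \<le> j" "Suc j \<le> n" and k: "k \<in> {1..n}"
  shows "\<not> Var k dvd F h j"
proof
  assume dvd: "Var k dvd F h j"
  let ?y = "\<lambda>l. if l = k then 0 else 1 :: int"
  let ?wt = "\<lambda>(\<Delta>, v). if \<Delta> - {v} = e k then 0 else 1 :: int"
  have kI: "k \<in> {1..2*n+3}" using k by simp
  have eq: "eval ?y (F h j) = path_sum ?wt h (Suc j) (w (Suc j))"
  proof (rule eval_F[OF h])
    fix l v assume lv: "l \<le> n" "v \<in> D l"
    have "opposite_label n e (D l, v) = k \<longleftrightarrow> D l - {v} = e k"
      using inj_on_eq_iff[OF labelled_triangulation_edges(2)[OF L] opposite_label_in(1)[OF lv] kI]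
      unfolding opposite_label_in(2)[OF lv] by blast
    then show "?y (opposite_label n e (D l, v)) = ?wt (D l, v)" by simp
  qed
  have "0 < path_sum ?wt h (Suc j) (w (Suc j))" using h by (intro path_sum_pos[OF _ k]) auto
  moreover have "eval ?y (F h j) = 0" by (rule eval_Var_dvd[OF dvd]) simp
  ultimately show False unfolding eq by simp
qed

lemma indets_F:
  assumes h: "h \<le> j" "Suc j \<le> n"
  shows "indets (F h j) \<subseteq> {1..2*n+3}"
  unfolding F_def path_sum_def matching_sum_def
proof (intro indets_sum indets_prod)
  fix A a assume "A \<in> matchings (D ` {h..Suc j}) (V h (Suc j) - {u (Suc h), w (Suc j)})" "a \<in> A"
  then have "a \<in> angles (D ` {h..Suc j})" unfolding matchings_def by blast
  then obtain k v where "a = (D k, v)" "k \<in> {h..Suc j}" "v \<in> D k" unfolding angles_def by blast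
  then have "opposite_label n e a \<in> {1..2*n+3}" using opposite_label_in(1)[of k v] h by simp
  then show "indets (opp_var a) \<subseteq> {1..2*n+3}" using indets_Var by blast
qed

lemma prod_x_nonzero: "i \<in> {1..n} \<Longrightarrow> j \<le> n \<Longrightarrow> (\<Prod>k=i..j. x k) \<noteq> 0"
  using x_nonzero by (subst prod_zero_iff) auto

text \<open>If the length were zero, algebraic independence would make \<open>F h j\<close> the zero
  polynomial, which every variable divides, against \<open>not_Var_dvd_F\<close>.\<close>

lemma chord_length_tips_nonzero:
  assumes h: "h \<le> j" "Suc j \<le> n"
  shows "chord_length p {u (Suc h), w (Suc j)} \<noteq> 0"
proof
  assume "chord_length p {u (Suc h), w (Suc j)} = 0"
  then have "eval x (F h j) = 0" using eval_x_F[OF h] by simp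
  then have "F h j = 0" using free_generating_set_eval_eq_0[OF free indets_F[OF h]] by blast
  then show False using not_Var_dvd_F[OF h, of "Suc j"] h by simp
qed

lemma chord_length_nonzero:
  assumes v: "v < n + 3" "v' < n + 3" "v \<noteq> v'"
  shows "chord_length p {v, v'} \<noteq> 0"
proof (cases rule: chord_cases[OF refl v])
  case 1
  then obtain l where "l \<in> {1..2*n+3}" "{v, v'} = e l" by (rule imageE)
  then show ?thesis using p x_nonzero by metis
next
  case (2 a b)
  then show ?thesis using chord_length_tips_nonzero[of "a - 1" "b - 1"] by simp
qed

section \<open>Cluster variables as chord lengths, and uniqueness of the numerator\<close>

lemma tips_cluster_variable:
  assumes h: "h \<le> j" "Suc j \<le> n"
  shows "chord_length p {u (Suc h), w (Suc j)} \<in> cluster_variables n (2*n+3) S0"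
proof -
  have "chord_length p (e k) \<noteq> 0" if "k \<in> {1..n}" for k using p[of k] x_nonzero[of k] that by simp
  from flips_reach_tips[OF refl realizes_S0 this, of h "Suc j"] h
  obtain S e' where S: "S \<in> reachable_seeds n (2*n+3) S0" "realizes n p e' S"
    and e': "Suc h \<le> Suc j \<longrightarrow> e' (Suc j) = {u (Suc h), w (Suc j)}"
    by auto
  have "fst S (Suc j) = chord_length p {u (Suc h), w (Suc j)}"
    using S(2) e' h unfolding realizes_def by simp
  then show ?thesis using S(1) h unfolding cluster_variables_def by (intro CollectI exI[of _ S] exI[of _ "Suc j"]) simp
qed

text \<open>The first alternative comes from edges of the initial triangulation, the second covers
  the other chords, by \<open>chord_cases\<close>. A second candidate for a numerator is excluded by
  running through this list.\<close>

lemma cluster_variable_chord: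
  assumes "z \<in> cluster_variables n (2*n+3) S0"
  obtains l where "l \<in> {1..2*n+3}" "z = x l"
  | h j where "h \<le> j" "Suc j \<le> n" "z = chord_length p {u (Suc h), w (Suc j)}"
proof -
  obtain S k where S: "S \<in> reachable_seeds n (2*n+3) S0" "k \<in> {1..n}" and z: "z = fst S k"
    using assms unfolding cluster_variables_def by blast
  obtain e' where e': "realizes n p e' S"
    using reachable_realizes[OF realizes_S0 S(1) chord_length_nonzero] by blast
  then have L': "labelled_triangulation n e'" and z: "z = chord_length p (e' k)"
    using S(2) z by (auto simp: realizes_def)
  have "e' k \<in> e' ` {1..2*n+3}" by (rule imageI) (use S(2) in auto)
  then obtain v v' where v: "v < n + 3" "v' < n + 3" "v \<noteq> v'" "e' k = {v, v'}"
    by (rule full_triangulation_edgeE[OF labelled_triangulation_edges(1)[OF L']])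
  show thesis
  proof (cases rule: chord_cases[OF refl v(1-3)])
    case 1
    then obtain l where "l \<in> {1..2*n+3}" "{v, v'} = e l" by (rule imageE)
    then show ?thesis using that(1)[of l] p[of l] z v(4) by simp
  next
    case (2 a b)
    then show ?thesis using that(2)[of "a - 1" "b - 1"] z v(4) by simp
  qed
qed

lemma is_numerator_F:
  assumes h: "h \<le> j" "Suc j \<le> n"
  shows "is_numerator n (2*n+3) S0 (Suc h) (Suc j) (F h j)"
proof -
  have "(\<Prod>k=Suc h..Suc j. x k) \<noteq> 0" using prod_x_nonzero[of "Suc h" "Suc j"] h by simp
  then have "eval x (F h j) / (\<Prod>k=Suc h..Suc j. x k) = chord_length p {u (Suc h), w (Suc j)}"
    unfolding eval_x_F[OF h] by (rule nonzero_mult_div_cancel_right)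
  then show ?thesis
    unfolding is_numerator_def fst_conv
    using indets_F[OF h] not_Var_dvd_F[OF h] tips_cluster_variable[OF h] by simp
qed

text \<open>A fraction with monomial denominator and a numerator divisible by no
  \<open>Var k\<close> with \<open>k \<le> n\<close> is in lowest terms, so equal values force equal
  denominators and hence equal numerators.\<close>

lemma is_numerator_imp_eq_F:
  assumes h: "h \<le> j" "Suc j \<le> n" and f: "is_numerator n (2*n+3) S0 (Suc h) (Suc j) f"
  shows "f = F h j"
proof -
  let ?P = "\<lambda>a b. \<Prod>k=a..b. (Var k :: int mpoly)"
  have f1: "indets f \<subseteq> {1..2*n+3}" and f2: "\<And>k. k \<in> {1..n} \<Longrightarrow> \<not> Var k dvd f"
    and f3: "eval x f / (\<Prod>k=Suc h..Suc j. x k) \<in> cluster_variables n (2*n+3) S0"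
    using f by (auto simp: is_numerator_def)
  have nz: "(\<Prod>k=Suc h..Suc j. x k) \<noteq> 0" using prod_x_nonzero[of "Suc h" "Suc j"] h by simp
  have indets_P: "indets (?P a b) \<subseteq> {1..2*n+3}" if "1 \<le> a" "b \<le> n" for a b
    using that by (intro indets_prod order_trans[OF indets_Var]) auto
  show ?thesis
    using f3
  proof (cases rule: cluster_variable_chord)
    case (1 l)
    then have "eval x f = eval x (Var l * ?P (Suc h) (Suc j))" using nz by (simp add: divide_eq_eq)
    moreover have "indets (Var l * ?P (Suc h) (Suc j)) \<subseteq> {1..2*n+3}"
      by (rule indets_mult[OF order_trans[OF indets_Var] indets_P]) (use 1 h in auto)
    ultimately have "f = Var l * ?P (Suc h) (Suc j)"
      using free_generating_set_eval_inj[OF free f1] by blast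
    \<comment> \<open>If the cluster variable were an edge length \<open>x l\<close>, then
      \<open>f\<close> would contain the whole denominator as a factor.\<close>
    moreover have "Var (Suc h) dvd ?P (Suc h) (Suc j)" using h by (intro dvd_prodI) auto
    ultimately have "Var (Suc h) dvd f" by (simp add: dvd_mult)
    then show ?thesis using f2[of "Suc h"] h by simp
  next
    case (2 h' j')
    let ?G = "F h' j'"
    have "eval x f = chord_length p {u (Suc h'), w (Suc j')} * (\<Prod>k=Suc h..Suc j. x k)"
      using 2(3) nz by (simp add: divide_eq_eq)
    then have "eval x (f * ?P (Suc h') (Suc j')) = eval x (?G * ?P (Suc h) (Suc j))"
      using eval_x_F[OF 2(1,2)] by simp
    moreover have "indets (f * ?P (Suc h') (Suc j')) \<subseteq> {1..2*n+3}"
      by (rule indets_mult[OF f1 indets_P]) (use 2 in auto)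
    moreover have "indets (?G * ?P (Suc h) (Suc j)) \<subseteq> {1..2*n+3}"
      by (rule indets_mult[OF indets_F[OF 2(1,2)] indets_P]) (use h in auto)
    ultimately have eq: "f * ?P (Suc h') (Suc j') = ?G * ?P (Suc h) (Suc j)"
      using free_generating_set_eval_inj[OF free] by blast
    \<comment> \<open>In \<open>eq\<close>, a variable occurring in only one of the two products
      would divide \<open>f\<close> or \<open>?G\<close>. So the two index intervals
      coincide.\<close>
    have sub1: "k \<in> {Suc h'..Suc j'}" if k: "k \<in> {Suc h..Suc j}" for k
    proof (rule ccontr)
      assume k': "k \<notin> {Suc h'..Suc j'}"
      have "Var k dvd ?P (Suc h) (Suc j)" using k by (intro dvd_prodI) auto
      then have "Var k dvd f * ?P (Suc h') (Suc j')" unfolding eq by (rule dvd_mult)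
      from Var_dvd_mult_prod_Var[OF this k'] have "Var k dvd f" .
      then show False using f2[of k] k h by simp
    qed
    have sub2: "k \<in> {Suc h..Suc j}" if k: "k \<in> {Suc h'..Suc j'}" for k
    proof (rule ccontr)
      assume k': "k \<notin> {Suc h..Suc j}"
      have "Var k dvd ?P (Suc h') (Suc j')" using k by (intro dvd_prodI) auto
      then have "Var k dvd ?G * ?P (Suc h) (Suc j)" unfolding eq[symmetric] by (rule dvd_mult)
      from Var_dvd_mult_prod_Var[OF this k'] have "Var k dvd ?G" .
      then show False using not_Var_dvd_F[OF 2(1,2), of k] k 2(2) by simp
    qed
    have "h' = h" "j' = j"
      using sub1[of "Suc h"] sub2[of "Suc h'"] sub1[of "Suc j"] sub2[of "Suc j'"] h 2(1) by auto
    then have "eval x f = eval x (F h j)"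
      using 2(3) nz eval_x_F[OF h] by (simp add: divide_eq_eq)
    then show ?thesis by (rule free_generating_set_eval_inj[OF free f1 indets_F[OF h]])
  qed
qed

lemma numerator_eq_F:
  assumes h: "h \<le> j" "Suc j \<le> n"
  shows "\<exists>!f. is_numerator n (2*n+3) S0 (Suc h) (Suc j) f"
    and "numerator n (2*n+3) S0 (Suc h) (Suc j) = F h j"
proof -
  show "\<exists>!f. is_numerator n (2*n+3) S0 (Suc h) (Suc j) f"
    by (rule ex1I[where a = "F h j"]) (rule is_numerator_F[OF h], erule is_numerator_imp_eq_F[OF h])
  show "numerator n (2*n+3) S0 (Suc h) (Suc j) = F h j"
    unfolding numerator_def
    by (rule the_equality) (rule is_numerator_F[OF h], erule is_numerator_imp_eq_F[OF h])
qed

end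

theorem theorem1p2:
  fixes n :: nat and e :: "nat \<Rightarrow> nat set" and x :: "nat \<Rightarrow> 'a::field_char_0"
  assumes "n \<ge> 1"
    and "labelled_triangulation n e"
    and "acyclic_path_quiver n (Q_of n e)"
    and "is_seed n (2*n+3) (x, Qbar_of n e)"
  shows "\<forall>i j. 1 \<le> i \<and> i \<le> j \<and> j \<le> n \<longrightarrow>
    (\<exists>!f. is_numerator n (2*n+3) (x, Qbar_of n e) i j f) \<and>
    numerator n (2*n+3) (x, Qbar_of n e) i j =
      (\<Sum>A\<in>angle_matchings (subpolygon_triangles n e i j) (subpolygon_diagonals e i j).
         \<Prod>a\<in>A. Var (opposite_label n e a))"
proof -
  let ?I = "{1..2*n+3}"
  \<comment> \<open>The initial variables, carried from labels to edges, are the determinants to be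
    prescribed.\<close>
  let ?y = "\<lambda>s. x (the_inv_into ?I e s)"
  have free: "free_generating_set ?I x" using assms(4) by (simp add: is_seed_Qbar_of_iff)
  note inj = labelled_triangulation_edges(2)[OF assms(2)]
  have y_nz: "?y s \<noteq> 0" if "s \<in> e ` ?I" for s
    by (rule free_generating_set_nonzero[OF free the_inv_into_into[OF inj that order_refl]])
  obtain p :: "nat \<Rightarrow> 'a \<times> 'a" where p: "\<And>s. s \<in> e ` ?I \<Longrightarrow> chord_length p s = ?y s"
    by (rule exists_chord_length[OF labelled_triangulation_edges(1)[OF assms(2)] y_nz]) auto
  have p: "chord_length p (e l) = x l" if "l \<in> ?I" for l
    unfolding p[OF imageI[OF that]] the_inv_into_f_f[OF inj that] ..
  obtain D where D: "\<And>k. k \<in> {1..n} \<Longrightarrow> {\<Delta> \<in> triangles n e. e k \<subseteq> \<Delta>} = {D (k - 1), D k}"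
    "\<And>k. k \<in> {1..n} \<Longrightarrow> D (k - 1) \<noteq> D k"
    using path_quiver_triangles[OF assms(2,3,1)] by metis
  interpret triangle_chain "n + 3" n "e ` ?I" e D
    by (rule path_quiver_chain[OF assms(2,1) D])
  interpret path_seed n e D x p
    by unfold_locales (rule assms(2) D(1) free p; assumption)+
  show ?thesis
  proof (intro allI impI)
    fix i j assume ij: "1 \<le> i \<and> i \<le> j \<and> j \<le> n"
    then obtain h j' where h: "i = Suc h" "j = Suc j'" by (metis Suc_le_D One_nat_def le_trans)
    then have h': "h \<le> j'" "Suc j' \<le> n" using ij by auto
    show "(\<exists>!f. is_numerator n (2*n+3) (x, Qbar_of n e) i j f) \<and>
      numerator n (2*n+3) (x, Qbar_of n e) i j =
      (\<Sum>A\<in>angle_matchings (subpolygon_triangles n e i j) (subpolygon_diagonals e i j).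
         \<Prod>a\<in>A. Var (opposite_label n e a))"
      unfolding h angle_matchings_sum_eq[OF h'] using numerator_eq_F[OF h'] by blast
  qed
qed

end
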